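(* Let $Y\subset H^\infty(\mathbb{D})$ be a subspace which is preserved as a set when composing its functions from the inside with surjective Möbius transformations of the disk, i.e. $f\circ\phi\in Y$ for every $f\in Y$ and every Möbius transformation $\phi$ of $\mathbb{D}$ onto itself. Let $A\subset L^\infty(\partial\mathbb{D})$ be the sub-$C^*$-algebra of $L^\infty(\partial\mathbb{D})$ generated by (the boundary functions of the elements of) $Y$. Then $A$ is $\omega^*$-convex-transitive with respect to the group of weighted composition operators on $A$ of the form $$ f\mapsto u\cdot (f\circ\phi), $$ where $u\in A$ satisfies $|u|=1$ a.e. on $\partial\mathbb{D}$ and $\phi$ is a Möbius transformation of the unit disk onto itself.
   Context: All Banach spaces are complex. $\mathbb{D}$ is the open unit disk and $\partial\mathbb{D}$ its boundary with Lebesgue measure $m$; $L^\infty(\partial\mathbb{D})=L^\infty(\partial\mathbb{D},m)$ with its usual $C^*$-algebra structure (pointwise operations, complex conjugation, essential supremum norm). $H^\infty(\mathbb{D})$ is the algebra of bounded analytic functions on $\mathbb{D}$ with the supremum norm, identified isometrically with a closed subalgebra of $L^\infty(\partial\mathbb{D})$ via radial boundary values. A Möbius transformation $\phi$ of $\mathbb{D}$ onto itself extends to a bilipschitz homeomorphism of $\partial\mathbb{D}$ onto itself, so $f\circ\phi$ makes sense for $f\in L^\infty(\partial\mathbb{D})$. $B_A$ and $S_A$ are the closed unit ball and unit sphere of $A$. On $A$, $\omega^*$ denotes the topology $\sigma(A,L^1)$, i.e. the relative topology inherited from the weak-star topology of $L^\infty(\partial\mathbb{D})=(L^1(\partial\mathbb{D}))^*$.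 For a group $G$ of linear isometric isomorphisms of $A$ onto $A$, $A$ is $\omega^*$-convex-transitive with respect to $G$ if $\overline{\mathrm{conv}}^{\,\omega^*}\{T(x): T\in G\}=B_A$ for every $x\in S_A$ (closure taken in $A$). *)

theory Defs
  imports
    "HOL-Probability.Essential_Supremum"
    "HOL-Analysis.Analysis"
    "HOL-Algebra.Bij"
begin

section \<open>The Banach algebra of essentially bounded functions on the circle\<close>

text \<open>Arc length measure on the Borel sets of the unit circle (total mass \<open>2 * pi\<close>; the
  normalisation is irrelevant for null sets, essential suprema and the weak-star topology).\<close>

definition circle :: "complex measure" where
  "circle = distr (restrict_space lborel {0..<2*pi}) (restrict_space borel (sphere 0 1)) cis"

lemma space_circle [simp]: "space circle = sphere 0 1"
  by (simp add: circle_def space_restrict_space)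

lemma emeasure_circle: "emeasure circle (space circle) = ennreal (2 * pi)"
proof -
  have m: "cis \<in> restrict_space lborel {0..<2*pi} \<rightarrow>\<^sub>M restrict_space borel (sphere 0 1)"
  proof (rule measurable_restrict_space2)
    show "cis \<in> space (restrict_space lborel {0..<2*pi}) \<rightarrow> sphere 0 1" by auto
    have "cis \<in> borel_measurable (borel :: real measure)"
      by (intro borel_measurable_continuous_onI continuous_intros)
    then have "cis \<in> borel_measurable lborel" by simp
    then show "cis \<in> borel_measurable (restrict_space lborel {0..<2*pi})"
      by (rule measurable_restrict_space1)
  qed
  have "cis -` sphere 0 1 \<inter> space (restrict_space lborel {0..<2*pi}) = {0..<2*pi}"
    by (auto simp: space_restrict_space)
  moreover have "space (restrict_space borel (sphere (0::complex) 1)) = sphere 0 1"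
    by (simp add: space_restrict_space)
  moreover have "sphere 0 1 \<in> sets (restrict_space borel (sphere (0::complex) 1))"
    using sets.top[of "restrict_space borel (sphere (0::complex) 1)"]
    by (simp add: space_restrict_space)
  ultimately have "emeasure circle (space circle)
      = emeasure (restrict_space lborel {0..<2*pi}) {0..<2*pi}"
    unfolding space_circle by (simp add: circle_def emeasure_distr[OF m])
  then show ?thesis by (simp add: emeasure_restrict_space)
qed

lemma AE_circle_const [simp]: "(AE z in circle. P) \<longleftrightarrow> P"
proof -
  have "ae_filter circle \<noteq> bot"
    unfolding ae_filter_eq_bot_iff emeasure_circle by (simp add: ennreal_eq_0_iff not_le)
  then show ?thesis by (simp add: eventually_const)
qed

definition ess_bounded :: "(complex \<Rightarrow> complex) \<Rightarrow> bool" where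
  "ess_bounded f \<longleftrightarrow> f \<in> borel_measurable circle \<and> (\<exists>C. AE z in circle. cmod (f z) \<le> C)"

definition linf_rel :: "(complex \<Rightarrow> complex) \<Rightarrow> (complex \<Rightarrow> complex) \<Rightarrow> bool" where
  "linf_rel f g \<longleftrightarrow> ess_bounded f \<and> ess_bounded g \<and> (AE z in circle. f z = g z)"

lemma ess_bounded_measurable: "ess_bounded f \<Longrightarrow> f \<in> borel_measurable circle"
  by (simp add: ess_bounded_def)

lemma ess_bounded_const: "ess_bounded (\<lambda>z. c)"
  unfolding ess_bounded_def by auto

lemma ess_bounded_add:
  assumes "ess_bounded f" "ess_bounded g"
  shows "ess_bounded (\<lambda>z. f z + g z)"
proof -
  from assms obtain C D where "AE z in circle. cmod (f z) \<le> C" "AE z in circle. cmod (g z) \<le> D"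
    by (auto simp: ess_bounded_def)
  then have "AE z in circle. cmod (f z + g z) \<le> C + D"
    by eventually_elim (meson add_mono norm_triangle_ineq order_trans)
  with assms show ?thesis by (auto simp: ess_bounded_def)
qed

lemma ess_bounded_mult:
  assumes "ess_bounded f" "ess_bounded g"
  shows "ess_bounded (\<lambda>z. f z * g z)"
proof -
  from assms obtain C D where "AE z in circle. cmod (f z) \<le> C" "AE z in circle. cmod (g z) \<le> D"
    by (auto simp: ess_bounded_def)
  then have "AE z in circle. cmod (f z * g z) \<le> C * D"
  proof eventually_elim
    case (elim z)
    have "0 \<le> C" using elim(1) norm_ge_zero order_trans by blast
    with elim show ?case by (simp add: norm_mult mult_mono)
  qed
  with assms show ?thesis by (auto simp: ess_bounded_def)
qed

lemma ess_bounded_cmult: "ess_bounded f \<Longrightarrow> ess_bounded (\<lambda>z. c * f z)"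
  using ess_bounded_mult[OF ess_bounded_const] .

lemma ess_bounded_minus: "ess_bounded f \<Longrightarrow> ess_bounded (\<lambda>z. - f z)"
  using ess_bounded_cmult[of f "-1"] by simp

lemma ess_bounded_diff: "ess_bounded f \<Longrightarrow> ess_bounded g \<Longrightarrow> ess_bounded (\<lambda>z. f z - g z)"
  using ess_bounded_add[OF _ ess_bounded_minus, of f g] by simp

lemma ess_bounded_scaleR: "ess_bounded f \<Longrightarrow> ess_bounded (\<lambda>z. r *\<^sub>R f z)"
  using ess_bounded_cmult[of f "of_real r"] by (simp add: scaleR_conv_of_real)

lemma ess_bounded_cnj: "ess_bounded f \<Longrightarrow> ess_bounded (\<lambda>z. cnj (f z))"
proof -
  assume f: "ess_bounded f"
  have "cnj \<in> borel_measurable borel"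
    by (intro borel_measurable_continuous_onI continuous_intros)
  from measurable_compose[OF ess_bounded_measurable[OF f] this] f show ?thesis
    by (auto simp: ess_bounded_def)
qed

lemma part_equivp_linf_rel: "part_equivp linf_rel"
proof (rule part_equivpI)
  show "\<exists>f. linf_rel f f" by (auto simp: linf_rel_def intro: ess_bounded_const)
  show "symp linf_rel" by (auto simp: symp_def linf_rel_def elim: eventually_mono)
  show "transp linf_rel"
    unfolding transp_def linf_rel_def
    by (auto elim: eventually_elim2)
qed

quotient_type linf = "complex \<Rightarrow> complex" / partial: linf_rel
  by (rule part_equivp_linf_rel)

lemma ess_bounded_rep: "ess_bounded (rep_linf f)"
  using Quotient3_rep_reflp[OF Quotient3_linf, of f] by (simp add: linf_rel_def)

definition ess_norm :: "(complex \<Rightarrow> complex) \<Rightarrow> real" where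
  "ess_norm f = real_of_ereal (esssup circle (\<lambda>z. ereal (cmod (f z))))"

lemma esssup_ess_norm:
  assumes "ess_bounded f"
  shows "esssup circle (\<lambda>z. ereal (cmod (f z))) = ereal (ess_norm f)" "0 \<le> ess_norm f"
proof -
  let ?s = "esssup circle (\<lambda>z. ereal (cmod (f z)))"
  have m: "(\<lambda>z. ereal (cmod (f z))) \<in> borel_measurable circle"
    using ess_bounded_measurable[OF assms] by simp
  obtain C where C: "AE z in circle. cmod (f z) \<le> C" using assms by (auto simp: ess_bounded_def)
  have "?s \<le> ereal C" using C by (intro esssup_I[OF m]) simp
  then have "?s \<noteq> \<infinity>" by auto
  moreover have "AE z in circle. ereal (cmod (f z)) \<le> ?s" by (rule esssup_AE)
  then have "AE z in circle. 0 \<le> ?s"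
    by eventually_elim (meson ereal_less_eq(5) norm_ge_zero order_trans)
  then have ge: "0 \<le> ?s" by simp
  ultimately show "?s = ereal (ess_norm f)"
    unfolding ess_norm_def by (subst ereal_real) auto
  show "0 \<le> ess_norm f" using ge by (simp add: ess_norm_def real_of_ereal_pos)
qed

lemma ess_norm_AE:
  assumes "ess_bounded f"
  shows "AE z in circle. cmod (f z) \<le> ess_norm f"
  using esssup_AE[of "\<lambda>z. ereal (cmod (f z))" circle] unfolding esssup_ess_norm[OF assms] by simp

lemma ess_norm_le:
  assumes "ess_bounded f" "AE z in circle. cmod (f z) \<le> c"
  shows "ess_norm f \<le> c"
proof -
  have "(\<lambda>z. ereal (cmod (f z))) \<in> borel_measurable circle"
    using ess_bounded_measurable[OF assms(1)] by simp
  then have "esssup circle (\<lambda>z. ereal (cmod (f z))) \<le> ereal c"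
    using assms(2) by (intro esssup_I) simp_all
  then show ?thesis unfolding esssup_ess_norm[OF assms(1)] by simp
qed

instantiation linf :: "{real_algebra_1, comm_ring_1}"
begin

lift_definition zero_linf :: linf is "\<lambda>z. 0"
  by (simp add: linf_rel_def ess_bounded_const)
lift_definition one_linf :: linf is "\<lambda>z. 1"
  by (simp add: linf_rel_def ess_bounded_const)
lift_definition plus_linf :: "linf \<Rightarrow> linf \<Rightarrow> linf" is "\<lambda>f g z. f z + g z"
  by (auto simp: linf_rel_def intro: ess_bounded_add elim: eventually_elim2)
lift_definition minus_linf :: "linf \<Rightarrow> linf \<Rightarrow> linf" is "\<lambda>f g z. f z - g z"
  by (auto simp: linf_rel_def intro: ess_bounded_diff elim: eventually_elim2)
lift_definition uminus_linf :: "linf \<Rightarrow> linf" is "\<lambda>f z. - f z"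
  by (auto simp: linf_rel_def intro: ess_bounded_minus)
lift_definition times_linf :: "linf \<Rightarrow> linf \<Rightarrow> linf" is "\<lambda>f g z. f z * g z"
  by (auto simp: linf_rel_def intro: ess_bounded_mult elim: eventually_elim2)
lift_definition scaleR_linf :: "real \<Rightarrow> linf \<Rightarrow> linf" is "\<lambda>r f z. r *\<^sub>R f z"
  by (auto simp: linf_rel_def intro: ess_bounded_scaleR elim: eventually_mono)
instance
proof
  fix a b c :: linf and r s :: real
  note intros = ess_bounded_add ess_bounded_diff ess_bounded_mult ess_bounded_minus
    ess_bounded_scaleR ess_bounded_const
  show "a + b + c = a + (b + c)"
    by transfer (auto simp: linf_rel_def algebra_simps intro!: intros)
  show "a + b = b + a"
    by transfer (auto simp: linf_rel_def algebra_simps intro!: intros)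
  show "0 + a = a"
    by transfer (auto simp: linf_rel_def algebra_simps intro!: intros)
  show "- a + a = 0"
    by transfer (auto simp: linf_rel_def algebra_simps intro!: intros)
  show "a - b = a + - b"
    by transfer (auto simp: linf_rel_def algebra_simps intro!: intros)
  show "r *\<^sub>R (a + b) = r *\<^sub>R a + r *\<^sub>R b"
    by transfer (auto simp: linf_rel_def algebra_simps intro!: intros)
  show "(r + s) *\<^sub>R a = r *\<^sub>R a + s *\<^sub>R a"
    by transfer (auto simp: linf_rel_def algebra_simps intro!: intros)
  show "r *\<^sub>R s *\<^sub>R a = (r * s) *\<^sub>R a"
    by transfer (auto simp: linf_rel_def algebra_simps intro!: intros)
  show "1 *\<^sub>R a = a"
    by transfer (auto simp: linf_rel_def algebra_simps intro!: intros)
  show "a * b * c = a * (b * c)"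
    by transfer (auto simp: linf_rel_def algebra_simps intro!: intros)
  show "a * b = b * a"
    by transfer (auto simp: linf_rel_def algebra_simps intro!: intros)
  show "(a + b) * c = a * c + b * c"
    by transfer (auto simp: linf_rel_def algebra_simps intro!: intros)
  show "r *\<^sub>R a * b = r *\<^sub>R (a * b)"
    by transfer (auto simp: linf_rel_def algebra_simps intro!: intros)
  show "a * r *\<^sub>R b = r *\<^sub>R (a * b)"
    by transfer (auto simp: linf_rel_def algebra_simps intro!: intros)
  show "a * (b + c) = a * b + a * c"
    by transfer (auto simp: linf_rel_def algebra_simps intro!: intros)
  show "a * 1 = a"
    by transfer (auto simp: linf_rel_def algebra_simps intro!: intros)
  show "1 * a = a"
    by transfer (auto simp: linf_rel_def algebra_simps intro!: intros)
  show "(0::linf) \<noteq> 1"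
    by transfer (simp add: linf_rel_def)
qed

end

instantiation linf :: real_normed_algebra_1
begin

lift_definition norm_linf :: "linf \<Rightarrow> real" is ess_norm
proof -
  fix f g assume fg: "linf_rel f g"
  have "esssup circle (\<lambda>z. ereal (cmod (f z))) = esssup circle (\<lambda>z. ereal (cmod (g z)))"
    using fg by (intro esssup_AE_cong) (auto simp: linf_rel_def ess_bounded_def elim: eventually_mono)
  then show "ess_norm f = ess_norm g" by (simp add: ess_norm_def)
qed

definition "dist f g = norm (f - g)" for f g :: linf
definition "sgn f = f /\<^sub>R norm f" for f :: linf
definition "(uniformity :: (linf \<times> linf) filter) = (INF e\<in>{0<..}. principal {(x, y). dist x y < e})"
definition "open (U :: linf set) \<longleftrightarrow> (\<forall>x\<in>U. \<forall>\<^sub>F (x', y) in uniformity. x' = x \<longrightarrow> y \<in> U)"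

instance
proof
  fix a b :: linf and r :: real
  show "dist a b = norm (a - b)" by (rule dist_linf_def)
  show "sgn a = a /\<^sub>R norm a" by (rule sgn_linf_def)
  show "(uniformity :: (linf \<times> linf) filter) = (INF e\<in>{0<..}. principal {(x, y). dist x y < e})"
    by (rule uniformity_linf_def)
  show "open U \<longleftrightarrow> (\<forall>x\<in>U. \<forall>\<^sub>F (x', y) in uniformity. x' = x \<longrightarrow> y \<in> U)" for U :: "linf set"
    by (rule open_linf_def)
  show "norm a = 0 \<longleftrightarrow> a = 0"
  proof transfer
    fix f assume "linf_rel f f"
    then have f: "ess_bounded f" by (simp add: linf_rel_def)
    show "ess_norm f = 0 \<longleftrightarrow> linf_rel f (\<lambda>z. 0)"
    proof
      assume "ess_norm f = 0"
      then show "linf_rel f (\<lambda>z. 0)"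
        using ess_norm_AE[OF f] f by (auto simp: linf_rel_def ess_bounded_const)
    next
      assume "linf_rel f (\<lambda>z. 0)"
      then have "AE z in circle. cmod (f z) \<le> 0" by (simp add: linf_rel_def)
      then show "ess_norm f = 0"
        using ess_norm_le[OF f, of 0] esssup_ess_norm(2)[OF f] by simp
    qed
  qed
  show "norm (a + b) \<le> norm a + norm b"
  proof transfer
    fix f g assume "linf_rel f f" "linf_rel g g"
    then have f: "ess_bounded f" and g: "ess_bounded g" by (simp_all add: linf_rel_def)
    have "AE z in circle. cmod (f z + g z) \<le> ess_norm f + ess_norm g"
      using ess_norm_AE[OF f] ess_norm_AE[OF g]
      by eventually_elim (meson add_mono norm_triangle_ineq order_trans)
    then show "ess_norm (\<lambda>z. f z + g z) \<le> ess_norm f + ess_norm g"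
      by (intro ess_norm_le ess_bounded_add f g)
  qed
  show "norm (r *\<^sub>R a) = \<bar>r\<bar> * norm a"
  proof transfer
    fix r f assume "linf_rel f f"
    then have f: "ess_bounded f" by (simp add: linf_rel_def)
    have le: "ess_norm (\<lambda>z. t *\<^sub>R g z) \<le> \<bar>t\<bar> * ess_norm g" if g: "ess_bounded g" for t g
      using ess_norm_AE[OF g]
      by (intro ess_norm_le ess_bounded_scaleR g) (auto elim!: eventually_mono intro: mult_left_mono)
    show "ess_norm (\<lambda>z. r *\<^sub>R f z) = \<bar>r\<bar> * ess_norm f"
    proof (cases "r = 0")
      case True
      then show ?thesis
        using le[OF f, of 0] esssup_ess_norm(2)[OF ess_bounded_scaleR[OF f, of 0]] by simp
    next
      case False
      have "ess_norm f \<le> \<bar>inverse r\<bar> * ess_norm (\<lambda>z. r *\<^sub>R f z)"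
        using le[OF ess_bounded_scaleR[OF f, of r], of "inverse r"] False by simp
      then have "\<bar>r\<bar> * ess_norm f \<le> ess_norm (\<lambda>z. r *\<^sub>R f z)"
        using False by (simp add: field_simps abs_inverse)
      with le[OF f, of r] show ?thesis by linarith
    qed
  qed
  show "norm (a * b) \<le> norm a * norm b"
  proof transfer
    fix f g assume "linf_rel f f" "linf_rel g g"
    then have f: "ess_bounded f" and g: "ess_bounded g" by (simp_all add: linf_rel_def)
    have "AE z in circle. cmod (f z * g z) \<le> ess_norm f * ess_norm g"
      using ess_norm_AE[OF f] ess_norm_AE[OF g]
      by eventually_elim (simp add: norm_mult mult_mono esssup_ess_norm(2)[OF f])
    then show "ess_norm (\<lambda>z. f z * g z) \<le> ess_norm f * ess_norm g"
      by (intro ess_norm_le ess_bounded_mult f g)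
  qed
  show "norm (1::linf) = 1"
  proof transfer
    have "AE z in circle. (1::real) \<le> ess_norm (\<lambda>z. 1)"
      using ess_norm_AE[OF ess_bounded_const[of 1]] by simp
    then have "1 \<le> ess_norm (\<lambda>z. 1)" by simp
    moreover have "ess_norm (\<lambda>z. 1) \<le> 1"
      by (rule ess_norm_le[OF ess_bounded_const]) simp
    ultimately show "ess_norm (\<lambda>z. 1) = 1" by simp
  qed
qed

end

lift_definition scaleC_linf :: "complex \<Rightarrow> linf \<Rightarrow> linf" is "\<lambda>c f z. c * f z"
  by (auto simp: linf_rel_def intro: ess_bounded_cmult elim: eventually_mono)

lift_definition cnj_linf :: "linf \<Rightarrow> linf" is "\<lambda>f z. cnj (f z)"
  by (auto simp: linf_rel_def intro: ess_bounded_cnj elim: eventually_mono)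

section \<open>Sub-C*-algebras\<close>

text \<open>Sub-C*-algebras are understood to contain the unit of the ambient algebra. Without the unit the
  set of weighted composition operators below may be empty, hence not a group: an outer function
  \<open>f\<close> with \<open>- ln \<bar>f\<bar>\<close> the sum of a series of logarithmic singularities at a dense set of boundary
  points generates, with its compositions \<open>f \<circ> \<phi>\<close>, a non-unital algebra all of whose elements
  have essential infimum \<open>0\<close> in modulus.\<close>

definition sub_cstar_algebra :: "linf set \<Rightarrow> bool" where
  "sub_cstar_algebra B \<longleftrightarrow>
     1 \<in> B \<and>
     (\<forall>f\<in>B. \<forall>g\<in>B. f + g \<in> B) \<and>
     (\<forall>c. \<forall>f\<in>B. scaleC_linf c f \<in> B) \<and>
     (\<forall>f\<in>B. \<forall>g\<in>B. f * g \<in> B) \<and>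
     (\<forall>f\<in>B. cnj_linf f \<in> B) \<and>
     closed B"

definition cstar_generated :: "linf set \<Rightarrow> linf set" where
  "cstar_generated S = sub_cstar_algebra hull S"

section \<open>Bounded analytic functions and Moebius transformations\<close>

text \<open>A function on the open disk is represented by its extension by zero to the whole plane, so
  that equality of representatives is equality on the disk.\<close>

definition Hinf :: "(complex \<Rightarrow> complex) set" where
  "Hinf = {f. f holomorphic_on ball 0 1 \<and> bounded (f ` ball 0 1) \<and> (\<forall>z. z \<notin> ball 0 1 \<longrightarrow> f z = 0)}"

definition linear_subspace_Hinf :: "(complex \<Rightarrow> complex) set \<Rightarrow> bool" where
  "linear_subspace_Hinf Y \<longleftrightarrow>
     Y \<subseteq> Hinf \<and>
     (\<lambda>z. 0) \<in> Y \<and>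
     (\<forall>f\<in>Y. \<forall>g\<in>Y. (\<lambda>z. f z + g z) \<in> Y) \<and>
     (\<forall>c. \<forall>f\<in>Y. (\<lambda>z. c * f z) \<in> Y)"

text \<open>Moebius transformations of the disk onto itself. Such a transformation has no pole in the
  closed disk (its image of the disk would otherwise be unbounded), so the convention \<open>x / 0 = 0\<close>
  plays no role on the disk or on its boundary.\<close>

definition disk_moebius :: "(complex \<Rightarrow> complex) set" where
  "disk_moebius = {\<phi>. (\<exists>a b c d. a * d - b * c \<noteq> 0 \<and> \<phi> = (\<lambda>z. (a * z + b) / (c * z + d)))
                      \<and> \<phi> ` ball 0 1 = ball 0 1}"

definition disk_compose :: "(complex \<Rightarrow> complex) \<Rightarrow> (complex \<Rightarrow> complex) \<Rightarrow> (complex \<Rightarrow> complex)" where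
  "disk_compose f \<phi> = (\<lambda>z. if z \<in> ball 0 1 then f (\<phi> z) else 0)"

text \<open>Radial limits of a function in \<open>Hinf\<close> exist almost everywhere (Fatou); the value \<open>0\<close> at the
  exceptional points does not affect the class of the boundary function.\<close>

definition radial_limit :: "(complex \<Rightarrow> complex) \<Rightarrow> complex \<Rightarrow> complex" where
  "radial_limit f \<zeta> =
     (if \<exists>l. ((\<lambda>r. f (complex_of_real r * \<zeta>)) \<longlongrightarrow> l) (at_left 1)
      then Lim (at_left 1) (\<lambda>r. f (complex_of_real r * \<zeta>)) else 0)"

definition boundary_function :: "(complex \<Rightarrow> complex) \<Rightarrow> linf" where
  "boundary_function f = abs_linf (radial_limit f)"

section \<open>Weighted composition operators\<close>

text \<open>For \<open>\<phi>\<close> in \<open>disk_moebius\<close> the class does not depend on the chosen representative, since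
  \<open>\<phi>\<close> restricts to a bilipschitz homeomorphism of the circle.\<close>

definition compose_linf :: "linf \<Rightarrow> (complex \<Rightarrow> complex) \<Rightarrow> linf" where
  "compose_linf f \<phi> = abs_linf (\<lambda>z. rep_linf f (\<phi> z))"

definition unimodular :: "linf \<Rightarrow> bool" where
  "unimodular u \<longleftrightarrow> (AE z in circle. cmod (rep_linf u z) = 1)"

definition weighted_composition_operators :: "linf set \<Rightarrow> (linf \<Rightarrow> linf) set" where
  "weighted_composition_operators A =
     {(\<lambda>f\<in>A. u * compose_linf f \<phi>) | u \<phi>. u \<in> A \<and> unimodular u \<and> \<phi> \<in> disk_moebius}"

section \<open>Weak-star convex-transitivity\<close>

definition weak_star :: "linf topology" where
  "weak_star = topology_generated_by
     {{f. (LINT z|circle. rep_linf f z * g z) \<in> U} | g U.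
        integrable circle (g :: complex \<Rightarrow> complex) \<and> open (U :: complex set)}"

text \<open>A group, under composition, of linear isometric isomorphisms of \<open>A\<close> onto \<open>A\<close>.\<close>

definition isometry_group :: "linf set \<Rightarrow> (linf \<Rightarrow> linf) set \<Rightarrow> bool" where
  "isometry_group A G \<longleftrightarrow>
     subgroup G (BijGroup A) \<and>
     (\<forall>T\<in>G. (\<forall>f\<in>A. \<forall>g\<in>A. T (f + g) = T f + T g) \<and>
             (\<forall>c. \<forall>f\<in>A. T (scaleC_linf c f) = scaleC_linf c (T f)) \<and>
             (\<forall>f\<in>A. norm (T f) = norm f))"

definition weak_star_convex_transitive :: "linf set \<Rightarrow> (linf \<Rightarrow> linf) set \<Rightarrow> bool" where
  "weak_star_convex_transitive A G \<longleftrightarrow>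
     isometry_group A G \<and>
     (\<forall>x\<in>A. norm x = 1 \<longrightarrow>
        (subtopology weak_star A) closure_of (convex hull {T x | T. T \<in> G}) = {y \<in> A. norm y \<le> 1})"

end

theory Submission
  imports Defs "HOL-Complex_Analysis.Cauchy_Integral_Formula"
begin

text \<open>Let \<open>x\<close> be in the unit sphere of \<open>A\<close>. In the Cayley coordinate of the circle the Moebius group contains the
  affine maps of the line, so zooming in on intervals in which the set \<open>\<bar>x\<bar> > 1 - \<epsilon>\<close> has almost full
  density and applying Borel--Cantelli gives Moebius maps \<open>\<phi>\<^sub>n\<close> such that \<open>h\<^sub>n = x \<circ> \<phi>\<^sub>n\<close> satisfies
  \<open>\<bar>h\<^sub>n\<bar> \<rightarrow> 1\<close> almost everywhere. For \<open>y\<close> in the unit ball of \<open>A\<close> and \<open>c\<^sub>n \<up> 1\<close>, the Russo--Dye theorem provides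
  convex combinations \<open>v\<^sub>n\<close> of unimodular elements of \<open>A\<close> close to \<open>c\<^sub>n * cnj h\<^sub>n * y\<close>. Then \<open>v\<^sub>n * h\<^sub>n\<close> is a convex
  combination of elements \<open>u * (x \<circ> \<phi>\<^sub>n)\<close>, and it is close to \<open>c\<^sub>n * \<bar>h\<^sub>n\<bar>\<^sup>2 * y\<close>, which tends to \<open>y\<close> almost
  everywhere and boundedly, hence weak-star.

  That \<open>A\<close> is invariant under composition needs no theorem of Fatou: at each single boundary point, \<open>f \<circ> \<phi>\<close> has a
  radial limit if and only if \<open>f\<close> has one at the image point, and the two limits agree.\<close>

section \<open>Essentially bounded functions\<close>

text \<open>Dividing by \<open>h_n\<close> would be the direct way to reach \<open>y\<close>, but
  \<open>x\<close> may vanish on large sets, and then \<open>h_n\<close> has no inverse in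
  \<open>A\<close>. The conjugate \<open>cnj h_n\<close> stands in for the inverse at the price of a
  factor \<open>\<bar>h_n\<bar>^2\<close>, and this is why
  \<open>\<bar>h_n\<bar> \<rightarrow> 1\<close> has to be arranged; the phase of \<open>x\<close>
  never has to be controlled, because the weights absorb it. Zooming is done on the line since
  affine maps scale all lengths by one constant and so preserve relative densities exactly, while
  Moebius maps distort arc length unevenly; only null sets are carried between line and circle. The
  factor \<open>c_n < 1\<close> moves the target into the open unit ball: there
  \<open>1 + \<lambda> * cnj a\<close> is inverted by a Neumann series, so that the unimodular
  functions \<open>(\<lambda> + a) / (1 + \<lambda> * cnj a)\<close> belong to \<open>A\<close>. The
  opposite inclusion rests on the unit ball being weak-star closed.\<close>

lemma rep_abs_linf:
  assumes "ess_bounded f"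
  shows "AE z in circle. rep_linf (abs_linf f) z = f z"
  using Quotient3_rep_abs[OF Quotient3_linf, of f] assms by (simp add: linf_rel_def)

lemma abs_rep_linf [simp]: "abs_linf (rep_linf f) = f"
  using Quotient3_abs_rep[OF Quotient3_linf] .

lemma abs_linf_cong:
  assumes "ess_bounded f" "ess_bounded g" "AE z in circle. f z = g z"
  shows "abs_linf f = abs_linf g"
  using Quotient3_rel_abs[OF Quotient3_linf, of f g] assms by (simp add: linf_rel_def)

text \<open>The working principle for the quotient type: an identity between classes is checked
  pointwise almost everywhere, after collecting the \<open>rep_linf\<close> rules for the operations
  involved.\<close>

lemma linf_eqI:
  assumes "AE z in circle. rep_linf f z = rep_linf g z"
  shows "f = g"
  using abs_linf_cong[OF ess_bounded_rep ess_bounded_rep assms] by simp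

lemma measurable_rep_linf [measurable]: "rep_linf f \<in> borel_measurable circle"
  by (rule ess_bounded_measurable[OF ess_bounded_rep])

lemma rep_linf_zero: "AE z in circle. rep_linf 0 z = 0"
  unfolding zero_linf_def by (rule rep_abs_linf[OF ess_bounded_const])

lemma rep_linf_one: "AE z in circle. rep_linf 1 z = 1"
  unfolding one_linf_def by (rule rep_abs_linf[OF ess_bounded_const])

lemma rep_linf_add: "AE z in circle. rep_linf (f + g) z = rep_linf f z + rep_linf g z"
  using rep_abs_linf[OF ess_bounded_add[OF ess_bounded_rep ess_bounded_rep], of f g]
  by (simp add: plus_linf_def)

lemma rep_linf_diff: "AE z in circle. rep_linf (f - g) z = rep_linf f z - rep_linf g z"
  using rep_abs_linf[OF ess_bounded_diff[OF ess_bounded_rep ess_bounded_rep], of f g]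
  by (simp add: minus_linf_def)

lemma rep_linf_mult: "AE z in circle. rep_linf (f * g) z = rep_linf f z * rep_linf g z"
  using rep_abs_linf[OF ess_bounded_mult[OF ess_bounded_rep ess_bounded_rep], of f g]
  by (simp add: times_linf_def)

lemma rep_linf_scaleC: "AE z in circle. rep_linf (scaleC_linf c f) z = c * rep_linf f z"
  using rep_abs_linf[OF ess_bounded_cmult[OF ess_bounded_rep], of c f]
  by (simp add: scaleC_linf_def)

lemma rep_linf_scaleR: "AE z in circle. rep_linf (r *\<^sub>R f) z = complex_of_real r * rep_linf f z"
  using rep_abs_linf[OF ess_bounded_scaleR[OF ess_bounded_rep], of r f]
  by (simp add: scaleR_linf_def scaleR_conv_of_real)

lemma rep_linf_cnj: "AE z in circle. rep_linf (cnj_linf f) z = cnj (rep_linf f z)"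
  using rep_abs_linf[OF ess_bounded_cnj[OF ess_bounded_rep], of f]
  by (simp add: cnj_linf_def)

lemma rep_linf_sum:
  "AE z in circle. rep_linf (\<Sum>i\<in>I. f i) z = (\<Sum>i\<in>I. rep_linf (f i) z)"
proof (induction I rule: infinite_finite_induct)
  case (insert i I)
  from rep_linf_add[of "f i" "sum f I"] insert(3) show ?case
    by eventually_elim (simp add: insert)
qed (use rep_linf_zero in auto)

lemma norm_linf_eq: "norm f = ess_norm (rep_linf f)"
  by (simp add: norm_linf_def)

lemma AE_le_norm_linf: "AE z in circle. cmod (rep_linf f z) \<le> norm f"
  unfolding norm_linf_eq by (rule ess_norm_AE[OF ess_bounded_rep])

lemma norm_linf_le: "AE z in circle. cmod (rep_linf f z) \<le> c \<Longrightarrow> norm f \<le> c"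
  unfolding norm_linf_eq by (rule ess_norm_le[OF ess_bounded_rep])

lemma norm_linf_cong:
  assumes "AE z in circle. cmod (rep_linf f z) = cmod (rep_linf g z)"
  shows "norm f = norm g"
proof (rule antisym)
  show "norm f \<le> norm g"
    using assms AE_le_norm_linf[of g] by (intro norm_linf_le) (auto elim: eventually_elim2)
  show "norm g \<le> norm f"
    using assms AE_le_norm_linf[of f] by (intro norm_linf_le) (auto elim: eventually_elim2)
qed

lemma scaleR_eq_scaleC_linf: "r *\<^sub>R f = scaleC_linf (of_real r) f"
  using rep_linf_scaleR[of r f] rep_linf_scaleC[of "of_real r" f]
  by (intro linf_eqI) (auto elim: eventually_elim2)

lemma norm_cnj_linf: "norm (cnj_linf f) = norm f"
  using rep_linf_cnj[of f] by (intro norm_linf_cong) (auto elim: eventually_mono)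

lemma unimodularD: "unimodular u \<Longrightarrow> AE z in circle. cmod (rep_linf u z) = 1"
  by (simp add: unimodular_def)

lemma norm_unimodular_mult:
  assumes "unimodular u"
  shows "norm (u * f) = norm f"
proof (rule norm_linf_cong)
  show "AE z in circle. cmod (rep_linf (u * f) z) = cmod (rep_linf f z)"
    using unimodularD[OF assms] rep_linf_mult[of u f] by eventually_elim (simp add: norm_mult)
qed

lemma unimodular_one: "unimodular 1"
  unfolding unimodular_def using rep_linf_one by eventually_elim simp

lemma unimodular_mult:
  assumes "unimodular u" "unimodular v"
  shows "unimodular (u * v)"
  unfolding unimodular_def
  using unimodularD[OF assms(1)] unimodularD[OF assms(2)] rep_linf_mult[of u v]
  by eventually_elim (simp add: norm_mult)

lemma unimodular_cnj: "unimodular u \<Longrightarrow> unimodular (cnj_linf u)"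
  unfolding unimodular_def using rep_linf_cnj[of u] by (auto elim: eventually_elim2)

lemma cnj_mult_unimodular:
  assumes "unimodular u"
  shows "cnj_linf u * u = 1"
proof (rule linf_eqI)
  show "AE z in circle. rep_linf (cnj_linf u * u) z = rep_linf 1 z"
    using unimodularD[OF assms] rep_linf_mult[of "cnj_linf u" u] rep_linf_cnj[of u] rep_linf_one
    by eventually_elim (metis complex_norm_square mult.commute of_real_1 power_one)
qed

lemma scaleC_mult_left_linf: "scaleC_linf c f * g = scaleC_linf c (f * g)"
proof (rule linf_eqI)
  show "AE z in circle. rep_linf (scaleC_linf c f * g) z = rep_linf (scaleC_linf c (f * g)) z"
    using rep_linf_mult[of "scaleC_linf c f" g] rep_linf_mult[of f g] rep_linf_scaleC[of c f]
      rep_linf_scaleC[of c "f * g"]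
    by eventually_elim simp
qed

lemma AE_bounded_rep_abs:
  assumes "f \<in> borel_measurable circle" "AE z in circle. cmod (f z) \<le> C"
  shows "AE z in circle. rep_linf (abs_linf f) z = f z"
  by (rule rep_abs_linf) (use assms in \<open>auto simp: ess_bounded_def\<close>)

section \<open>Sub-C*-algebras: closure properties and Neumann inversion\<close>

lemma sub_cstarD:
  assumes "sub_cstar_algebra B"
  shows "1 \<in> B" "f \<in> B \<Longrightarrow> g \<in> B \<Longrightarrow> f + g \<in> B" "f \<in> B \<Longrightarrow> scaleC_linf c f \<in> B"
    "f \<in> B \<Longrightarrow> g \<in> B \<Longrightarrow> f * g \<in> B" "f \<in> B \<Longrightarrow> cnj_linf f \<in> B" "closed B"
  using assms by (auto simp: sub_cstar_algebra_def)

lemma sub_cstar_scaleR: "sub_cstar_algebra B \<Longrightarrow> f \<in> B \<Longrightarrow> r *\<^sub>R f \<in> B"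
  by (simp add: scaleR_eq_scaleC_linf sub_cstarD)

lemma sub_cstar_zero: "sub_cstar_algebra B \<Longrightarrow> 0 \<in> B"
  using sub_cstar_scaleR[of B 1 0] sub_cstarD(1) by simp

lemma sub_cstar_power: "sub_cstar_algebra B \<Longrightarrow> f \<in> B \<Longrightarrow> f ^ n \<in> B"
  by (induction n) (auto simp: sub_cstarD)

lemma sub_cstar_sum: "sub_cstar_algebra B \<Longrightarrow> (\<And>i. i \<in> I \<Longrightarrow> f i \<in> B) \<Longrightarrow> (\<Sum>i\<in>I. f i) \<in> B"
  by (induction I rule: infinite_finite_induct) (auto simp: sub_cstarD sub_cstar_zero)

lemma sub_cstar_algebra_generated: "sub_cstar_algebra (cstar_generated S)"
  unfolding cstar_generated_def
  by (rule hull_in) (auto simp: sub_cstar_algebra_def intro!: closed_Inter)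

text \<open>Completeness of the ambient algebra is not needed: the inverse exists pointwise, and the Neumann
  partial sums converge to it in norm.\<close>

lemma sub_cstar_inverse:
  assumes B: "sub_cstar_algebra B" and g: "g \<in> B" "norm g < 1"
  obtains h where "h \<in> B" "AE z in circle. rep_linf h z * (1 - rep_linf g z) = 1"
proof -
  define k where "k z = inverse (1 - rep_linf g z)" for z
  have bound: "AE z in circle. cmod (k z) \<le> inverse (1 - norm g)"
    using AE_le_norm_linf[of g]
  proof eventually_elim
    case (elim z)
    have "1 - norm g \<le> cmod (1 - rep_linf g z)"
      using norm_triangle_ineq2[of 1 "rep_linf g z"] elim by simp
    then show ?case using g(2) by (simp add: k_def norm_inverse le_imp_inverse_le)
  qed
  have km: "k \<in> borel_measurable circle" unfolding k_def by measurable
  define h where "h = abs_linf k"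
  have h: "AE z in circle. rep_linf h z = k z"
    unfolding h_def by (rule AE_bounded_rep_abs[OF km bound])
  have inv: "AE z in circle. rep_linf h z * (1 - rep_linf g z) = 1"
    using h AE_le_norm_linf[of g]
  proof eventually_elim
    case (elim z)
    have "1 - rep_linf g z \<noteq> 0" using elim g(2) by auto
    then show ?case using elim by (simp add: k_def)
  qed
  have hg: "h * (1 - g) = 1"
  proof (rule linf_eqI)
    show "AE z in circle. rep_linf (h * (1 - g)) z = rep_linf 1 z"
      using inv rep_linf_mult[of h "1 - g"] rep_linf_diff[of 1 g] rep_linf_one
      by eventually_elim simp
  qed
  define s where "s n = (\<Sum>i<n. g ^ i)" for n
  \<comment> \<open>Multiplying the finite geometric sum by the pointwise inverse \<open>h\<close>
    gives an exact error term, which decays geometrically in norm.\<close>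
  have s: "s n - h = - (h * g ^ n)" for n
  proof -
    have "(1 - g) * s n = 1 - g ^ n" unfolding s_def by (simp add: one_diff_power_eq)
    then have "h * ((1 - g) * s n) = h * (1 - g ^ n)" by simp
    then have "s n = h * (1 - g ^ n)" using hg by (simp flip: mult.assoc)
    then show ?thesis by (simp add: algebra_simps)
  qed
  have "s \<longlonglongrightarrow> h"
  proof (rule Lim_transform_bound[where g = "\<lambda>n. norm h * norm g ^ n" and f = "\<lambda>n. s n - h",
        THEN Lim_null[THEN iffD2]])
    show "\<forall>\<^sub>F n in sequentially. norm (s n - h) \<le> norm (norm h * norm g ^ n)"
    proof (intro always_eventually allI)
      fix n
      have "norm (h * g ^ n) \<le> norm h * norm g ^ n"
        by (meson norm_mult_ineq norm_power_ineq mult_left_mono norm_ge_zero order_trans)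
      then show "norm (s n - h) \<le> norm (norm h * norm g ^ n)"
        by (simp add: s)
    qed
    show "(\<lambda>n. norm h * norm g ^ n) \<longlonglongrightarrow> 0"
      using g(2) by (auto intro!: tendsto_mult_right_zero LIMSEQ_power_zero)
  qed
  moreover have "s n \<in> B" for n
    unfolding s_def using B g by (intro sub_cstar_sum sub_cstar_power)
  ultimately have "h \<in> B" using sub_cstarD(6)[OF B] closed_sequentially by blast
  with inv that show thesis by blast
qed

section \<open>The Russo--Dye theorem\<close>

lemma sum_powers_root_of_unity:
  fixes w :: complex
  assumes "w ^ n = 1" "w \<noteq> 1"
  shows "(\<Sum>j<n. w ^ j) = 0"
  using assms by (simp add: sum_gp_strict)

text \<open>Orthogonality of characters: the summand is \<open>w ^ j\<close> for one root of unity
  \<open>w\<close> fixed by \<open>k\<close>, and \<open>w = 1\<close> happens exactly when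
  \<open>n\<close> divides \<open>k\<close>. Otherwise the geometric sum vanishes.\<close>

lemma sum_cis_powers:
  assumes "0 < n"
  shows "(\<Sum>j<n. cis (2 * pi * real j / real n) ^ k) = (if n dvd k then of_nat n else 0)"
proof -
  define w where "w = cis (2 * pi * real k / real n)"
  have eq: "cis (2 * pi * real j / real n) ^ k = w ^ j" for j
    unfolding w_def Complex.DeMoivre by (simp add: mult_ac)
  have wn: "w ^ n = 1"
    unfolding w_def Complex.DeMoivre using assms by (simp add: cis_multiple_2pi)
  show ?thesis
  proof (cases "n dvd k")
    case True
    then obtain m where "k = n * m" by blast
    then have "2 * pi * real k / real n = 2 * pi * real m" using assms by simp
    then have "w = 1" by (simp only: w_def cis_multiple_2pi Ints_of_nat)
    then show ?thesis using True by (simp add: eq)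
  next
    case False
    have "w \<noteq> 1"
    proof
      assume "w = 1"
      then have "cos (2 * pi * real k / real n) = 1" by (simp add: w_def cis.ctr complex_eq_iff)
      then obtain m :: int where "2 * pi * real k / real n = of_int m * 2 * pi"
        by (auto simp: cos_one_2pi_int)
      then have "real k = of_int m * real n" using assms by (simp add: field_simps)
      then have "int k = m * int n" by (metis of_int_eq_iff of_int_mult of_int_of_nat_eq)
      then have "int n dvd int k" by simp
      with False show False by simp
    qed
    with wn have "(\<Sum>j<n. w ^ j) = 0" by (rule sum_powers_root_of_unity)
    with False show ?thesis by (simp add: eq)
  qed
qed

text \<open>The mean over all unimodular \<open>\<lambda>\<close> of the analytic function
  \<open>\<lambda> \<mapsto> (\<lambda> + a) / (1 + \<lambda> * b)\<close> is its value \<open>a\<close> at \<open>0\<close>; here the mean is taken over the roots of unity only.\<close>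

lemma mean_blaschke:
  fixes a b :: complex
  assumes n: "2 \<le> n" and b: "cmod b < 1"
  defines "l \<equiv> \<lambda>j. cis (2 * pi * real j / real n)"
  shows "(\<Sum>j<n. (l j + a) / (1 + l j * b)) = of_nat n * ((a + (-b) ^ (n - 1)) / (1 - (-b) ^ n))"
proof -
  have n0: "0 < n" using n by simp
  have l1: "cmod (l j) = 1" for j by (simp add: l_def)
  have ln: "l j ^ n = 1" for j
    unfolding l_def Complex.DeMoivre using n0 by (simp add: cis_multiple_2pi)
  have bn: "cmod ((-b) ^ n) < 1" using b n0 by (simp add: norm_power power_less_one_iff)
  then have nz: "1 - (-b) ^ n \<noteq> 0" by auto
  have nz': "1 + l j * b \<noteq> 0" for j
  proof
    assume "1 + l j * b = 0"
    then have "cmod (l j * b) = 1" by (metis add.commute add_eq_0_iff norm_minus_cancel norm_one)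
    with b l1 show False by (simp add: norm_mult)
  qed
  \<comment> \<open>Because \<open>l j ^ n = 1\<close>, the geometric series folds into its first
    \<open>n\<close> terms, with a denominator that is the same for all \<open>j\<close>.\<close>
  have geo: "1 / (1 + l j * b) = (\<Sum>k<n. (-b) ^ k * l j ^ k) / (1 - (-b) ^ n)" for j
  proof -
    have "1 - (- (l j * b)) ^ n = (1 - (- (l j * b))) * (\<Sum>k<n. (- (l j * b)) ^ k)"
      by (rule one_diff_power_eq)
    moreover have "(- (l j * b)) ^ k = (-b) ^ k * l j ^ k" for k
      by (metis mult.commute mult_minus_left power_mult_distrib)
    ultimately have "1 - (-b) ^ n = (1 + l j * b) * (\<Sum>k<n. (-b) ^ k * l j ^ k)"
      by (simp add: ln)
    then show ?thesis using nz nz'[of j] by (simp add: field_simps)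
  qed
  have "(\<Sum>j<n. (l j + a) * (\<Sum>k<n. (-b) ^ k * l j ^ k))
      = (\<Sum>j<n. \<Sum>k<n. (-b) ^ k * l j ^ Suc k + a * (-b) ^ k * l j ^ k)"
    by (simp add: sum_distrib_left algebra_simps)
  also have "\<dots> = (\<Sum>k<n. \<Sum>j<n. (-b) ^ k * l j ^ Suc k + a * (-b) ^ k * l j ^ k)"
    by (rule sum.swap)
  also have "\<dots> = (\<Sum>k<n. (-b) ^ k * (\<Sum>j<n. l j ^ Suc k) + a * (-b) ^ k * (\<Sum>j<n. l j ^ k))"
    by (simp only: sum.distrib sum_distrib_left)
  \<comment> \<open>Only two exponents survive: \<open>Suc k = n\<close> in the first sum and
    \<open>k = 0\<close> in the second. The former is an aliasing term, which the mean over the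
    whole circle does not have.\<close>
  also have "\<dots> = (\<Sum>k<n. (if k = n - 1 then of_nat n * (-b) ^ (n - 1) else 0)
      + (if k = 0 then of_nat n * a else 0))"
  proof (rule sum.cong[OF refl])
    fix k assume "k \<in> {..<n}"
    then have k: "k < n" by simp
    have s: "(\<Sum>j<n. l j ^ m) = (if n dvd m then of_nat n else 0)" for m
      unfolding l_def by (rule sum_cis_powers[OF n0])
    have 1: "n dvd Suc k \<longleftrightarrow> k = n - 1" using k n by (auto dest!: dvd_imp_le)
    have 2: "n dvd k \<longleftrightarrow> k = 0" using k by (auto dest!: dvd_imp_le)
    show "(-b) ^ k * (\<Sum>j<n. l j ^ Suc k) + a * (-b) ^ k * (\<Sum>j<n. l j ^ k)
      = (if k = n - 1 then of_nat n * (-b) ^ (n - 1) else 0) + (if k = 0 then of_nat n * a else 0)"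
      unfolding s 1 2 by auto
  qed
  also have "\<dots> = of_nat n * (a + (-b) ^ (n - 1))"
    using n0 by (simp add: sum.distrib sum.delta algebra_simps)
  finally have main: "(\<Sum>j<n. (l j + a) * (\<Sum>k<n. (-b) ^ k * l j ^ k)) = of_nat n * (a + (-b) ^ (n - 1))" .
  have "(\<Sum>j<n. (l j + a) / (1 + l j * b))
      = (\<Sum>j<n. (l j + a) * (\<Sum>k<n. (-b) ^ k * l j ^ k)) / (1 - (-b) ^ n)"
    unfolding sum_divide_distrib using geo
    by (intro sum.cong[OF refl]) (metis (no_types, lifting) mult.right_neutral times_divide_eq_right)
  then show ?thesis unfolding main by simp
qed

text \<open>Everything that separates the discrete mean from \<open>a\<close> carries at least
  \<open>n - 1\<close> factors \<open>cnj a\<close>, and the denominator stays above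
  \<open>1 - c\<close>. The bound depends on \<open>a\<close> only through \<open>c\<close>, so it
  is uniform over the values of a function and passes to the norm.\<close>

lemma mean_blaschke_error:
  fixes a :: complex
  assumes n: "2 \<le> n" and a: "cmod a \<le> c" "c < 1"
  shows "cmod ((a + (- cnj a) ^ (n - 1)) / (1 - (- cnj a) ^ n) - a) \<le> 2 * c ^ (n - 1) / (1 - c)"
proof -
  define b where "b = - cnj a"
  have b: "cmod b \<le> c" using a by (simp add: b_def)
  have c0: "0 \<le> c" using b norm_ge_zero order_trans by blast
  have bm: "cmod (b ^ m) \<le> c ^ m" for m using b by (simp add: norm_power power_mono)
  have "c ^ n \<le> c ^ 1" by (rule power_decreasing) (use n a c0 in auto)
  then have "cmod (b ^ n) \<le> c" using bm[of n] by simp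
  moreover have "1 - cmod (b ^ n) \<le> cmod (1 - b ^ n)" using norm_triangle_ineq2[of 1 "b ^ n"] by simp
  ultimately have den: "1 - c \<le> cmod (1 - b ^ n)" by simp
  then have nz: "1 - b ^ n \<noteq> 0" using a(2) by auto
  have "(a + b ^ (n - 1)) / (1 - b ^ n) - a = (b ^ (n - 1) + a * b ^ n) / (1 - b ^ n)"
    using nz by (simp add: field_simps)
  moreover have "cmod (b ^ (n - 1) + a * b ^ n) \<le> 2 * c ^ (n - 1)"
  proof -
    have "cmod (a * b ^ n) \<le> 1 * c ^ n"
      unfolding norm_mult using a bm[of n] by (intro mult_mono) auto
    moreover have "c ^ n \<le> c ^ (n - 1)" by (rule power_decreasing) (use a c0 in auto)
    ultimately show ?thesis
      using norm_triangle_ineq[of "b ^ (n - 1)" "a * b ^ n"] bm[of "n - 1"] by linarith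
  qed
  ultimately show ?thesis
    unfolding b_def[symmetric] using den a(2) c0
    by (simp add: norm_divide frac_le)
qed

text \<open>Multiplying the denominator by \<open>cnj l\<close>, of modulus one, turns it into the
  conjugate of the numerator.\<close>

lemma cmod_blaschke_eq_1:
  assumes "cmod l = 1" "cmod a < 1"
  shows "cmod ((l + a) / (1 + l * cnj a)) = 1" "1 + l * cnj a \<noteq> 0"
proof -
  have "cmod (1 + l * cnj a) = cmod (cnj l * (1 + l * cnj a))"
    using assms by (simp add: norm_mult)
  also have "cnj l * (1 + l * cnj a) = cnj (l + a)"
    using complex_norm_square[of l] assms by (simp add: algebra_simps)
  also have "cmod \<dots> = cmod (l + a)" by (rule complex_mod_cnj)
  finally have eq: "cmod (1 + l * cnj a) = cmod (l + a)" .
  have "l + a \<noteq> 0" using assms by (metis add_eq_0_iff2 norm_minus_cancel less_irrefl)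
  then show "cmod ((l + a) / (1 + l * cnj a)) = 1" "1 + l * cnj a \<noteq> 0"
    using eq by (auto simp: norm_divide)
qed

text \<open>For each unimodular constant \<open>l\<close>, the pointwise quotient
  \<open>(l + a) / (1 + l * cnj a)\<close> is unimodular and stays in \<open>B\<close>. Averaging
  over the \<open>n\<close>-th roots of unity with equal weights is a convex combination, and its
  distance from \<open>a\<close> is the aliasing error.\<close>

lemma russo_dye:
  assumes B: "sub_cstar_algebra B" and a: "a \<in> B" "norm a < 1" and e: "0 < e"
  obtains v where "v \<in> convex hull {u \<in> B. unimodular u}" "norm (v - a) \<le> e"
proof -
  let ?c = "norm a"
  have "(\<lambda>n. 2 * ?c ^ n / (1 - ?c)) \<longlonglongrightarrow> 2 * 0 / (1 - ?c)"
    using a(2) by (intro tendsto_intros LIMSEQ_power_zero) auto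
  then have "\<forall>\<^sub>F n in sequentially. 2 * ?c ^ n / (1 - ?c) < e"
    using e by (intro order_tendstoD) auto
  then obtain N where "\<And>n. N \<le> n \<Longrightarrow> 2 * ?c ^ n / (1 - ?c) < e"
    by (auto simp: eventually_sequentially)
  then obtain m where m: "m \<ge> 1" "2 * ?c ^ m / (1 - ?c) < e"
    by (meson max.cobounded1 max.cobounded2)
  \<comment> \<open>The error bound has exponent \<open>n - 1\<close>, and \<open>m \<ge> 1\<close>
    yields the \<open>2 \<le> n\<close> that the mean formula asks for.\<close>
  define n where "n = Suc m"
  have n: "2 \<le> n" "n - 1 = m" "0 < n" using m by (auto simp: n_def)
  define l where "l j = cis (2 * pi * real j / real n)" for j
  have l1: "cmod (l j) = 1" for j by (simp add: l_def)
  have "\<exists>w\<in>B. AE z in circle. rep_linf w z = (l j + rep_linf a z) / (1 + l j * cnj (rep_linf a z))" for j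
  proof -
    \<comment> \<open>The sign makes \<open>1 - g\<close> equal to the denominator
      \<open>1 + l j * cnj a\<close>.\<close>
    define g where "g = scaleC_linf (- l j) (cnj_linf a)"
    have gB: "g \<in> B" unfolding g_def by (intro sub_cstarD[OF B] a)
    have g: "AE z in circle. rep_linf g z = - l j * cnj (rep_linf a z)"
      unfolding g_def using rep_linf_scaleC[of "- l j" "cnj_linf a"] rep_linf_cnj[of a]
      by eventually_elim simp
    have "norm g = norm a"
      using g by (intro norm_linf_cong) (auto elim!: eventually_mono simp: norm_mult l1)
    then obtain h where h: "h \<in> B" "AE z in circle. rep_linf h z * (1 - rep_linf g z) = 1"
      using sub_cstar_inverse[OF B gB] a(2) by auto
    define w where "w = (scaleC_linf (l j) 1 + a) * h"
    have "AE z in circle. rep_linf w z = (l j + rep_linf a z) / (1 + l j * cnj (rep_linf a z))"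
      unfolding w_def
      using h(2) g rep_linf_mult[of "scaleC_linf (l j) 1 + a" h] rep_linf_add[of "scaleC_linf (l j) 1" a]
        rep_linf_scaleC[of "l j" 1] rep_linf_one
    proof eventually_elim
      case (elim z)
      then have "rep_linf h z * (1 + l j * cnj (rep_linf a z)) = 1" by simp
      then have "rep_linf h z = 1 / (1 + l j * cnj (rep_linf a z))"
        by (metis eq_divide_imp mult_zero_right zero_neq_one)
      then show ?case using elim by simp
    qed
    moreover have "w \<in> B" unfolding w_def by (intro sub_cstarD[OF B] a h)
    ultimately show ?thesis by blast
  qed
  then obtain w where w: "\<And>j. w j \<in> B"
    "\<And>j. AE z in circle. rep_linf (w j) z = (l j + rep_linf a z) / (1 + l j * cnj (rep_linf a z))"
    by metis
  have un: "unimodular (w j)" for j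
    unfolding unimodular_def using w(2)[of j] AE_le_norm_linf[of a]
  proof eventually_elim
    case (elim z)
    then show ?case using cmod_blaschke_eq_1(1)[OF l1[of j]] a(2) by simp
  qed
  define v where "v = (\<Sum>j<n. (1 / real n) *\<^sub>R w j)"
  have "v \<in> convex hull {u \<in> B. unimodular u}"
    unfolding v_def using w(1) un n(3)
    by (intro convex_sum convex_convex_hull hull_inc) auto
  moreover have "norm (v - a) \<le> 2 * ?c ^ (n - 1) / (1 - ?c)"
  proof (rule norm_linf_le)
    have s: "AE z in circle. \<forall>j\<in>{..<n}. rep_linf ((1 / real n) *\<^sub>R w j) z
        = of_real (1 / real n) * rep_linf (w j) z"
      by (rule AE_finite_allI) (use rep_linf_scaleR in blast)+
    have ww: "AE z in circle. \<forall>j\<in>{..<n}. rep_linf (w j) z = (l j + rep_linf a z) / (1 + l j * cnj (rep_linf a z))"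
      by (rule AE_finite_allI) (auto intro: w(2))
    show "AE z in circle. cmod (rep_linf (v - a) z) \<le> 2 * ?c ^ (n - 1) / (1 - ?c)"
      using s ww rep_linf_diff[of v a] rep_linf_sum[of "\<lambda>j. (1 / real n) *\<^sub>R w j" "{..<n}"] AE_le_norm_linf[of a]
    proof eventually_elim
      case (elim z)
      let ?a = "rep_linf a z"
      have "rep_linf v z = (\<Sum>j<n. of_real (1 / real n) * ((l j + ?a) / (1 + l j * cnj ?a)))"
        using elim(1,2,4) by (simp add: v_def)
      also have "\<dots> = of_real (1 / real n) * (\<Sum>j<n. (l j + ?a) / (1 + l j * cnj ?a))"
        by (rule sum_distrib_left[symmetric])
      also have "\<dots> = (?a + (- cnj ?a) ^ (n - 1)) / (1 - (- cnj ?a) ^ n)"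
        unfolding l_def using mean_blaschke[OF n(1), of "cnj ?a" ?a] elim(5) a(2) n(3) by simp
      finally have "rep_linf v z = (?a + (- cnj ?a) ^ (n - 1)) / (1 - (- cnj ?a) ^ n)" .
      then show ?case using elim(3) mean_blaschke_error[OF n(1) elim(5) a(2)] by simp
    qed
  qed
  ultimately show thesis using that[of v] m(2) n(2) by auto
qed

section \<open>Moebius transformations of the disk\<close>

text \<open>The matrix with rows \<open>m * cnj d, m * cnj c\<close> and \<open>c, d\<close>
  belongs, up to scaling, to U(1,1) when \<open>cmod m = 1\<close> and
  \<open>cmod c < cmod d\<close>; these are all the automorphisms of the disk. Leaving
  \<open>c\<close> and \<open>d\<close> unnormalised keeps products and inverses polynomial in the
  parameters.\<close>

definition disk_auto :: "complex \<Rightarrow> complex \<Rightarrow> complex \<Rightarrow> complex \<Rightarrow> complex" where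
  "disk_auto m c d z = (m * cnj d * z + m * cnj c) / (c * z + d)"

lemma disk_auto_denom_nonzero:
  assumes "cmod c < cmod d" "cmod z \<le> 1"
  shows "c * z + d \<noteq> 0"
proof
  assume "c * z + d = 0"
  then have "cmod d = cmod (c * z)" by (metis add_eq_0_iff norm_minus_cancel)
  also have "\<dots> \<le> cmod c" using assms(2) by (simp add: norm_mult mult_left_le)
  finally show False using assms(1) by simp
qed

text \<open>Invariance of the indefinite Hermitian form up to the determinant. The sign of the
  right-hand side shows at once that the disk and the circle are each mapped into
  themselves.\<close>

lemma disk_auto_identity:
  "(cmod (c * z + d))\<^sup>2 - (cmod (cnj d * z + cnj c))\<^sup>2 = ((cmod d)\<^sup>2 - (cmod c)\<^sup>2) * (1 - (cmod z)\<^sup>2)"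
proof -
  have "complex_of_real ((cmod (c * z + d))\<^sup>2 - (cmod (cnj d * z + cnj c))\<^sup>2)
      = complex_of_real (((cmod d)\<^sup>2 - (cmod c)\<^sup>2) * (1 - (cmod z)\<^sup>2))"
    unfolding of_real_diff of_real_mult complex_norm_square of_real_1 by (simp add: algebra_simps)
  then show ?thesis by (simp only: of_real_eq_iff)
qed

lemma cmod_disk_auto:
  assumes "cmod m = 1" "cmod c < cmod d"
  shows "cmod z < 1 \<Longrightarrow> cmod (disk_auto m c d z) < 1" "cmod z = 1 \<Longrightarrow> cmod (disk_auto m c d z) = 1"
proof -
  have eq: "cmod (disk_auto m c d z) = cmod (cnj d * z + cnj c) / cmod (c * z + d)"
    using assms(1) by (simp add: disk_auto_def norm_divide norm_mult flip: distrib_left mult.assoc)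
      (metis mult.assoc distrib_left norm_mult mult_1)
  have dc: "(cmod c)\<^sup>2 < (cmod d)\<^sup>2" using assms(2) by (simp add: power_strict_mono)
  show "cmod (disk_auto m c d z) < 1" if z: "cmod z < 1"
  proof -
    have "(cmod z)\<^sup>2 < 1" using z by (simp add: power_less_one_iff)
    then have "(cmod (cnj d * z + cnj c))\<^sup>2 < (cmod (c * z + d))\<^sup>2"
      using disk_auto_identity[of c z d] dc by (smt (verit) mult_pos_pos)
    then have "cmod (cnj d * z + cnj c) < cmod (c * z + d)" by (rule power_less_imp_less_base) simp
    then show ?thesis unfolding eq by (smt (verit) divide_less_eq_1 norm_ge_zero)
  qed
  show "cmod (disk_auto m c d z) = 1" if z: "cmod z = 1"
  proof -
    have "(cmod (cnj d * z + cnj c))\<^sup>2 = (cmod (c * z + d))\<^sup>2"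
      using disk_auto_identity[of c z d] z by simp
    then have "cmod (cnj d * z + cnj c) = cmod (c * z + d)" by (simp add: power2_eq_iff_nonneg)
    moreover have "c * z + d \<noteq> 0" using disk_auto_denom_nonzero[OF assms(2)] z by simp
    ultimately show ?thesis unfolding eq by simp
  qed
qed

text \<open>\<open>C\<close> and \<open>D\<close> form the bottom row of the matrix product; the top
  row has the required conjugate shape because \<open>m' * cnj m' = 1\<close>. The inequality
  between their moduli is multiplicativity of the determinant.\<close>

lemma disk_auto_compose:
  assumes m: "cmod m = 1" and cd: "cmod c < cmod d" and m': "cmod m' = 1" and cd': "cmod c' < cmod d'"
  defines "C \<equiv> c * m' * cnj d' + d * c'" and "D \<equiv> c * m' * cnj c' + d * d'"
  shows "cmod C < cmod D"
    and "cmod z \<le> 1 \<Longrightarrow> disk_auto m c d (disk_auto m' c' d' z) = disk_auto (m * m') C D z"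
proof -
  have mm: "m' * cnj m' = 1" using m' complex_norm_square[of m'] by simp
  have "complex_of_real ((cmod D)\<^sup>2 - (cmod C)\<^sup>2)
      = (d * cnj d - c * cnj c) * (d' * cnj d' - c' * cnj c') + (m' * cnj m' - 1) * c * cnj c * (c' * cnj c' - d' * cnj d')"
    unfolding of_real_diff complex_norm_square C_def D_def by (simp add: algebra_simps)
  also have "\<dots> = complex_of_real (((cmod d)\<^sup>2 - (cmod c)\<^sup>2) * ((cmod d')\<^sup>2 - (cmod c')\<^sup>2))"
    unfolding mm of_real_diff of_real_mult complex_norm_square by simp
  finally have "(cmod D)\<^sup>2 - (cmod C)\<^sup>2 = ((cmod d)\<^sup>2 - (cmod c)\<^sup>2) * ((cmod d')\<^sup>2 - (cmod c')\<^sup>2)"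
    by (simp only: of_real_eq_iff)
  moreover have "(cmod c)\<^sup>2 < (cmod d)\<^sup>2" "(cmod c')\<^sup>2 < (cmod d')\<^sup>2"
    using cd cd' by (simp_all add: power_strict_mono)
  ultimately have "(cmod C)\<^sup>2 < (cmod D)\<^sup>2" by (smt (verit) mult_pos_pos)
  then show CD: "cmod C < cmod D" by (rule power_less_imp_less_base) simp
  show "disk_auto m c d (disk_auto m' c' d' z) = disk_auto (m * m') C D z" if z: "cmod z \<le> 1"
  proof -
    define q where "q = c' * z + d'"
    define p where "p = m' * cnj d' * z + m' * cnj c'"
    have q: "q \<noteq> 0" unfolding q_def by (rule disk_auto_denom_nonzero[OF cd' z])
    have "disk_auto m c d (disk_auto m' c' d' z) = (m * cnj d * (p / q) + m * cnj c) / (c * (p / q) + d)"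
      by (simp add: disk_auto_def p_def q_def)
    also have "\<dots> = ((m * cnj d * (p / q) + m * cnj c) * q) / ((c * (p / q) + d) * q)"
      using q by simp
    also have "\<dots> = (m * cnj d * p + m * cnj c * q) / (c * p + d * q)"
      using q by (simp add: distrib_right)
    also have "c * p + d * q = C * z + D" by (simp add: p_def q_def C_def D_def algebra_simps)
    also have "m * cnj d * p + m * cnj c * q = m * m' * cnj D * z + m * m' * cnj C"
    proof -
      have "m * m' * cnj D * z + m * m' * cnj C
          = m * (m' * cnj m') * cnj c * c' * z + m * m' * cnj d * cnj d' * z
            + m * (m' * cnj m') * cnj c * d' + m * m' * cnj d * cnj c'"
        unfolding C_def D_def by (simp add: algebra_simps)
      then show ?thesis unfolding mm by (simp add: p_def q_def algebra_simps)
    qed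
    finally show ?thesis by (simp add: disk_auto_def)
  qed
qed

text \<open>\<open>- c\<close> and \<open>m * cnj d\<close> are the bottom row of the adjugate
  matrix, whose top row \<open>d, - m * cnj c\<close> has the right shape because \<open>m\<close>
  is unimodular. Either product is therefore diagonal.\<close>

lemma disk_auto_inverse:
  assumes m: "cmod m = 1" and cd: "cmod c < cmod d" and z: "cmod z \<le> 1"
  shows "disk_auto m (- c) (m * cnj d) (disk_auto m c d z) = z"
    and "disk_auto m c d (disk_auto m (- c) (m * cnj d) z) = z"
proof -
  have mm: "m * cnj m = 1" using m complex_norm_square[of m] by simp
  have m0: "m \<noteq> 0" using m by auto
  have cd': "cmod (- c) < cmod (m * cnj d)" using m cd by (simp add: norm_mult)
  define D where "D = d * cnj d - c * cnj c"
  have "(cmod c)\<^sup>2 < (cmod d)\<^sup>2" using cd by (simp add: power_strict_mono)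
  moreover have "D = complex_of_real ((cmod d)\<^sup>2 - (cmod c)\<^sup>2)"
    unfolding D_def of_real_diff complex_norm_square by simp
  ultimately have D0: "D \<noteq> 0" and cD: "cnj D = D" by (auto simp del: of_real_diff)
  have e1: "- c * m * cnj d + m * cnj d * c = 0" "- c * m * cnj c + m * cnj d * d = m * D"
    by (simp_all add: D_def algebra_simps)
  have "disk_auto m (- c) (m * cnj d) (disk_auto m c d z) = disk_auto (m * m) 0 (m * D) z"
    using disk_auto_compose(2)[OF m cd' m cd z] unfolding e1 .
  also have "\<dots> = (m * cnj m) * z" using m0 D0 by (simp add: disk_auto_def cD)
  finally show "disk_auto m (- c) (m * cnj d) (disk_auto m c d z) = z" by (simp add: mm)
  have e2: "c * m * cnj (m * cnj d) + d * - c = 0" "c * m * cnj (- c) + d * (m * cnj d) = m * D"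
  proof -
    have "c * m * cnj (m * cnj d) + d * - c = (m * cnj m) * c * d - c * d" by simp
    then show "c * m * cnj (m * cnj d) + d * - c = 0" by (simp add: mm)
  qed (simp add: D_def algebra_simps)
  have "disk_auto m c d (disk_auto m (- c) (m * cnj d) z) = disk_auto (m * m) 0 (m * D) z"
    using disk_auto_compose(2)[OF m cd m cd' z] unfolding e2 .
  also have "\<dots> = (m * cnj m) * z" using m0 D0 by (simp add: disk_auto_def cD)
  finally show "disk_auto m c d (disk_auto m (- c) (m * cnj d) z) = z" by (simp add: mm)
qed

lemma disk_auto_in_disk_moebius:
  assumes m: "cmod m = 1" and cd: "cmod c < cmod d"
  shows "disk_auto m c d \<in> disk_moebius"
  unfolding disk_moebius_def mem_Collect_eq
proof
  have m0: "m \<noteq> 0" using m by auto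
  have "(cmod c)\<^sup>2 < (cmod d)\<^sup>2" using cd by (simp add: power_strict_mono)
  then have "(cmod d)\<^sup>2 - (cmod c)\<^sup>2 \<noteq> 0" by linarith
  then have "complex_of_real ((cmod d)\<^sup>2 - (cmod c)\<^sup>2) \<noteq> 0" by (simp only: of_real_eq_0_iff not_False_eq_True)
  then have "m * cnj d * d - m * cnj c * c \<noteq> 0"
    using m0 unfolding of_real_diff complex_norm_square by (simp add: algebra_simps)
  then show "\<exists>a b c' d'. a * d' - b * c' \<noteq> 0 \<and> disk_auto m c d = (\<lambda>z. (a * z + b) / (c' * z + d'))"
    by (intro exI[of _ "m * cnj d"] exI[of _ "m * cnj c"] exI[of _ c] exI[of _ d])
       (auto simp: disk_auto_def)
  have cd': "cmod (- c) < cmod (m * cnj d)" using m cd by (simp add: norm_mult)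
  show "disk_auto m c d ` ball 0 1 = ball 0 1"
  proof
    show "disk_auto m c d ` ball 0 1 \<subseteq> ball 0 1" using cmod_disk_auto(1)[OF m cd] by auto
    show "ball 0 1 \<subseteq> disk_auto m c d ` ball 0 1"
    proof
      fix z :: complex assume "z \<in> ball 0 1"
      then show "z \<in> disk_auto m c d ` ball 0 1"
        using cmod_disk_auto(1)[OF m cd', of z] disk_auto_inverse(2)[OF m cd, of z]
        by (intro image_eqI[of _ _ "disk_auto m (- c) (m * cnj d) z"]) auto
    qed
  qed
qed

text \<open>On the circle, numerator and denominator turn out to have equal modulus. Both squared
  moduli are trigonometric polynomials of degree one, so comparing coefficients forces
  \<open>a\<close> and \<open>b\<close> to be \<open>cnj d\<close> and \<open>cnj c\<close> up to
  one common unimodular factor.\<close>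

lemma disk_moebius_imp_disk_auto:
  assumes "\<phi> \<in> disk_moebius"
  obtains m c d where "cmod m = 1" "cmod c < cmod d" "\<phi> = disk_auto m c d"
proof -
  from assms obtain a b c d where det: "a * d - b * c \<noteq> 0" and \<phi>: "\<phi> = (\<lambda>z. (a * z + b) / (c * z + d))"
    and im: "\<phi> ` ball 0 1 = ball 0 1" by (auto simp: disk_moebius_def)
  have lt: "cmod (a * z + b) < cmod (c * z + d)" if "cmod z < 1" "c * z + d \<noteq> 0" for z
  proof -
    have "\<phi> z \<in> ball 0 1" using im that by auto
    then have "cmod (a * z + b) / cmod (c * z + d) < 1" by (simp add: \<phi> norm_divide)
    then show ?thesis using that by (simp add: divide_less_eq)
  qed
  \<comment> \<open>A zero of the denominator is isolated, so close to any \<open>p\<close> the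
    strict inequality holds at all other points of the disk, even if \<open>p\<close> is a pole
    where the quotient takes its default value.\<close>
  have limit: "\<forall>\<^sub>F z in at p within ball 0 1. c * z + d \<noteq> 0" for p
  proof (cases "c * p + d = 0")
    case True
    have "c * z + d \<noteq> 0" if "z \<noteq> p" for z
    proof
      assume "c * z + d = 0"
      with True have "c * (z - p) = 0" by algebra
      with that True det show False by auto
    qed
    then show ?thesis by (auto simp: eventually_at_filter)
  next
    case False
    then show ?thesis by (intro tendsto_imp_eventually_ne[where c = "c * p + d"] tendsto_intros)
  qed
  have le: "cmod (a * p + b) \<le> cmod (c * p + d)" if "cmod p \<le> 1" for p
  proof (rule tendsto_le)
    show "at p within ball 0 1 \<noteq> bot"
      using that by (simp add: trivial_limit_within islimpt_ball)
    show "((\<lambda>z. cmod (c * z + d)) \<longlongrightarrow> cmod (c * p + d)) (at p within ball 0 1)"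
      "((\<lambda>z. cmod (a * z + b)) \<longlongrightarrow> cmod (a * p + b)) (at p within ball 0 1)"
      by (intro tendsto_intros)+
    have "\<forall>\<^sub>F z in at p within ball 0 1. z \<in> ball 0 1" by (simp add: eventually_at_filter)
    with limit[of p] show "\<forall>\<^sub>F z in at p within ball 0 1. cmod (a * z + b) \<le> cmod (c * z + d)"
      by eventually_elim (use lt in \<open>auto intro: less_imp_le\<close>)
  qed
  \<comment> \<open>At a pole the inequality just proved would make the numerator vanish too,
    against the nonzero determinant.\<close>
  have nz: "c * p + d \<noteq> 0" if "cmod p \<le> 1" for p
  proof
    assume 0: "c * p + d = 0"
    with le[OF that] have "a * p + b = 0" by simp
    then have b: "b = - a * p" by (simp add: add_eq_0_iff)
    have d: "d = - c * p" using 0 by (simp add: add_eq_0_iff)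
    from det show False by (simp add: b d)
  qed
  \<comment> \<open>A boundary point sent inside the disk would share its value with an interior
    point, against injectivity.\<close>
  have eq: "cmod (a * p + b) = cmod (c * p + d)" if p: "cmod p = 1" for p
  proof (rule ccontr)
    assume "cmod (a * p + b) \<noteq> cmod (c * p + d)"
    then have "cmod (a * p + b) < cmod (c * p + d)" using le[of p] p by simp
    then have "cmod (\<phi> p) < 1" using nz[of p] p by (simp add: \<phi> norm_divide)
    then have "\<phi> p \<in> \<phi> ` ball 0 1" unfolding im by simp
    then obtain z where z: "cmod z < 1" "\<phi> p = \<phi> z" by auto
    then have "(a * p + b) * (c * z + d) = (a * z + b) * (c * p + d)"
      using nz[of p] nz[of z] p by (simp add: \<phi> field_simps)
    then have "(a * d - b * c) * (p - z) = 0" by (simp add: algebra_simps)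
    with det z p show False by auto
  qed
  have expand: "(cmod (s * p + t))\<^sup>2 = (cmod s)\<^sup>2 + (cmod t)\<^sup>2 + 2 * Re (s * cnj t * p)"
    if "cmod p = 1" for s t p
  proof -
    have "(cmod (s * p + t))\<^sup>2 = (cmod (s * p))\<^sup>2 + (cmod t)\<^sup>2 + 2 * Re (s * p * cnj t)"
      by (simp only: cmod_power2 Re_complex_of_real plus_complex.sel times_complex.sel cnj.sel)
         (simp add: power2_eq_square algebra_simps)
    then show ?thesis using that by (simp add: norm_mult mult_ac)
  qed
  have e: "(cmod a)\<^sup>2 + (cmod b)\<^sup>2 + 2 * Re (a * cnj b * p) = (cmod c)\<^sup>2 + (cmod d)\<^sup>2 + 2 * Re (c * cnj d * p)"
    if "cmod p = 1" for p
    using expand[OF that, of a b] expand[OF that, of c d] eq[OF that] by simp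
  \<comment> \<open>The points \<open>1\<close>, \<open>-1\<close> and \<open>\<i>\<close> separate
    the constant term from the real and imaginary parts of the linear coefficient.\<close>
  have sum: "(cmod a)\<^sup>2 + (cmod b)\<^sup>2 = (cmod c)\<^sup>2 + (cmod d)\<^sup>2"
    using e[of 1] e[of "-1"] by simp
  have "Re (a * cnj b) = Re (c * cnj d)" using e[of 1] sum by simp
  moreover have "Im (a * cnj b) = Im (c * cnj d)" using e[of \<i>] sum by simp
  ultimately have prod: "a * cnj b = c * cnj d" by (rule complex_eqI)
  have cd: "cmod c < cmod d"
  proof (rule ccontr)
    assume not: "\<not> cmod c < cmod d"
    have "c \<noteq> 0" using not det by auto
    then have "cmod (- d / c) \<le> 1" using not by (simp add: norm_divide divide_le_eq)
    from nz[OF this] \<open>c \<noteq> 0\<close> show False by simp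
  qed
  then have d0: "d \<noteq> 0" by auto
  have "(cmod a)\<^sup>2 * (cmod b)\<^sup>2 = (cmod c)\<^sup>2 * (cmod d)\<^sup>2"
    using arg_cong[OF prod, of cmod] by (simp add: norm_mult flip: power_mult_distrib)
  \<comment> \<open>Equal sums and equal products make the squared moduli of \<open>a, b\<close> and
    of \<open>c, d\<close> agree as unordered pairs; pairing \<open>a\<close> with \<open>c\<close>
    is then excluded by the determinant.\<close>
  then have "((cmod a)\<^sup>2 - (cmod d)\<^sup>2) * ((cmod a)\<^sup>2 - (cmod c)\<^sup>2) = 0"
    using sum by algebra
  then consider "cmod a = cmod d" | "cmod a = cmod c" by auto
  then have ad: "cmod a = cmod d"
  proof cases
    case 2
    then have "cmod b = cmod d" using sum by simp
    then have bd: "b * cnj b = d * cnj d" using complex_norm_square[of b] complex_norm_square[of d] by simp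
    have "cnj d * (a * d) = a * (b * cnj b)" by (simp add: bd mult_ac)
    also have "\<dots> = cnj d * (b * c)" using prod by (simp add: mult_ac)
    finally show ?thesis using det d0 by simp
  qed
  define m where "m = a / cnj d"
  have m: "cmod m = 1" using ad d0 by (simp add: m_def norm_divide)
  have a: "a = m * cnj d" using d0 by (simp add: m_def)
  have a0: "a \<noteq> 0" using ad d0 by auto
  have "a * cnj a = d * cnj d" using ad complex_norm_square[of a] complex_norm_square[of d] by simp
  moreover have "cnj a * b = cnj c * d" using arg_cong[OF prod, of cnj] by simp
  ultimately have "cnj a * (b * cnj d) = cnj a * (a * cnj c)" by algebra
  then have "b * cnj d = a * cnj c" using a0 by simp
  then have b: "b = m * cnj c" using d0 by (simp add: m_def field_simps)
  have "\<phi> = disk_auto m c d" unfolding \<phi> disk_auto_def a b by (simp add: mult_ac)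
  with m cd that show thesis by blast
qed

section \<open>Null sets and composition\<close>

definition cayley :: "real \<Rightarrow> complex" where
  "cayley t = (1 + \<i> * of_real t) / (1 - \<i> * of_real t)"

text \<open>On the circle without \<open>-1\<close> the quotient is already real and
  \<open>Re\<close> only changes its type; at \<open>-1\<close> the value is the default
  \<open>0\<close>.\<close>

definition cayley_inv :: "complex \<Rightarrow> real" where
  "cayley_inv z = Re (- \<i> * (z - 1) / (z + 1))"

lemma cayley_denom_nonzero: "1 - \<i> * of_real t \<noteq> 0" "1 + \<i> * of_real t \<noteq> 0"
  by (auto simp: complex_eq_iff)

lemma cayley_eq_cis: "cayley t = cis (2 * arctan t)"
proof -
  define x where "x = arctan t"
  have x: "- (pi / 2) < x" "x < pi / 2" "tan x = t" using arctan[of t] by (auto simp: x_def)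
  then have c: "cos x > 0" by (intro cos_gt_zero_pi)
  have "of_real t = complex_of_real (sin x) / of_real (cos x)" unfolding x(3)[symmetric] tan_def by simp
  then have S: "complex_of_real (sin x) = of_real (cos x) * of_real t" using c by simp
  have "of_real (cos x) + \<i> * of_real (sin x) = of_real (cos x) * (1 + \<i> * of_real t)"
    "of_real (cos x) - \<i> * of_real (sin x) = of_real (cos x) * (1 - \<i> * of_real t)"
    unfolding S by (simp_all add: algebra_simps)
  then have "cayley t = (of_real (cos x) + \<i> * of_real (sin x)) / (of_real (cos x) - \<i> * of_real (sin x))"
    using c unfolding cayley_def by simp
  also have "\<dots> = cis x / cis (- x)" by (simp add: cis_conv_exp[symmetric] complex_eq_iff cis.ctr Complex_eq)
  also have "\<dots> = cis (2 * x)" by (simp add: cis_divide)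
  finally show ?thesis by (simp add: x_def)
qed

lemma cmod_cayley [simp]: "cmod (cayley t) = 1"
  by (simp add: cayley_eq_cis)

lemma cayley_neq: "cayley t \<noteq> -1"
  using cayley_denom_nonzero[of t] by (simp add: cayley_def field_simps)

lemma cayley_inv_cayley: "cayley_inv (cayley t) = t"
proof -
  have "cayley t - 1 = 2 * \<i> * of_real t / (1 - \<i> * of_real t)"
    "cayley t + 1 = 2 / (1 - \<i> * of_real t)"
    using cayley_denom_nonzero[of t] by (simp_all add: cayley_def field_simps)
  then show ?thesis
    using cayley_denom_nonzero[of t] by (simp add: cayley_inv_def)
qed

lemma cayley_surj:
  assumes "cmod z = 1" "z \<noteq> -1"
  obtains t where "z = cayley t"
proof -
  \<comment> \<open>The parameter is real because it equals its own conjugate, which after clearing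
    denominators is \<open>z * cnj z = 1\<close>.\<close>
  define w where "w = - \<i> * (z - 1) / (z + 1)"
  have z1: "z + 1 \<noteq> 0" using assms(2) by (simp add: add_eq_0_iff2)
  have zz: "z * cnj z = 1" using complex_norm_square[of z] assms(1) by simp
  have c1: "cnj z + 1 \<noteq> 0" using z1 by (metis complex_cnj_add complex_cnj_one complex_cnj_zero_iff)
  have "cnj w = \<i> * (cnj z - 1) / (cnj z + 1)" by (simp add: w_def)
  also have "\<dots> = w"
  proof -
    have "\<i> * (cnj z - 1) * (z + 1) = - \<i> * (z - 1) * (cnj z + 1)" using zz by algebra
    then show ?thesis using z1 c1 by (simp only: w_def frac_eq_eq not_False_eq_True)
  qed
  finally have "w \<in> \<real>" by (simp add: Reals_cnj_iff)
  then obtain t where t: "w = of_real t" by (auto elim: Reals_cases)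
  have "\<i> * w = (z - 1) / (z + 1)"
    by (simp only: w_def times_divide_eq_right mult.assoc[symmetric] mult_minus_right complex_i_mult_minus)
       simp
  then have "1 + \<i> * w = 2 * z / (z + 1)" "1 - \<i> * w = 2 / (z + 1)"
    using z1 by (simp_all add: field_simps)
  then have "z = cayley t" using z1 by (simp add: cayley_def flip: t)
  with that show thesis by blast
qed

section \<open>Null sets of the circle in the angle and in the Cayley coordinate\<close>

lemma sets_circle: "sets circle = sets (restrict_space borel (sphere 0 1))"
  by (simp add: circle_def)

lemma measurable_into_circle:
  assumes "f \<in> M \<rightarrow>\<^sub>M borel" "\<And>x. x \<in> space M \<Longrightarrow> cmod (f x) = 1"
  shows "f \<in> M \<rightarrow>\<^sub>M circle"
proof -
  have "f \<in> M \<rightarrow>\<^sub>M restrict_space borel (sphere 0 1)"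
    using assms by (intro measurable_restrict_space2) auto
  then show ?thesis using measurable_cong_sets[OF refl sets_circle, of M] by simp
qed

lemma measurable_circle_continuous:
  assumes "continuous_on (sphere 0 1) f" "\<And>z. cmod z = 1 \<Longrightarrow> cmod (f z) = 1"
  shows "f \<in> circle \<rightarrow>\<^sub>M circle"
proof (rule measurable_into_circle)
  have "f \<in> borel_measurable (restrict_space borel (sphere 0 1))"
    using assms(1) by (rule borel_measurable_continuous_on_restrict)
  then show "f \<in> borel_measurable circle"
    using measurable_cong_sets[OF sets_circle refl] by blast
qed (use assms(2) in auto)

lemma measurable_cayley [measurable]: "cayley \<in> borel \<rightarrow>\<^sub>M circle"
proof (rule measurable_into_circle)
  show "cayley \<in> borel_measurable borel"
    unfolding cayley_def using cayley_denom_nonzero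
    by (intro borel_measurable_continuous_onI continuous_intros) auto
qed simp

lemma null_sets_circle_iff_cis:
  assumes "N \<in> sets circle"
  shows "N \<in> null_sets circle \<longleftrightarrow> negligible {\<theta> \<in> {0..<2*pi}. cis \<theta> \<in> N}"
proof -
  have m: "cis \<in> restrict_space lborel {0..<2*pi} \<rightarrow>\<^sub>M restrict_space borel (sphere 0 1)"
  proof (rule measurable_restrict_space2)
    show "cis \<in> borel_measurable (restrict_space lborel {0..<2*pi})"
      by (intro measurable_restrict_space1)
         (simp add: borel_measurable_continuous_onI continuous_intros)
  qed auto
  let ?T = "{\<theta> \<in> {0..<2*pi}. cis \<theta> \<in> N}"
  have eq: "cis -` N \<inter> space (restrict_space lborel {0..<2*pi}) = ?T"
    by (auto simp: space_restrict_space)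
  have "?T \<in> sets (restrict_space lborel {0..<2*pi})"
    using measurable_sets[OF m, of N] assms unfolding eq sets_circle by simp
  then have T: "?T \<in> sets lborel" by (auto simp: sets_restrict_space_iff)
  have "N \<in> null_sets circle \<longleftrightarrow> ?T \<in> null_sets (restrict_space lborel {0..<2*pi})"
    unfolding circle_def null_sets_distr_iff[OF m] eq using assms by (simp add: sets_circle)
  also have "\<dots> \<longleftrightarrow> ?T \<in> null_sets lborel"
    by (subst null_sets_restrict_space) auto
  also have "\<dots> \<longleftrightarrow> negligible ?T"
    unfolding negligible_iff_null_sets using T by (auto simp: null_sets_def)
  finally show ?thesis .
qed

text \<open>The coordinate changes below are real parts of complex quotients; this lets the complex
  differentiation rules handle them.\<close>

lemma differentiable_Re_of_real:
  assumes "F field_differentiable at (of_real s)"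
  shows "(\<lambda>x. Re (F (of_real x))) differentiable at s"
proof -
  obtain D where "(F has_field_derivative D) (at (of_real s))"
    using assms by (auto simp: field_differentiable_def)
  then have "((\<lambda>x. F (of_real x)) has_vector_derivative D) (at s)"
    by (rule has_vector_derivative_real_field)
  then have "(\<lambda>x. F (of_real x)) differentiable at s" by (rule differentiableI_vector)
  then show ?thesis by (auto simp: differentiable_def intro: bounded_linear.has_derivative[OF bounded_linear_Re])
qed

text \<open>Angle and Cayley coordinate are differentiable functions of each other off one point,
  and a differentiable map of the line sends negligible sets to negligible sets. Each direction
  covers one coordinate set by such images of the other.\<close>

lemma null_sets_circle_iff:
  assumes N: "N \<in> sets circle"
  shows "N \<in> null_sets circle \<longleftrightarrow> negligible {t. cayley t \<in> N}"
proof -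
  let ?S = "{t. cayley t \<in> N}" and ?T = "{\<theta> \<in> {0..<2*pi}. cis \<theta> \<in> N}"
  have "negligible ?S \<longleftrightarrow> negligible ?T"
  proof
    assume S: "negligible ?S"
    \<comment> \<open>\<open>?f\<close> takes its values strictly between \<open>- pi\<close> and
      \<open>pi\<close>; \<open>?g\<close> moves the negative ones up by a full turn, and the
      remaining angle \<open>pi\<close> is the point \<open>-1\<close> that the Cayley coordinate
      omits.\<close>
    let ?f = "\<lambda>s. 2 * arctan s" and ?g = "\<lambda>s. 2 * arctan s + 2 * pi"
    have "?T \<subseteq> {pi} \<union> ?f ` ?S \<union> ?g ` ?S"
    proof
      fix x assume "x \<in> ?T"
      then have x: "0 \<le> x" "x < 2 * pi" "cis x \<in> N" by auto
      define s where "s = tan (x / 2)"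
      consider "x = pi" | "x < pi" | "pi < x" by linarith
      then show "x \<in> {pi} \<union> ?f ` ?S \<union> ?g ` ?S"
      proof cases
        case 2
        then have "arctan s = x / 2" unfolding s_def using x by (intro arctan_tan) auto
        then have "?f s = x" by simp
        then have "x = ?f s" "cayley s = cis x" by (simp_all only: cayley_eq_cis)
        then show ?thesis using x by auto
      next
        case 3
        have "s = tan (x / 2 - pi)" unfolding s_def by (simp add: tan_def)
        then have "arctan s = x / 2 - pi" using x 3 by (simp add: arctan_tan)
        then have "?f s = x - 2 * pi" by simp
        then have "x = ?g s" "cayley s = cis (x - 2 * pi)"
          by (simp_all only: cayley_eq_cis)
        moreover have "cis (x - 2 * pi) = cis x" by (simp flip: cis_divide)
        ultimately show ?thesis using x by auto
      qed simp
    qed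
    moreover have "negligible ((\<lambda>s. 2 * arctan s + k) ` ?S)" for k
    proof (rule negligible_differentiable_image_negligible[OF _ S])
      have "((\<lambda>s. 2 * arctan s + k) has_real_derivative 2 * inverse (1 + s\<^sup>2)) (at s within ?S)" for s
        by (rule derivative_eq_intros refl)+ simp
      then show "(\<lambda>s. 2 * arctan s + k) differentiable_on ?S"
        unfolding differentiable_on_def real_differentiable_def by blast
    qed simp
    from this[of 0] this[of "2 * pi"] have "negligible (?f ` ?S)" "negligible (?g ` ?S)" by simp_all
    ultimately show "negligible ?T" by (meson negligible_Un negligible_sing negligible_subset)
  next
    assume T: "negligible ?T"
    \<comment> \<open>This is \<open>tan (x / 2)\<close> written through the exponential function;
      restricting to \<open>?T'\<close> removes its pole.\<close>
    let ?h = "\<lambda>x. Re (- \<i> * (exp (\<i> * of_real x) - 1) / (exp (\<i> * of_real x) + 1))"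
    let ?T' = "{x \<in> ?T. cis x \<noteq> -1}"
    have "?S \<subseteq> ?h ` ?T'"
    proof
      fix t assume t: "t \<in> ?S"
      obtain x where x: "0 \<le> x" "x < 2 * pi" "cayley t = cis x"
        using complex_unimodular_polar[OF cmod_cayley[of t]] by (metis cis.ctr complex_eq_iff cis.sel complex.sel)
      then have hx: "?h x = t"
        using cayley_inv_cayley[of t] by (simp add: cayley_inv_def cis_conv_exp)
      have "x \<in> ?T'" using t x cayley_neq[of t] by auto
      with hx[symmetric] show "t \<in> ?h ` ?T'" by (rule image_eqI)
    qed
    moreover have "negligible (?h ` ?T')"
    proof (rule negligible_differentiable_image_negligible)
      show "negligible ?T'" using T by (rule negligible_subset) auto
      show "?h differentiable_on ?T'"
        unfolding differentiable_on_def
      proof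
        fix x assume "x \<in> ?T'"
        then have "exp (\<i> * of_real x) + 1 \<noteq> 0" by (simp add: cis_conv_exp add_eq_0_iff2)
        moreover have "(\<lambda>z. exp (\<i> * z)) field_differentiable at w" for w
          unfolding field_differentiable_def by (rule exI, (rule derivative_eq_intros refl)+)
        ultimately have "?h differentiable at x"
          by (intro differentiable_Re_of_real[where F = "\<lambda>x. - \<i> * (exp (\<i> * x) - 1) / (exp (\<i> * x) + 1)"]
                derivative_intros)
        then show "?h differentiable at x within ?T'" by (rule differentiable_at_withinI)
      qed
    qed simp
    ultimately show "negligible ?S" by (rule negligible_subset[rotated])
  qed
  then show ?thesis using null_sets_circle_iff_cis[OF N] by simp
qed

lemma AE_circle_iff_cayley:
  assumes "{z \<in> space circle. P z} \<in> sets circle"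
  shows "(AE z in circle. P z) \<longleftrightarrow> (AE t in lborel. P (cayley t))"
proof -
  have N: "{z \<in> space circle. \<not> P z} \<in> sets circle"
    using sets.compl_sets[OF assms] by (simp add: set_diff_eq conj_commute) (metis (no_types, lifting) Collect_cong)
  have "(AE z in circle. P z) \<longleftrightarrow> {z \<in> space circle. \<not> P z} \<in> null_sets circle"
    using N by (rule AE_iff_null)
  also have "\<dots> \<longleftrightarrow> negligible {t. cayley t \<in> {z \<in> space circle. \<not> P z}}"
    using N by (rule null_sets_circle_iff)
  also have "{t. cayley t \<in> {z \<in> space circle. \<not> P z}} = {t. \<not> P (cayley t)}" by simp
  also have "negligible \<dots> \<longleftrightarrow> (AE t in lebesgue. P (cayley t))"
    by (auto simp: eventually_ae_filter simp flip: negligible_iff_null_sets intro: negligible_subset)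
  also have "\<dots> \<longleftrightarrow> (AE t in lborel. P (cayley t))" by (rule AE_completion_iff)
  finally show ?thesis .
qed

section \<open>Moebius maps on the circle: measurability and null sets\<close>

lemma continuous_on_disk_auto:
  assumes "cmod c < cmod d"
  shows "continuous_on (cball 0 1) (disk_auto m c d)"
  unfolding disk_auto_def
  by (intro continuous_intros) (use disk_auto_denom_nonzero[OF assms] in auto)

lemma measurable_disk_auto:
  assumes "cmod m = 1" "cmod c < cmod d"
  shows "disk_auto m c d \<in> circle \<rightarrow>\<^sub>M circle"
proof (rule measurable_circle_continuous)
  show "continuous_on (sphere 0 1) (disk_auto m c d)"
    by (rule continuous_on_subset[OF continuous_on_disk_auto[OF assms(2)]]) auto
qed (rule cmod_disk_auto(2)[OF assms])

text \<open>The preimage of a null set under the map is its image under the inverse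
  \<open>?\<psi>\<close>, and in the Cayley coordinate \<open>?\<psi>\<close> is differentiable
  wherever its value is not \<open>-1\<close>.\<close>

lemma AE_circle_disk_auto:
  assumes m: "cmod m = 1" and cd: "cmod c < cmod d" and P: "AE z in circle. P z"
  shows "AE z in circle. P (disk_auto m c d z)"
proof -
  let ?\<phi> = "disk_auto m c d" and ?\<psi> = "disk_auto m (- c) (m * cnj d)"
  have cd': "cmod (- c) < cmod (m * cnj d)" using m cd by (simp add: norm_mult)
  obtain N where N: "N \<in> null_sets circle" "{z \<in> space circle. \<not> P z} \<subseteq> N"
    using P by (auto simp: eventually_ae_filter)
  let ?N' = "?\<phi> -` N \<inter> space circle"
  have N': "?N' \<in> sets circle"
    using measurable_sets[OF measurable_disk_auto[OF m cd]] N by auto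
  \<comment> \<open>The point at infinity enters twice: parameters that \<open>?\<psi>\<close> sends
    to \<open>-1\<close> are dropped here, and the only \<open>t\<close> that can be mapped to
    \<open>-1\<close> is added as a singleton below.\<close>
  let ?S = "{s \<in> {s. cayley s \<in> N}. ?\<psi> (cayley s) \<noteq> -1}"
  let ?F = "\<lambda>w. - \<i> * (?\<psi> ((1 + \<i> * w) / (1 - \<i> * w)) - 1) / (?\<psi> ((1 + \<i> * w) / (1 - \<i> * w)) + 1)"
  let ?h = "\<lambda>s. Re (?F (of_real s))"
  have h: "?h s = cayley_inv (?\<psi> (cayley s))" for s by (simp add: cayley_inv_def cayley_def)
  have "{t. cayley t \<in> ?N'} \<subseteq> {cayley_inv (?\<psi> (-1))} \<union> ?h ` ?S"
  proof
    fix t assume "t \<in> {t. cayley t \<in> ?N'}"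
    then have t: "?\<phi> (cayley t) \<in> N" by auto
    have inv: "?\<psi> (?\<phi> (cayley t)) = cayley t" by (rule disk_auto_inverse[OF m cd]) simp
    show "t \<in> {cayley_inv (?\<psi> (-1))} \<union> ?h ` ?S"
    proof (cases "?\<phi> (cayley t) = -1")
      case True
      then show ?thesis using inv cayley_inv_cayley[of t] by simp
    next
      case False
      then obtain s where s: "?\<phi> (cayley t) = cayley s"
        using cayley_surj[OF cmod_disk_auto(2)[OF m cd, of "cayley t"]] by auto
      then have "?\<psi> (cayley s) = cayley t" using inv by simp
      then have "?h s = t" "s \<in> ?S" using h cayley_inv_cayley cayley_neq t s by auto
      then show ?thesis by (intro UnI2 image_eqI[of _ _ s]) auto
    qed
  qed
  moreover have "negligible (?h ` ?S)"
  proof (rule negligible_differentiable_image_negligible)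
    have "negligible {s. cayley s \<in> N}" using N null_sets_circle_iff by auto
    then show "negligible ?S" by (rule negligible_subset) auto
    show "?h differentiable_on ?S"
      unfolding differentiable_on_def
    proof
      fix s assume s: "s \<in> ?S"
      have nz: "?\<psi> (cayley s) + 1 \<noteq> 0" "- c * cayley s + m * cnj d \<noteq> 0"
        using s disk_auto_denom_nonzero[OF cd', of "cayley s"] by (auto simp: add_eq_0_iff2)
      have "?F field_differentiable at (of_real s)"
        using nz cayley_denom_nonzero[of s] unfolding disk_auto_def cayley_def
        by (intro derivative_intros) auto
      then have "?h differentiable at s" by (rule differentiable_Re_of_real)
      then show "?h differentiable at s within ?S" by (rule differentiable_at_withinI)
    qed
  qed simp
  ultimately have "negligible {t. cayley t \<in> ?N'}"
    by (meson negligible_Un negligible_sing negligible_subset)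
  then have "?N' \<in> null_sets circle" using null_sets_circle_iff[OF N'] by simp
  moreover have "{z \<in> space circle. \<not> P (?\<phi> z)} \<subseteq> ?N'"
    using N(2) cmod_disk_auto(2)[OF m cd] by auto
  ultimately show ?thesis by (rule AE_I')
qed

lemma disk_moebius_measurable: "\<phi> \<in> disk_moebius \<Longrightarrow> \<phi> \<in> circle \<rightarrow>\<^sub>M circle"
  using disk_moebius_imp_disk_auto measurable_disk_auto by metis

lemma AE_circle_disk_moebius:
  assumes "\<phi> \<in> disk_moebius" "AE z in circle. P z"
  shows "AE z in circle. P (\<phi> z)"
  using disk_moebius_imp_disk_auto[OF assms(1)] AE_circle_disk_auto[OF _ _ assms(2)] by metis

lemma disk_moebius_inverse:
  assumes "\<phi> \<in> disk_moebius"
  obtains \<psi> where "\<psi> \<in> disk_moebius" "\<And>z. cmod z \<le> 1 \<Longrightarrow> \<psi> (\<phi> z) = z" "\<And>z. cmod z \<le> 1 \<Longrightarrow> \<phi> (\<psi> z) = z"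
proof -
  obtain m c d where m: "cmod m = 1" and cd: "cmod c < cmod d" and \<phi>: "\<phi> = disk_auto m c d"
    using disk_moebius_imp_disk_auto[OF assms] .
  have "cmod (- c) < cmod (m * cnj d)" using m cd by (simp add: norm_mult)
  from that[OF disk_auto_in_disk_moebius[OF m this]] show thesis
    unfolding \<phi> using disk_auto_inverse[OF m cd] by simp
qed

text \<open>Agreement is claimed on the closed disk only: at a pole of the inner map, division by
  zero gives the value \<open>0\<close>, and there the composite differs in general from the product
  of the matrices.\<close>

lemma disk_moebius_compose:
  assumes "\<phi> \<in> disk_moebius" "\<psi> \<in> disk_moebius"
  obtains \<rho> where "\<rho> \<in> disk_moebius" "\<And>z. cmod z \<le> 1 \<Longrightarrow> \<rho> z = \<phi> (\<psi> z)"
proof -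
  obtain m c d where m: "cmod m = 1" and cd: "cmod c < cmod d" and \<phi>: "\<phi> = disk_auto m c d"
    using disk_moebius_imp_disk_auto[OF assms(1)] .
  obtain m' c' d' where m': "cmod m' = 1" and cd': "cmod c' < cmod d'" and \<psi>: "\<psi> = disk_auto m' c' d'"
    using disk_moebius_imp_disk_auto[OF assms(2)] .
  have "cmod (m * m') = 1" using m m' by (simp add: norm_mult)
  from that[OF disk_auto_in_disk_moebius[OF this disk_auto_compose(1)[OF m cd m' cd']]] show thesis
    unfolding \<phi> \<psi> using disk_auto_compose(2)[OF m cd m' cd'] by simp
qed

lemma disk_moebius_id: obtains \<kappa> where "\<kappa> \<in> disk_moebius" "\<And>z. \<kappa> z = z"
  using disk_auto_in_disk_moebius[of 1 0 1] by (auto simp: disk_auto_def)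

lemma disk_moebius_sphere: "\<phi> \<in> disk_moebius \<Longrightarrow> cmod z = 1 \<Longrightarrow> cmod (\<phi> z) = 1"
  using disk_moebius_imp_disk_auto cmod_disk_auto(2) by metis

lemma disk_moebius_ball: "\<phi> \<in> disk_moebius \<Longrightarrow> cmod z < 1 \<Longrightarrow> cmod (\<phi> z) < 1"
  using disk_moebius_imp_disk_auto cmod_disk_auto(1) by metis

section \<open>Composition with Moebius maps as an isometric automorphism of the algebra\<close>

lemma ess_bounded_compose:
  assumes "ess_bounded f" "\<phi> \<in> disk_moebius"
  shows "ess_bounded (\<lambda>z. f (\<phi> z))"
proof -
  obtain C where "AE z in circle. cmod (f z) \<le> C" using assms(1) by (auto simp: ess_bounded_def)
  from AE_circle_disk_moebius[OF assms(2) this]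
    measurable_compose[OF disk_moebius_measurable[OF assms(2)] ess_bounded_measurable[OF assms(1)]]
  show ?thesis by (auto simp: ess_bounded_def)
qed

lemma rep_compose_linf:
  assumes "\<phi> \<in> disk_moebius"
  shows "AE z in circle. rep_linf (compose_linf f \<phi>) z = rep_linf f (\<phi> z)"
  unfolding compose_linf_def by (rule rep_abs_linf[OF ess_bounded_compose[OF ess_bounded_rep assms]])

lemma compose_linf_add:
  assumes "\<phi> \<in> disk_moebius"
  shows "compose_linf (f + g) \<phi> = compose_linf f \<phi> + compose_linf g \<phi>"
proof (rule linf_eqI)
  show "AE z in circle. rep_linf (compose_linf (f + g) \<phi>) z = rep_linf (compose_linf f \<phi> + compose_linf g \<phi>) z"
    using rep_compose_linf[OF assms, of f] rep_compose_linf[OF assms, of g] rep_compose_linf[OF assms, of "f + g"]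
      rep_linf_add[of "compose_linf f \<phi>" "compose_linf g \<phi>"] AE_circle_disk_moebius[OF assms rep_linf_add[of f g]]
    by eventually_elim simp
qed

lemma compose_linf_mult:
  assumes "\<phi> \<in> disk_moebius"
  shows "compose_linf (f * g) \<phi> = compose_linf f \<phi> * compose_linf g \<phi>"
proof (rule linf_eqI)
  show "AE z in circle. rep_linf (compose_linf (f * g) \<phi>) z = rep_linf (compose_linf f \<phi> * compose_linf g \<phi>) z"
    using rep_compose_linf[OF assms, of f] rep_compose_linf[OF assms, of g] rep_compose_linf[OF assms, of "f * g"]
      rep_linf_mult[of "compose_linf f \<phi>" "compose_linf g \<phi>"] AE_circle_disk_moebius[OF assms rep_linf_mult[of f g]]
    by eventually_elim simp
qed

lemma compose_linf_scaleC:
  assumes "\<phi> \<in> disk_moebius"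
  shows "compose_linf (scaleC_linf c f) \<phi> = scaleC_linf c (compose_linf f \<phi>)"
proof (rule linf_eqI)
  show "AE z in circle. rep_linf (compose_linf (scaleC_linf c f) \<phi>) z = rep_linf (scaleC_linf c (compose_linf f \<phi>)) z"
    using rep_compose_linf[OF assms, of f] rep_compose_linf[OF assms, of "scaleC_linf c f"]
      rep_linf_scaleC[of c "compose_linf f \<phi>"] AE_circle_disk_moebius[OF assms rep_linf_scaleC[of c f]]
    by eventually_elim simp
qed

lemma compose_linf_cnj:
  assumes "\<phi> \<in> disk_moebius"
  shows "compose_linf (cnj_linf f) \<phi> = cnj_linf (compose_linf f \<phi>)"
proof (rule linf_eqI)
  show "AE z in circle. rep_linf (compose_linf (cnj_linf f) \<phi>) z = rep_linf (cnj_linf (compose_linf f \<phi>)) z"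
    using rep_compose_linf[OF assms, of f] rep_compose_linf[OF assms, of "cnj_linf f"]
      rep_linf_cnj[of "compose_linf f \<phi>"] AE_circle_disk_moebius[OF assms rep_linf_cnj[of f]]
    by eventually_elim simp
qed

lemma compose_linf_one:
  assumes "\<phi> \<in> disk_moebius"
  shows "compose_linf 1 \<phi> = 1"
proof (rule linf_eqI)
  show "AE z in circle. rep_linf (compose_linf 1 \<phi>) z = rep_linf 1 z"
    using rep_compose_linf[OF assms, of 1] rep_linf_one AE_circle_disk_moebius[OF assms rep_linf_one]
    by eventually_elim simp
qed

lemma compose_linf_compose:
  assumes "\<phi> \<in> disk_moebius" "\<psi> \<in> disk_moebius" "\<rho> \<in> disk_moebius"
    and "\<And>z. cmod z = 1 \<Longrightarrow> \<rho> z = \<phi> (\<psi> z)"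
  shows "compose_linf (compose_linf f \<phi>) \<psi> = compose_linf f \<rho>"
proof (rule linf_eqI)
  have "AE z in circle. \<rho> z = \<phi> (\<psi> z)" using assms(4) by (intro AE_I2) simp
  then show "AE z in circle. rep_linf (compose_linf (compose_linf f \<phi>) \<psi>) z = rep_linf (compose_linf f \<rho>) z"
    using AE_circle_disk_moebius[OF assms(2) rep_compose_linf[OF assms(1), of f]]
      rep_compose_linf[OF assms(2), of "compose_linf f \<phi>"] rep_compose_linf[OF assms(3), of f]
    by eventually_elim simp
qed

lemma compose_linf_ident:
  assumes "\<phi> \<in> disk_moebius" "\<And>z. cmod z = 1 \<Longrightarrow> \<phi> z = z"
  shows "compose_linf f \<phi> = f"
proof (rule linf_eqI)
  have "AE z in circle. \<phi> z = z" using assms(2) by (intro AE_I2) simp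
  then show "AE z in circle. rep_linf (compose_linf f \<phi>) z = rep_linf f z"
    using rep_compose_linf[OF assms(1), of f] by eventually_elim simp
qed

lemma norm_compose_linf_le:
  assumes "\<phi> \<in> disk_moebius"
  shows "norm (compose_linf f \<phi>) \<le> norm f"
proof (rule norm_linf_le)
  show "AE z in circle. cmod (rep_linf (compose_linf f \<phi>) z) \<le> norm f"
    using rep_compose_linf[OF assms, of f] AE_circle_disk_moebius[OF assms AE_le_norm_linf[of f]]
    by eventually_elim simp
qed

lemma compose_linf_inverse:
  assumes "\<phi> \<in> disk_moebius" "\<psi> \<in> disk_moebius" "\<And>z. cmod z \<le> 1 \<Longrightarrow> \<phi> (\<psi> z) = z"
  shows "compose_linf (compose_linf f \<phi>) \<psi> = f"
proof -
  obtain \<kappa> where \<kappa>: "\<kappa> \<in> disk_moebius" "\<And>z. \<kappa> z = z" by (rule disk_moebius_id) blast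
  have "compose_linf (compose_linf f \<phi>) \<psi> = compose_linf f \<kappa>"
    using assms \<kappa> by (intro compose_linf_compose) auto
  also have "\<dots> = f" using \<kappa> by (intro compose_linf_ident) auto
  finally show ?thesis .
qed

lemma norm_compose_linf:
  assumes "\<phi> \<in> disk_moebius"
  shows "norm (compose_linf f \<phi>) = norm f"
proof (rule antisym[OF norm_compose_linf_le[OF assms]])
  obtain \<psi> where \<psi>: "\<psi> \<in> disk_moebius" "\<And>z. cmod z \<le> 1 \<Longrightarrow> \<phi> (\<psi> z) = z"
    using disk_moebius_inverse[OF assms] by metis
  show "norm f \<le> norm (compose_linf f \<phi>)"
    using norm_compose_linf_le[OF \<psi>(1), of "compose_linf f \<phi>"] compose_linf_inverse[OF assms \<psi>] by simp
qed

lemma unimodular_compose: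
  assumes "\<phi> \<in> disk_moebius" "unimodular u"
  shows "unimodular (compose_linf u \<phi>)"
  unfolding unimodular_def
  using rep_compose_linf[OF assms(1), of u] AE_circle_disk_moebius[OF assms(1) unimodularD[OF assms(2)]]
  by eventually_elim simp

section \<open>Radial limits\<close>

text \<open>Points within \<open>r / 2\<close> of \<open>w\<close> still have distance at least
  \<open>r / 2\<close> from the circle, so Cauchy's inequality on circles of radius
  \<open>r / 4\<close> bounds the derivative by \<open>4 * M / r\<close>.\<close>

lemma holomorphic_bounded_lipschitz:
  assumes f: "f holomorphic_on ball 0 1" and M: "\<And>z. cmod z < 1 \<Longrightarrow> cmod (f z) \<le> M"
    and r: "0 < r" "cmod w + r \<le> 1" and z: "cmod (z - w) \<le> r / 2"
  shows "cmod (f z - f w) \<le> 4 * M / r * cmod (z - w)"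
proof (rule field_differentiable_bound[of "cball w (r / 2)" f "deriv f"])
  fix x assume "x \<in> cball w (r / 2)"
  then have x: "cmod (x - w) \<le> r / 2" by (simp add: dist_norm norm_minus_commute)
  have nx: "cmod x \<le> 1 - r / 2"
    using norm_triangle_ineq[of "x - w" w] x r by simp
  then have xb: "x \<in> ball 0 1" using r by simp
  have sub: "cball x (r / 4) \<subseteq> ball 0 1"
  proof
    fix y assume "y \<in> cball x (r / 4)"
    then have "cmod (y - x) \<le> r / 4" by (simp add: dist_norm norm_minus_commute)
    then show "y \<in> ball 0 1" using norm_triangle_ineq[of "y - x" x] nx r by simp
  qed
  show "(f has_field_derivative deriv f x) (at x within cball w (r / 2))"
    using holomorphic_derivI[OF f open_ball xb] by (rule has_field_derivative_at_within)
  have "cmod ((deriv ^^ 1) f x) \<le> fact 1 * M / (r / 4) ^ 1"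
  proof (rule Cauchy_inequality)
    show "f holomorphic_on ball x (r / 4)"
      using f by (rule holomorphic_on_subset) (use sub in auto)
    show "continuous_on (cball x (r / 4)) f"
      using holomorphic_on_imp_continuous_on[OF f] sub by (rule continuous_on_subset)
    show "cmod (f y) \<le> M" if "cmod (x - y) = r / 4" for y
      using that sub by (intro M) (auto simp: dist_norm)
  qed (use r in auto)
  then show "cmod (deriv f x) \<le> 4 * M / r" by (simp add: field_simps)
qed (use z r in \<open>auto simp: dist_norm norm_minus_commute\<close>)

text \<open>The image of a radius under \<open>\<phi>\<close> approaches the radius ending at \<open>\<phi> \<zeta>\<close> quadratically in the distance
  to the boundary, while the derivative of a bounded analytic function grows only like the inverse of that distance.\<close>

lemma disk_auto_radius:
  assumes cd: "cmod c < cmod d" and z: "cmod z = 1" and r: "0 \<le> r" "r \<le> 1"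
  defines "k \<equiv> ((cmod d)\<^sup>2 - (cmod c)\<^sup>2) / (cmod (c * z + d))\<^sup>2"
    and "K \<equiv> ((cmod d)\<^sup>2 - (cmod c)\<^sup>2) * cmod c / ((cmod (c * z + d))\<^sup>2 * (cmod d - cmod c))"
  assumes m: "cmod m = 1"
  shows "cmod (disk_auto m c d (of_real r * z) - of_real (1 - (1 - r) * k) * disk_auto m c d z) \<le> K * (1 - r)\<^sup>2"
proof -
  define q where "q = c * z + d"
  define g where "g = c * (of_real r * z) + d"
  define D where "D = (cmod d)\<^sup>2 - (cmod c)\<^sup>2"
  define w where "w = disk_auto m c d z"
  have zz: "z * cnj z = 1" using complex_norm_square[of z] z by simp
  have z0: "z \<noteq> 0" using z by auto
  have q: "q \<noteq> 0" unfolding q_def by (rule disk_auto_denom_nonzero[OF cd]) (simp add: z)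
  have g: "g \<noteq> 0" unfolding g_def
    by (rule disk_auto_denom_nonzero[OF cd]) (use r z in \<open>simp add: norm_mult\<close>)
  have q': "cnj q \<noteq> 0" using q by simp
  have D: "complex_of_real D = d * cnj d - c * cnj c"
    unfolding D_def of_real_diff complex_norm_square by simp
  have k: "complex_of_real k = (d * cnj d - c * cnj c) / (q * cnj q)"
    unfolding k_def q_def[symmetric] of_real_divide D_def[symmetric] D complex_norm_square by simp
  have zq: "cnj d * z + cnj c = z * cnj q" using zz by (simp add: q_def algebra_simps)
  have w: "w = m * (z * cnj q) / q"
    unfolding w_def disk_auto_def q_def[symmetric] zq[symmetric] by (simp add: algebra_simps)
  have "disk_auto m c d (of_real r * z) = m * (of_real r * (cnj d * z) + cnj c) / g"
    unfolding disk_auto_def g_def by (simp add: algebra_simps)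
  also have "cnj d * z = z * cnj q - cnj c" using zq by (simp add: algebra_simps)
  finally have p: "disk_auto m c d (of_real r * z) = m * (of_real r * (z * cnj q) + (1 - of_real r) * cnj c) / g"
    by (simp add: algebra_simps)
  \<comment> \<open>\<open>k\<close> is the modulus of the derivative at \<open>z\<close>, so the
    terms of first order in \<open>1 - r\<close> cancel and an exact quadratic remainder is left.
    Once denominators are cleared, the identity is polynomial modulo
    \<open>cnj z * z = 1\<close>.\<close>
  have "disk_auto m c d (of_real r * z) - of_real (1 - (1 - r) * k) * w
      = - w * (1 - of_real r)\<^sup>2 * of_real D * (c * z) / (q * cnj q * g)" (is "?L = ?R")
  proof -
    have "?L * (q * cnj q * g) * q = ?R * (q * cnj q * g) * q"
    proof -
      have c1: "cnj z * z = 1" using zz by (simp add: mult.commute)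
      have "?L * (q * cnj q * g) * q
         = m * (of_real r * (z * cnj q) + (1 - of_real r) * cnj c) * q * cnj q * q
           - (q * cnj q - (1 - of_real r) * (d * cnj d - c * cnj c)) * (m * (z * cnj q)) * g"
        unfolding p w using q g q' by (simp add: k field_simps)
      moreover have "?R * (q * cnj q * g) * q
         = - (m * (z * cnj q)) * (1 - of_real r)\<^sup>2 * (d * cnj d - c * cnj c) * (c * z)"
        unfolding D w using q g q' by (simp add: field_simps)
      moreover have "m * (of_real r * (z * cnj q) + (1 - of_real r) * cnj c) * q * cnj q * q
           - (q * cnj q - (1 - of_real r) * (d * cnj d - c * cnj c)) * (m * (z * cnj q)) * g
         = - (m * (z * cnj q)) * (1 - of_real r)\<^sup>2 * (d * cnj d - c * cnj c) * (c * z)"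
        using c1 unfolding q_def g_def complex_cnj_add complex_cnj_mult by algebra
      ultimately show ?thesis by simp
    qed
    moreover have "q * cnj q * g \<noteq> 0" using q g q' by simp
    ultimately show ?thesis using mult_right_cancel[OF q] mult_right_cancel[of "q * cnj q * g"] by blast
  qed
  moreover have r1: "cmod (1 - of_real r) = 1 - r"
    using norm_of_real[of "1 - r", where 'a = complex] r by simp
  ultimately have eq: "cmod ?L = cmod w * (1 - r)\<^sup>2 * \<bar>D\<bar> * (cmod c * 1) / ((cmod q)\<^sup>2 * cmod g)"
    using z by (simp only: norm_mult norm_divide norm_power r1 norm_minus_cancel norm_of_real
        complex_mod_cnj) (simp add: power2_eq_square)
  have w1: "cmod w = 1" unfolding w_def by (rule cmod_disk_auto(2)[OF m cd z])
  have D0: "0 < D" using cd by (simp add: D_def power_strict_mono)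
  \<comment> \<open>This bounds the last factor that varies with \<open>r\<close>, so that
    \<open>K\<close> is uniform along the radius.\<close>
  have gge: "cmod d - cmod c \<le> cmod g"
  proof -
    have "cmod (c * (of_real r * z)) \<le> cmod c" using r z by (simp add: norm_mult mult_left_le)
    then show ?thesis using norm_triangle_ineq2[of d "- (c * (of_real r * z))"]
      by (simp add: g_def add.commute)
  qed
  have "cmod ?L \<le> (1 - r)\<^sup>2 * D * cmod c / ((cmod q)\<^sup>2 * (cmod d - cmod c))"
    unfolding eq w1 using D0 gge cd q by (intro frac_le mult_mono) auto
  then show ?thesis by (simp add: K_def D_def w_def q_def mult_ac)
qed

lemma Hinf_bounded:
  assumes "f \<in> Hinf"
  obtains M where "\<And>z. cmod z < 1 \<Longrightarrow> cmod (f z) \<le> M"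
proof -
  obtain M where "\<And>w. w \<in> f ` ball 0 1 \<Longrightarrow> cmod w \<le> M"
    using assms unfolding Hinf_def bounded_iff by blast
  then show thesis by (intro that[of M]) auto
qed

text \<open>At each \<open>r\<close> the curve is compared with the point of parameter
  \<open>s r\<close> on the straight radius. Since \<open>k > 0\<close>, \<open>s\<close> tends to 1
  from below and the given limit survives the reparametrisation; the values of \<open>f\<close> at
  the two points differ by \<open>O(1 - r)\<close>.\<close>

lemma radial_limit_transfer:
  assumes f: "f \<in> Hinf" and \<phi>: "\<phi> \<in> disk_moebius" and z: "cmod z = 1"
    and lim: "((\<lambda>r. f (of_real r * \<phi> z)) \<longlongrightarrow> l) (at_left 1)"
  shows "((\<lambda>r. f (\<phi> (of_real r * z))) \<longlongrightarrow> l) (at_left 1)"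
proof -
  obtain m c d where m: "cmod m = 1" and cd: "cmod c < cmod d" and \<phi>_eq: "\<phi> = disk_auto m c d"
    using disk_moebius_imp_disk_auto[OF \<phi>] .
  obtain M where M: "\<And>z. cmod z < 1 \<Longrightarrow> cmod (f z) \<le> M"
    using Hinf_bounded[OF f] by blast
  have holf: "f holomorphic_on ball 0 1" using f by (simp add: Hinf_def)
  have M0: "0 \<le> M" using order_trans[OF norm_ge_zero M[of 0]] by simp
  define k where "k = ((cmod d)\<^sup>2 - (cmod c)\<^sup>2) / (cmod (c * z + d))\<^sup>2"
  define K where "K = ((cmod d)\<^sup>2 - (cmod c)\<^sup>2) * cmod c / ((cmod (c * z + d))\<^sup>2 * (cmod d - cmod c))"
  define s where "s r = 1 - (1 - r) * k" for r :: real
  have q: "c * z + d \<noteq> 0" by (rule disk_auto_denom_nonzero[OF cd]) (simp add: z)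
  have dc: "(cmod c)\<^sup>2 < (cmod d)\<^sup>2" using cd by (simp add: power_strict_mono)
  have k0: "0 < k" using dc q by (simp add: k_def)
  have K0: "0 \<le> K" using dc cd by (simp add: K_def)
  have w1: "cmod (\<phi> z) = 1" by (rule disk_moebius_sphere[OF \<phi> z])
  have near: "cmod (\<phi> (of_real r * z) - of_real (s r) * \<phi> z) \<le> K * (1 - r)\<^sup>2" if "0 \<le> r" "r \<le> 1" for r
    unfolding \<phi>_eq s_def k_def K_def by (rule disk_auto_radius[OF cd z that m])
  have "(s \<longlongrightarrow> s 1) (at_left 1)" unfolding s_def by (intro tendsto_intros)
  then have s1: "(s \<longlongrightarrow> 1) (at_left 1)" by (simp add: s_def)
  have lt1: "\<forall>\<^sub>F r in at_left 1. r < (1::real)" by (simp add: eventually_at_filter)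
  have "filterlim s (at_left 1) (at_left 1)"
    unfolding filterlim_at using s1 lt1 k0 by (auto simp: s_def elim!: eventually_mono)
  with lim have lim_s: "((\<lambda>r. f (of_real (s r) * \<phi> z)) \<longlongrightarrow> l) (at_left 1)"
    by (rule filterlim_compose)
  have "((\<lambda>r. f (\<phi> (of_real r * z)) - f (of_real (s r) * \<phi> z)) \<longlongrightarrow> 0) (at_left 1)"
  proof (rule Lim_null_comparison)
    have "((\<lambda>r. 4 * M * K / k * (1 - r)) \<longlongrightarrow> 4 * M * K / k * (1 - 1)) (at_left 1)"
      by (intro tendsto_intros)
    then show "((\<lambda>r. 4 * M * K / k * (1 - r)) \<longlongrightarrow> 0) (at_left 1)" by simp
    have gt: "\<forall>\<^sub>F r in at_left 1. b < r" if "b < 1" for b :: real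
      using that eventually_at_left_real[OF that] by (auto elim: eventually_mono)
    \<comment> \<open>The first threshold keeps \<open>s r\<close> positive, so its point has
      distance exactly \<open>t * k\<close> from the circle; the second puts the two points within
      half that distance of each other. The \<open>+ 1\<close> covers \<open>K = 0\<close>, which
      occurs for \<open>c = 0\<close>.\<close>
    have b2: "1 - 1 / k < 1" "1 - k / (2 * K + 1) < 1" using k0 K0 by simp_all
    show "\<forall>\<^sub>F r in at_left 1. cmod (f (\<phi> (of_real r * z)) - f (of_real (s r) * \<phi> z)) \<le> 4 * M * K / k * (1 - r)"
      using lt1 gt[of 0, OF zero_less_one] gt[OF b2(1)] gt[OF b2(2)]
    proof eventually_elim
      case (elim r)
      define t where "t = 1 - r"
      have t: "0 < t" "t * k < 1" "t * (2 * K + 1) < k"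
        using elim k0 K0 by (simp_all add: t_def field_simps)
      have s: "s r = 1 - t * k" by (simp add: s_def t_def)
      have close: "cmod (\<phi> (of_real r * z) - of_real (s r) * \<phi> z) \<le> K * t\<^sup>2"
        using near[of r] elim by (simp add: t_def)
      have "\<bar>s r\<bar> + t * k = 1" using t by (simp add: s)
      then have sw: "cmod (of_real (s r) * \<phi> z) + t * k \<le> 1" by (simp only: norm_mult norm_of_real w1 mult_1_right)
      have "K * t\<^sup>2 \<le> t * k / 2"
      proof -
        have "t * (2 * (K * t)) \<le> t * k" using t by (intro mult_left_mono) (auto simp: algebra_simps)
        then show ?thesis by (simp add: power2_eq_square mult_ac)
      qed
      then have "cmod (f (\<phi> (of_real r * z)) - f (of_real (s r) * \<phi> z))
          \<le> 4 * M / (t * k) * cmod (\<phi> (of_real r * z) - of_real (s r) * \<phi> z)"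
        using close sw t k0 by (intro holomorphic_bounded_lipschitz[OF holf M]) auto
      also have "\<dots> \<le> 4 * M / (t * k) * (K * t\<^sup>2)"
        using close M0 t k0 by (intro mult_left_mono) auto
      also have "\<dots> = 4 * M * K / k * t" using t k0 by (simp add: power2_eq_square)
      finally show ?case by (simp add: t_def)
    qed
  qed
  from tendsto_add[OF this lim_s] show ?thesis by simp
qed

text \<open>Both directions of the equivalence matter: \<open>radial_limit\<close> defaults to
  \<open>0\<close> where no limit exists, so failure of convergence must transfer as well. The
  converse is the transfer for the composed function and the inverse map.\<close>

lemma radial_limit_disk_compose:
  assumes f: "f \<in> Hinf" and \<phi>: "\<phi> \<in> disk_moebius" and F: "disk_compose f \<phi> \<in> Hinf" and z: "cmod z = 1"
  shows "radial_limit (disk_compose f \<phi>) z = radial_limit f (\<phi> z)"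
proof -
  have ev: "\<forall>\<^sub>F r in at_left 1. 0 < r \<and> r < (1::real)"
    using eventually_at_left_real[of 0 1] by (auto elim: eventually_mono)
  have "((\<lambda>r. disk_compose f \<phi> (of_real r * z)) \<longlongrightarrow> l) (at_left 1)
      \<longleftrightarrow> ((\<lambda>r. f (of_real r * \<phi> z)) \<longlongrightarrow> l) (at_left 1)" (is "?l \<longleftrightarrow> ?r") for l
  proof
    assume ?r
    from radial_limit_transfer[OF f \<phi> z this] show ?l
      by (rule Lim_transform_eventually)
         (use ev z in \<open>auto elim!: eventually_mono simp: disk_compose_def norm_mult\<close>)
  next
    assume l: ?l
    obtain \<psi> where \<psi>: "\<psi> \<in> disk_moebius" "\<And>z. cmod z \<le> 1 \<Longrightarrow> \<psi> (\<phi> z) = z"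
      "\<And>z. cmod z \<le> 1 \<Longrightarrow> \<phi> (\<psi> z) = z" using disk_moebius_inverse[OF \<phi>] by metis
    have w: "cmod (\<phi> z) = 1" by (rule disk_moebius_sphere[OF \<phi> z])
    have "((\<lambda>r. disk_compose f \<phi> (\<psi> (of_real r * \<phi> z))) \<longlongrightarrow> l) (at_left 1)"
      using l z by (intro radial_limit_transfer[OF F \<psi>(1) w]) (simp add: \<psi>)
    then show ?r
    proof (rule Lim_transform_eventually)
      show "\<forall>\<^sub>F r in at_left 1. disk_compose f \<phi> (\<psi> (of_real r * \<phi> z)) = f (of_real r * \<phi> z)"
        using ev
      proof eventually_elim
        case (elim r)
        then have "cmod (of_real r * \<phi> z) < 1" by (simp add: norm_mult w)
        then show ?case using disk_moebius_ball[OF \<psi>(1)] \<psi>(3) by (simp add: disk_compose_def)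
      qed
    qed
  qed
  note iff = this
  show ?thesis
  proof (cases "\<exists>l. ((\<lambda>r. f (of_real r * \<phi> z)) \<longlongrightarrow> l) (at_left 1)")
    case True
    then obtain l where l: "((\<lambda>r. f (of_real r * \<phi> z)) \<longlongrightarrow> l) (at_left 1)" by blast
    then have "((\<lambda>r. disk_compose f \<phi> (of_real r * z)) \<longlongrightarrow> l) (at_left 1)" using iff by blast
    with l show ?thesis unfolding radial_limit_def by (auto simp: tendsto_Lim)
  next
    case False
    then show ?thesis unfolding radial_limit_def iff by simp
  qed
qed

text \<open>Existence of a limit ranges over uncountably many radii and values. For continuous
  \<open>h\<close> the Cauchy criterion may be tested at rationals, leaving countable quantifiers
  only, from which measurability of the convergence set can be read off.\<close>

lemma left_limit_iff_rat_Cauchy: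
  fixes h :: "real \<Rightarrow> complex"
  assumes h: "continuous_on {0<..<1} h"
  shows "(\<exists>l. (h \<longlongrightarrow> l) (at_left 1)) \<longleftrightarrow>
    (\<forall>k::nat. \<exists>m::nat. \<forall>p q :: rat. 1 - 1 / real (m + 2) < of_rat p \<longrightarrow> of_rat p < (1::real) \<longrightarrow>
        1 - 1 / real (m + 2) < of_rat q \<longrightarrow> of_rat q < (1::real) \<longrightarrow> cmod (h (of_rat p) - h (of_rat q)) \<le> 1 / real (k + 1))"
    (is "?L \<longleftrightarrow> (\<forall>k. \<exists>m. \<forall>p q. ?P k m p q)")
proof
  assume ?L
  then obtain l where l: "(h \<longlongrightarrow> l) (at_left 1)" by blast
  show "\<forall>k. \<exists>m. \<forall>p q. ?P k m p q"
  proof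
    fix k :: nat
    define e where "e = 1 / real (k + 1) / 2"
    have "e > 0" by (simp add: e_def)
    then have "\<forall>\<^sub>F r in at_left 1. dist (h r) l < e" using l by (rule tendstoD[rotated])
    then obtain b where b: "b < 1" "\<And>r. b < r \<Longrightarrow> r < 1 \<Longrightarrow> dist (h r) l < e"
      by (auto simp: eventually_at_left_field)
    obtain m :: nat where m: "1 / (1 - b) < real m" using reals_Archimedean2 by blast
    then have "b < 1 - 1 / real (m + 2)" using b(1) by (simp add: field_simps)
    then have bm: "b < r" if "1 - 1 / real (m + 2) < r" for r using that by linarith
    have "?P k m p q" for p q
    proof (intro impI)
      assume "1 - 1 / real (m + 2) < of_rat p" "of_rat p < (1::real)"
        "1 - 1 / real (m + 2) < of_rat q" "of_rat q < (1::real)"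
      then have "dist (h (of_rat p)) l < e" "dist (h (of_rat q)) l < e" using b(2) bm by blast+
      then have "dist (h (of_rat p)) (h (of_rat q)) < 2 * e"
        using dist_triangle2[of "h (of_rat p)" "h (of_rat q)" l] by linarith
      then show "cmod (h (of_rat p) - h (of_rat q)) \<le> 1 / real (k + 1)"
        unfolding e_def dist_norm mult_2 field_sum_of_halves by (rule less_imp_le)
    qed
    then show "\<exists>m. \<forall>p q. ?P k m p q" by blast
  qed
next
  assume R: "\<forall>k. \<exists>m. \<forall>p q. ?P k m p q"
  define x :: "nat \<Rightarrow> rat" where "x n = 1 - 1 / of_nat (n + 2)" for n
  have x: "of_rat (x n) = 1 - 1 / real (n + 2)" for n
    by (simp add: x_def of_rat_diff of_rat_divide of_rat_add)
  have x1: "of_rat (x n) < (1::real)" for n by (simp add: x)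
  have xm: "1 - 1 / real (m + 2) < of_rat (x n)" if "m < n" for m n
    using that by (simp add: x field_simps)
  have "Cauchy (\<lambda>n. h (of_rat (x n)))"
  proof (rule metric_CauchyI)
    fix e :: real assume "0 < e"
    then obtain k where "1 / real (Suc k) < e" by (rule nat_approx_posE)
    then have k: "1 / real (k + 1) < e" by simp
    obtain m where m: "\<And>p q. ?P k m p q" using R by blast
    show "\<exists>M. \<forall>i\<ge>M. \<forall>n\<ge>M. dist (h (of_rat (x i))) (h (of_rat (x n))) < e"
    proof (intro exI[of _ "Suc m"] allI impI)
      fix i n assume "Suc m \<le> i" "Suc m \<le> n"
      then have "cmod (h (of_rat (x i)) - h (of_rat (x n))) \<le> 1 / real (k + 1)"
        using m xm x1 by simp
      then show "dist (h (of_rat (x i))) (h (of_rat (x n))) < e" using k by (simp add: dist_norm)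
    qed
  qed
  then obtain l where l: "(\<lambda>n. h (of_rat (x n))) \<longlonglongrightarrow> l"
    using Cauchy_convergent_iff convergent_def by blast
  have "(h \<longlongrightarrow> l) (at_left 1)"
  proof (rule tendstoI)
    fix e :: real assume e: "0 < e"
    then obtain k where "1 / real (Suc k) < e / 2" using nat_approx_posE[of "e / 2"] half_gt_zero by blast
    then have k: "1 / real (k + 1) < e / 2" by simp
    obtain m where m: "\<And>p q. ?P k m p q" using R by blast
    have "\<forall>\<^sub>F n in sequentially. dist (h (of_rat (x n))) l < e / 2" using l e by (intro tendstoD) auto
    then have "\<forall>\<^sub>F n in sequentially. m < n \<and> dist (h (of_rat (x n))) l < e / 2"
      using eventually_gt_at_top[of m] by eventually_elim simp
    then obtain n where n: "m < n" "dist (h (of_rat (x n))) l < e / 2"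
      by (auto simp: eventually_sequentially)
    let ?y = "h (of_rat (x n))"
    \<comment> \<open>The sample \<open>?y\<close> serves as an anchor close to \<open>l\<close>. A
      violation at a real \<open>r\<close> would persist on a neighbourhood by continuity, hence
      occur at a rational, where the criterion forbids it.\<close>
    have near: "cmod (h r - ?y) \<le> 1 / real (k + 1)" if r: "1 - 1 / real (m + 2) < r" "r < 1" for r
    proof (rule ccontr)
      assume "\<not> cmod (h r - ?y) \<le> 1 / real (k + 1)"
      then have gt: "1 / real (k + 1) < cmod (h r - ?y)" by simp
      let ?I = "{1 - 1 / real (m + 2)<..<1}"
      have m2: "1 / real (m + 2) < 1" by simp
      have "continuous_on ?I h"
        by (rule continuous_on_subset[OF h])
          (unfold greaterThanLessThan_subseteq_greaterThanLessThan, use m2 in linarith)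
      then have "continuous_on ?I (\<lambda>r. cmod (h r - ?y))" by (intro continuous_intros)
      then have "open ((\<lambda>r. cmod (h r - ?y)) -` {1 / real (k + 1)<..} \<inter> ?I)"
        by (intro continuous_on_open_vimage[THEN iffD1, rule_format]) auto
      moreover have "r \<in> (\<lambda>r. cmod (h r - ?y)) -` {1 / real (k + 1)<..} \<inter> ?I" using gt r by simp
      ultimately obtain d where d: "0 < d" "ball r d \<subseteq> (\<lambda>r. cmod (h r - ?y)) -` {1 / real (k + 1)<..} \<inter> ?I"
        using openE by blast
      obtain p :: rat where p: "r < of_rat p" "of_rat p < r + d" using of_rat_dense[of r "r + d"] d by auto
      then have "of_rat p \<in> ball r d" by (simp add: dist_real_def)
      then have "1 / real (k + 1) < cmod (h (of_rat p) - ?y)" "of_rat p \<in> ?I" using d by auto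
      with m[of p "x n"] xm[OF n(1)] x1[of n] show False by simp
    qed
    have "1 - 1 / real (m + 2) < 1" by simp
    from eventually_at_left_real[OF this]
    show "\<forall>\<^sub>F r in at_left 1. dist (h r) l < e"
    proof eventually_elim
      case (elim r)
      then have "dist (h r) ?y < e / 2" using near[of r] k by (simp add: dist_norm)
      then show ?case using n(2) dist_triangle[of "h r" l ?y] by simp
    qed
  qed
  then show ?L by blast
qed

text \<open>On the measurable set where the radial limit exists it is a sequential limit of
  measurable functions of \<open>z\<close>; elsewhere it is \<open>0\<close>. Cutting the sequence
  off outside that set makes it converge at every point.\<close>

lemma ess_bounded_radial_limit:
  assumes f: "f \<in> Hinf"
  shows "ess_bounded (radial_limit f)"
proof -
  obtain M where M: "\<And>z. cmod z < 1 \<Longrightarrow> cmod (f z) \<le> M"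
    using Hinf_bounded[OF f] by blast
  have M0: "0 \<le> M" using order_trans[OF norm_ge_zero M[of 0]] by simp
  have contf: "continuous_on (ball 0 1) f"
    using f holomorphic_on_imp_continuous_on by (auto simp: Hinf_def)
  have ev: "\<forall>\<^sub>F r in at_left 1. 0 < r \<and> r < (1::real)"
    using eventually_at_left_real[of 0 1] by (auto elim: eventually_mono)
  have meas[measurable]: "(\<lambda>z. f (of_real r * z)) \<in> borel_measurable circle" for r
  proof (cases "\<bar>r\<bar> < 1")
    case True
    have "continuous_on (sphere 0 1) (\<lambda>z. f (of_real r * z))"
      using True by (intro continuous_on_compose2[OF contf] continuous_intros) (auto simp: norm_mult)
    then have "(\<lambda>z. f (of_real r * z)) \<in> borel_measurable (restrict_space borel (sphere 0 1))"
      by (rule borel_measurable_continuous_on_restrict)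
    then show ?thesis using measurable_cong_sets[OF sets_circle refl] by blast
  next
    \<comment> \<open>The rational radii in \<open>?P\<close> are unrestricted; for those of modulus
      at least 1 the extension of \<open>f\<close> by zero gives the zero function.\<close>
    case False
    have "f (of_real r * z) = 0" if "z \<in> space circle" for z
      using that False f by (auto simp: Hinf_def norm_mult)
    from measurable_cong[of circle "\<lambda>z. f (of_real r * z)" "\<lambda>_. 0", OF this] show ?thesis by simp
  qed
  let ?E = "\<lambda>z. \<exists>l. ((\<lambda>r. f (of_real r * z)) \<longlongrightarrow> l) (at_left 1)"
  let ?P = "\<lambda>z. \<forall>k::nat. \<exists>m::nat. \<forall>p q :: rat. 1 - 1 / real (m + 2) < of_rat p \<longrightarrow> of_rat p < (1::real) \<longrightarrow>
        1 - 1 / real (m + 2) < of_rat q \<longrightarrow> of_rat q < (1::real) \<longrightarrow>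
        cmod (f (of_real (of_rat p) * z) - f (of_real (of_rat q) * z)) \<le> 1 / real (k + 1)"
  have EP: "?E z \<longleftrightarrow> ?P z" if "z \<in> space circle" for z
  proof (rule left_limit_iff_rat_Cauchy)
    show "continuous_on {0<..<1} (\<lambda>r. f (of_real r * z))"
      using that by (intro continuous_on_compose2[OF contf] continuous_intros) (auto simp: norm_mult)
  qed
  have "Measurable.pred circle (\<lambda>z. cmod (f (of_real p * z) - f (of_real q * z)) \<le> e)" for p q e
    by measurable
  then have "Measurable.pred circle ?P"
    by (intro pred_intros_countable(1,2) pred_intros_imp')
  then have E[measurable]: "Measurable.pred circle ?E"
    by (simp only: measurable_cong[of circle ?E ?P, OF EP])
  define x where "x n = 1 - 1 / real (n + 2)" for n
  have x: "filterlim x (at_left 1) sequentially"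
    unfolding filterlim_at
  proof
    have "(\<lambda>n. 1 / real (n + 2)) \<longlonglongrightarrow> 0"
      using LIMSEQ_ignore_initial_segment[OF lim_1_over_n, of 2] by (simp add: add.commute)
    from tendsto_diff[OF tendsto_const this, of 1] show "x \<longlonglongrightarrow> 1" unfolding x_def by simp
  qed (auto simp: x_def)
  have lim: "((\<lambda>r. f (of_real r * z)) \<longlongrightarrow> radial_limit f z) (at_left 1)" if "?E z" for z
    using that by (auto simp: radial_limit_def tendsto_Lim)
  have "(\<lambda>z. radial_limit f z) \<in> borel_measurable circle"
  proof (rule borel_measurable_LIMSEQ_metric)
    show "(\<lambda>z. if ?E z then f (of_real (x n) * z) else 0) \<in> borel_measurable circle" for n by measurable
    show "(\<lambda>n. if ?E z then f (of_real (x n) * z) else 0) \<longlonglongrightarrow> radial_limit f z" for z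
    proof (cases "?E z")
      case True
      then show ?thesis using filterlim_compose[OF lim[OF True] x] by simp
    qed (simp add: radial_limit_def)
  qed
  moreover have "cmod (radial_limit f z) \<le> M" if "z \<in> space circle" for z
  proof (cases "?E z")
    case True
    show ?thesis
    proof (rule tendsto_upperbound[OF tendsto_norm[OF lim[OF True]]])
      show "\<forall>\<^sub>F r in at_left 1. cmod (f (of_real r * z)) \<le> M"
        using ev by eventually_elim (use that in \<open>auto intro!: M simp: norm_mult\<close>)
    qed simp
  qed (simp add: radial_limit_def M0)
  then have "AE z in circle. cmod (radial_limit f z) \<le> M" by (rule AE_I2)
  ultimately show ?thesis by (auto simp: ess_bounded_def)
qed

lemma compose_boundary_function:
  assumes f: "f \<in> Hinf" and \<phi>: "\<phi> \<in> disk_moebius" and F: "disk_compose f \<phi> \<in> Hinf"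
  shows "compose_linf (boundary_function f) \<phi> = boundary_function (disk_compose f \<phi>)"
proof (rule linf_eqI)
  have "AE z in circle. radial_limit (disk_compose f \<phi>) z = radial_limit f (\<phi> z)"
    using radial_limit_disk_compose[OF f \<phi> F] by (intro AE_I2) simp
  then show "AE z in circle. rep_linf (compose_linf (boundary_function f) \<phi>) z
      = rep_linf (boundary_function (disk_compose f \<phi>)) z"
    unfolding boundary_function_def
    using rep_compose_linf[OF \<phi>, of "abs_linf (radial_limit f)"]
      AE_circle_disk_moebius[OF \<phi> rep_abs_linf[OF ess_bounded_radial_limit[OF f]]]
      rep_abs_linf[OF ess_bounded_radial_limit[OF F]]
    by eventually_elim simp
qed

text \<open>Composition is a unital isometric *-homomorphism, so the functions whose composite lies
  in the algebra form a closed sub-C*-algebra. It contains the generators by the invariance of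
  \<open>Y\<close>.\<close>

lemma compose_linf_generated:
  assumes Y: "Y \<subseteq> Hinf" and inv: "\<And>f. f \<in> Y \<Longrightarrow> disk_compose f \<phi> \<in> Y" and \<phi>: "\<phi> \<in> disk_moebius"
    and f: "f \<in> cstar_generated (boundary_function ` Y)"
  shows "compose_linf f \<phi> \<in> cstar_generated (boundary_function ` Y)"
proof -
  let ?A = "cstar_generated (boundary_function ` Y)"
  have A: "sub_cstar_algebra ?A" by (rule sub_cstar_algebra_generated)
  let ?B = "{f. compose_linf f \<phi> \<in> ?A}"
  have "compose_linf f \<phi> - compose_linf g \<phi> = compose_linf (f - g) \<phi>" for f g
    using compose_linf_add[OF \<phi>, of "f - g" g] by simp
  then have "dist (compose_linf f \<phi>) (compose_linf g \<phi>) = dist f g" for f g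
    by (simp add: dist_norm norm_compose_linf[OF \<phi>])
  then have cont: "continuous_on UNIV (\<lambda>f. compose_linf f \<phi>)"
    unfolding continuous_on_iff by auto
  have "closed ?B"
    using closed_vimage[OF sub_cstarD(6)[OF A] cont] by (simp add: vimage_def)
  then have "sub_cstar_algebra ?B"
    using A by (simp add: sub_cstar_algebra_def compose_linf_one[OF \<phi>] compose_linf_add[OF \<phi>]
        compose_linf_scaleC[OF \<phi>] compose_linf_mult[OF \<phi>] compose_linf_cnj[OF \<phi>])
  moreover have "boundary_function ` Y \<subseteq> ?B"
  proof clarsimp
    fix f assume "f \<in> Y"
    then have "compose_linf (boundary_function f) \<phi> = boundary_function (disk_compose f \<phi>)"
      using Y inv by (intro compose_boundary_function \<phi>) auto
    then show "compose_linf (boundary_function f) \<phi> \<in> ?A"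
      using inv[OF \<open>f \<in> Y\<close>] by (simp add: cstar_generated_def hull_inc)
  qed
  ultimately have "?A \<subseteq> ?B" unfolding cstar_generated_def by (intro hull_minimal)
  then show ?thesis using f by auto
qed

section \<open>Concentration under Moebius transformations\<close>

text \<open>A weak density theorem by covering. If every interval missed \<open>E\<close> in
  proportion at least \<open>e\<close>, then a covering of a bounded part \<open>S\<close> by
  non-overlapping intervals would overshoot \<open>S\<close> by at least \<open>e * s\<close>, where
  \<open>s\<close> is its measure; but some covering overshoots by at most
  \<open>e * s / 2\<close>.\<close>

lemma interval_of_density:
  fixes E :: "real set"
  assumes E[measurable]: "E \<in> sets borel" and pos: "emeasure lborel E \<noteq> 0" and e: "0 < e"
  obtains a b where "a < b" "emeasure lborel ({a<..<b} - E) < ennreal (e * (b - a))"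
proof (rule ccontr)
  assume neg: "\<not> thesis"
  note found = that
  have ge: "ennreal (e * (b - a)) \<le> emeasure lborel ({a<..<b} - E)" if "a < b" for a b
  proof (rule ccontr)
    assume "\<not> ennreal (e * (b - a)) \<le> emeasure lborel ({a<..<b} - E)"
    then have "emeasure lborel ({a<..<b} - E) < ennreal (e * (b - a))" by (simp only: not_le)
    with neg found[OF that] show False by blast
  qed
  have "\<exists>N::nat. emeasure lborel (E \<inter> {- real N..real N}) \<noteq> 0"
  proof (rule ccontr)
    assume "\<not> ?thesis"
    then have "(\<Union>N. E \<inter> {- real N..real N}) \<in> null_sets lborel"
      by (intro null_sets_UN) (auto simp: null_sets_def)
    moreover have "(\<Union>N. E \<inter> {- real N..real N}) = E"
    proof -
      have "\<exists>N. - real N \<le> x \<and> x \<le> real N" for x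
        using real_arch_simple[of "\<bar>x\<bar>"] by (auto simp: abs_le_iff) (metis minus_le_iff)
      then show ?thesis by auto
    qed
    ultimately show False using pos by (simp add: null_sets_def)
  qed
  then obtain N :: nat where N: "emeasure lborel (E \<inter> {- real N..real N}) \<noteq> 0" by blast
  define S where "S = E \<inter> {- real N..real N}"
  have S_sets[measurable]: "S \<in> sets borel" unfolding S_def by measurable
  have "emeasure lborel S \<le> emeasure lborel {- real N..real N}"
    by (rule emeasure_mono) (auto simp: S_def)
  then have fin: "emeasure lborel S < \<infinity>" by (simp add: le_less_trans)
  define s where "s = measure lborel S"
  have Ss: "emeasure lborel S = ennreal s"
    unfolding s_def using fin by (intro emeasure_eq_ennreal_measure) auto
  have s0: "0 < s" using N unfolding S_def[symmetric] Ss by (simp add: ennreal_eq_0_iff)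
  have Sm: "S \<in> lmeasurable" using fin by (simp add: fmeasurable_def)
  obtain \<D> where D: "countable \<D>"
    "\<And>K. K \<in> \<D> \<Longrightarrow> K \<subseteq> cbox (- real N) (real N) \<and> K \<noteq> {} \<and> (\<exists>c d. K = cbox c d)"
    "pairwise (\<lambda>A B. interior A \<inter> interior B = {}) \<D>"
    "S \<subseteq> \<Union>\<D>" "\<Union>\<D> \<in> lmeasurable" "measure lebesgue (\<Union>\<D>) \<le> measure lebesgue S + e * s / 2"
    by (rule measurable_outer_intervals_bounded[OF Sm, of "- real N" "real N" "e * s / 2"])
       (use e s0 in \<open>auto simp: S_def\<close>)
  \<comment> \<open>The assumed estimate concerns open intervals, hence interiors; the endpoints
    lost are null, and degenerate cells have empty interior.\<close>
  have K: "interior K \<in> sets borel" "K \<in> sets borel" "emeasure lborel (K - interior K) = 0"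
    "ennreal e * emeasure lborel (interior K) \<le> emeasure lborel (interior K - E)" if KD: "K \<in> \<D>" for K
  proof -
    obtain c d where K: "K = {c..d}" "c \<le> d" using D(2)[OF KD] by auto
    then show "interior K \<in> sets borel" "K \<in> sets borel" by simp_all
    have "K - interior K \<subseteq> {c, d}" using K by auto
    then show "emeasure lborel (K - interior K) = 0"
      using emeasure_mono[of "K - interior K" "{c, d}" lborel] by (simp add: emeasure_lborel_countable)
    show "ennreal e * emeasure lborel (interior K) \<le> emeasure lborel (interior K - E)"
    proof (cases "c < d")
      case True
      then show ?thesis using ge[OF True] e by (simp add: K ennreal_mult)
    qed (use K in auto)
  qed
  define I where "I = (\<Union>K\<in>\<D>. interior K)"
  have I[measurable]: "I \<in> sets borel"
    unfolding I_def using D(1) K by (intro sets.countable_UN') auto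
  have UD[measurable]: "\<Union>\<D> \<in> sets borel"
    using D(1) K by (intro sets.countable_Union) auto
  have disj: "disjoint_family_on interior \<D>"
    using D(3) by (auto simp: disjoint_family_on_def pairwise_def)
  have disj': "disjoint_family_on (\<lambda>K. interior K - E) \<D>"
    using disj by (auto simp: disjoint_family_on_def)
  have "ennreal e * emeasure lborel I = ennreal e * (\<integral>\<^sup>+K. emeasure lborel (interior K) \<partial>count_space \<D>)"
    unfolding I_def using D(1) K disj by (subst emeasure_UN_countable) auto
  also have "\<dots> = (\<integral>\<^sup>+K. ennreal e * emeasure lborel (interior K) \<partial>count_space \<D>)"
    by (rule nn_integral_cmult[symmetric]) auto
  also have "\<dots> \<le> (\<integral>\<^sup>+K. emeasure lborel (interior K - E) \<partial>count_space \<D>)"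
    using K by (intro nn_integral_mono) auto
  also have "\<dots> = emeasure lborel (\<Union>K\<in>\<D>. interior K - E)"
    using D(1) K disj' by (subst emeasure_UN_countable) auto
  \<comment> \<open>As \<open>S\<close> is part of \<open>E\<close>, whatever the cells miss of
    \<open>E\<close> belongs to the overshoot of the covering.\<close>
  also have "\<dots> \<le> emeasure lborel (\<Union>\<D> - S)"
    using D(2) interior_subset by (intro emeasure_mono) (auto simp: S_def)
  also have "\<dots> \<le> ennreal (e * s / 2)"
  proof -
    have fin': "emeasure lborel (\<Union>\<D>) < \<infinity>" using D(5) by (simp add: fmeasurable_def)
    have "measure lborel (\<Union>\<D> - S) = measure lborel (\<Union>\<D>) - measure lborel S"
      using fin' D(4) by (intro measure_Diff) auto
    also have "\<dots> \<le> e * s / 2" using D(6) by simp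
    finally have "measure lborel (\<Union>\<D> - S) \<le> e * s / 2" .
    moreover have "emeasure lborel (\<Union>\<D> - S) \<noteq> \<infinity>"
      using fin' emeasure_mono[of "\<Union>\<D> - S" "\<Union>\<D>" lborel] by (auto simp: top_unique)
    ultimately show ?thesis by (simp add: emeasure_eq_ennreal_measure ennreal_leI)
  qed
  finally have le: "ennreal e * emeasure lborel I \<le> ennreal (e * s / 2)" .
  have "(\<Union>K\<in>\<D>. K - interior K) \<in> null_sets lborel"
    using D(1) K by (intro null_sets_UN') (auto simp: null_sets_def)
  then have "emeasure lborel (I \<union> (\<Union>K\<in>\<D>. K - interior K)) = emeasure lborel I"
    by (intro emeasure_Un_null_set) auto
  moreover have "emeasure lborel S \<le> emeasure lborel (I \<union> (\<Union>K\<in>\<D>. K - interior K))"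
  proof (rule emeasure_mono)
    show "S \<subseteq> I \<union> (\<Union>K\<in>\<D>. K - interior K)" using D(4) by (auto simp: I_def)
    show "I \<union> (\<Union>K\<in>\<D>. K - interior K) \<in> sets lborel"
      using I \<open>(\<Union>K\<in>\<D>. K - interior K) \<in> null_sets lborel\<close> by (simp add: null_sets_def sets.Un)
  qed
  ultimately have "ennreal s \<le> emeasure lborel I" by (simp add: Ss)
  then have "ennreal e * ennreal s \<le> ennreal e * emeasure lborel I" by (rule mult_left_mono) simp
  with le have "ennreal (e * s) \<le> ennreal (e * s / 2)" using e s0 by (simp add: ennreal_mult)
  then show False using e s0 by (simp add: ennreal_le_iff)
qed

lemma emeasure_lborel_affine_vimage:
  fixes c t :: real
  assumes "0 < c" "X \<in> sets borel"
  shows "emeasure lborel X = ennreal c * emeasure lborel ((\<lambda>x. t + c * x) -` X)"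
proof -
  have "emeasure lborel X = (\<integral>\<^sup>+x. indicator X x \<partial>lborel)" using assms by simp
  also have "\<dots> = ennreal c * (\<integral>\<^sup>+x. indicator X (t + c * x) \<partial>lborel)"
    using assms by (subst nn_integral_real_affine[where c = c and t = t]) auto
  also have "(\<lambda>x. indicator X (t + c * x) :: ennreal) = indicator ((\<lambda>x. t + c * x) -` X)"
    by (auto simp: fun_eq_iff split: split_indicator)
  also have "(\<integral>\<^sup>+x. indicator ((\<lambda>x. t + c * x) -` X) x \<partial>lborel) = emeasure lborel ((\<lambda>x. t + c * x) -` X)"
  proof (rule nn_integral_indicator)
    have "(\<lambda>x. t + c * x) -` X \<inter> space borel \<in> sets borel"
      by (rule measurable_sets[OF _ assms(2)]) measurable
    then show "(\<lambda>x. t + c * x) -` X \<in> sets lborel" by simp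
  qed
  finally show ?thesis .
qed

text \<open>An interval missing \<open>E\<close> in proportion below
  \<open>\<delta> / (2 * M)\<close> is rescaled to the window of length \<open>2 * M\<close>;
  proportions are preserved, so the exceptional measure is below \<open>\<delta>\<close>.\<close>

lemma affine_concentration:
  fixes E :: "real set"
  assumes E: "E \<in> sets borel" "emeasure lborel E \<noteq> 0" and M: "0 < M" and \<delta>: "0 < \<delta>"
  obtains t k where "0 < k" "emeasure lborel {x \<in> {- M<..<M}. t + k * x \<notin> E} < ennreal \<delta>"
proof -
  have "0 < \<delta> / (2 * M)" using M \<delta> by simp
  then obtain a b where ab: "a < b" "emeasure lborel ({a<..<b} - E) < ennreal (\<delta> / (2 * M) * (b - a))"
    using interval_of_density[OF E] by blast
  define k where "k = (b - a) / (2 * M)"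
  define t where "t = (a + b) / 2"
  have k: "0 < k" using ab M by (simp add: k_def)
  have kM: "k * M = (b - a) / 2" using M by (simp add: k_def)
  have eq: "(\<lambda>x. t + k * x) -` ({a<..<b} - E) = {x \<in> {- M<..<M}. t + k * x \<notin> E}"
  proof -
    have ta: "t = a + k * M" "t = b - k * M" unfolding t_def kM by (simp_all add: field_simps)
    have "a < t + k * x \<longleftrightarrow> 0 < k * (M + x)" for x by (simp add: ta(1) distrib_left)
    moreover have "t + k * x < b \<longleftrightarrow> 0 < k * (M - x)" for x by (simp add: ta(2) right_diff_distrib)
    moreover have "0 < k * (M + x) \<longleftrightarrow> - M < x" "0 < k * (M - x) \<longleftrightarrow> x < M" for x
      using k by (auto simp: zero_less_mult_iff)
    ultimately show ?thesis by auto
  qed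
  have "ennreal k * emeasure lborel {x \<in> {- M<..<M}. t + k * x \<notin> E} = emeasure lborel ({a<..<b} - E)"
    using E k by (subst emeasure_lborel_affine_vimage[of k _ t]) (auto simp: eq)
  also have "\<dots> < ennreal k * ennreal \<delta>"
    using ab k \<delta> by (simp add: k_def mult_ac flip: ennreal_mult)
  finally have "emeasure lborel {x \<in> {- M<..<M}. t + k * x \<notin> E} < ennreal \<delta>"
    using mult_left_mono[of "ennreal \<delta>" _ "ennreal k"] by (meson not_le zero_le)
  with k that show thesis by blast
qed

text \<open>Three parameters move together: the level rises to 1, the window grows to the whole
  line, and the exceptional measures stay below the summable \<open>(1 / 2) ^ n\<close>. By
  Borel--Cantelli almost every point avoids all but finitely many exceptional sets, and every point
  is eventually inside the window.\<close>

lemma affine_concentration_seq: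
  fixes p :: "real \<Rightarrow> real"
  assumes p[measurable]: "p \<in> borel_measurable borel"
    and pos: "\<And>e. 0 < e \<Longrightarrow> \<not> (AE x in lborel. p x \<le> 1 - e)"
  obtains t k :: "nat \<Rightarrow> real" where "\<And>n. 0 < k n"
    "AE x in lborel. \<forall>\<^sub>F n in sequentially. 1 - 1 / real (n + 1) < p (t n + k n * x)"
proof -
  define E where "E n = {x. 1 - 1 / real (n + 1) < p x}" for n
  have E: "E n \<in> sets borel" for n unfolding E_def by measurable
  have ne: "emeasure lborel (E n) \<noteq> 0" for n
  proof
    assume "emeasure lborel (E n) = 0"
    then have "AE x in lborel. x \<notin> E n" using E by (intro AE_not_in) (simp add: null_sets_def)
    then have "AE x in lborel. p x \<le> 1 - 1 / real (n + 1)" by (simp add: E_def not_less)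
    then show False using pos[of "1 / real (n + 1)"] by simp
  qed
  define Q where "Q n q \<longleftrightarrow> 0 < snd q \<and>
    emeasure lborel {x \<in> {- real (n + 1)<..<real (n + 1)}. fst q + snd q * x \<notin> E n} < ennreal ((1 / 2) ^ n)"
    for n :: nat and q :: "real \<times> real"
  have "\<exists>q. Q n q" for n
  proof -
    have "0 < real (n + 1)" "0 < (1 / 2 :: real) ^ n" by simp_all
    then obtain t k where "0 < k" "emeasure lborel {x \<in> {- real (n + 1)<..<real (n + 1)}. t + k * x \<notin> E n} < ennreal ((1 / 2) ^ n)"
      by (rule affine_concentration[OF E ne])
    then have "Q n (t, k)" by (simp add: Q_def)
    then show ?thesis by blast
  qed
  then obtain q where q: "\<And>n. Q n (q n)" by metis
  define t where "t n = fst (q n)" for n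
  define k where "k n = snd (q n)" for n
  have tk: "\<And>n. 0 < k n"
    "\<And>n. emeasure lborel {x \<in> {- real (n + 1)<..<real (n + 1)}. t n + k n * x \<notin> E n} < ennreal ((1 / 2) ^ n)"
    using q unfolding Q_def t_def k_def by blast+
  define A where "A n = {x \<in> {- real (n + 1)<..<real (n + 1)}. t n + k n * x \<notin> E n}" for n
  have "AE x in lborel. \<forall>\<^sub>F n in sequentially. x \<in> space lborel - A n"
  proof (rule borel_cantelli_AE1)
    show "A n \<in> sets lborel" for n
      unfolding A_def E_def by measurable
    show "emeasure lborel (A n) < \<infinity>" for n
      using tk(2)[of n] unfolding A_def[symmetric] by (rule less_trans) simp
    have "measure lborel (A n) \<le> (1 / 2) ^ n" for n
      using tk(2)[of n] unfolding A_def[symmetric] measure_def by (intro enn2real_leI) auto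
    then show "summable (\<lambda>n. measure lborel (A n))"
      by (intro summable_comparison_test'[OF summable_geometric[of "1 / 2 :: real"], of 0]) auto
  qed
  then have "AE x in lborel. \<forall>\<^sub>F n in sequentially. 1 - 1 / real (n + 1) < p (t n + k n * x)"
  proof eventually_elim
    case (elim x)
    obtain N :: nat where N: "\<bar>x\<bar> < real N" using reals_Archimedean2 by blast
    then have "\<forall>\<^sub>F n in sequentially. \<bar>x\<bar> < real (n + 1)"
      by (auto simp: eventually_sequentially intro!: exI[of _ N])
    with elim show ?case
      by eventually_elim (auto simp: A_def E_def abs_less_iff)
  qed
  with tk(1) that show thesis by blast
qed

lemma disk_moebius_affine:
  assumes "0 < k"
  obtains \<phi> where "\<phi> \<in> disk_moebius" "\<And>x. \<phi> (cayley x) = cayley (t + k * x)"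
proof -
  \<comment> \<open>With \<open>cayley x = u / v\<close>, requiring
    \<open>c * u + d * v = 2 * (1 - \<i> * (t + k * x))\<close> for all \<open>x\<close> determines
    \<open>c\<close> and \<open>d\<close>. The difference of their squared moduli is
    \<open>4 * k\<close>, which is where \<open>0 < k\<close> enters.\<close>
  define c where "c = 1 - of_real k - \<i> * of_real t"
  define d where "d = 1 + of_real k - \<i> * of_real t"
  have "(cmod c)\<^sup>2 = (1 - k)\<^sup>2 + t\<^sup>2" "(cmod d)\<^sup>2 = (1 + k)\<^sup>2 + t\<^sup>2"
    by (simp_all add: cmod_power2 c_def d_def)
  then have "(cmod c)\<^sup>2 < (cmod d)\<^sup>2" using assms by (simp add: power2_eq_square algebra_simps)
  then have cd: "cmod c < cmod d" by (rule power_less_imp_less_base) simp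
  have "disk_auto 1 c d (cayley x) = cayley (t + k * x)" for x
  proof -
    define u where "u = 1 + \<i> * of_real x"
    define v where "v = 1 - \<i> * of_real x"
    have v: "v \<noteq> 0" unfolding v_def by (rule cayley_denom_nonzero)
    have "disk_auto 1 c d (cayley x) = (cnj d * (u / v) + cnj c) / (c * (u / v) + d)"
      by (simp add: disk_auto_def cayley_def u_def v_def)
    also have "\<dots> = ((cnj d * (u / v) + cnj c) * v) / ((c * (u / v) + d) * v)" using v by simp
    also have "\<dots> = (cnj d * u + cnj c * v) / (c * u + d * v)" using v by (simp add: distrib_right)
    also have "cnj d * u + cnj c * v = 2 * (1 + \<i> * of_real (t + k * x))"
      by (simp add: c_def d_def u_def v_def algebra_simps)
    also have "c * u + d * v = 2 * (1 - \<i> * of_real (t + k * x))"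
      by (simp add: c_def d_def u_def v_def algebra_simps)
    also have "2 * (1 + \<i> * of_real (t + k * x)) / (2 * (1 - \<i> * of_real (t + k * x))) = cayley (t + k * x)"
      unfolding cayley_def by (rule mult_divide_mult_cancel_left) simp
    finally show ?thesis .
  qed
  with that disk_auto_in_disk_moebius[OF norm_one cd] show thesis by blast
qed

text \<open>The norm condition is used twice: it makes every set
  \<open>\<bar>x\<bar> > 1 - e\<close> non-null, which starts the zooming, and it bounds the
  composites by 1, so that lower bounds tending to 1 give convergence.\<close>

lemma moebius_concentration:
  assumes x: "norm x = 1"
  obtains \<phi> :: "nat \<Rightarrow> complex \<Rightarrow> complex" where "\<And>n. \<phi> n \<in> disk_moebius"
    "AE z in circle. (\<lambda>n. cmod (rep_linf x (\<phi> n z))) \<longlonglongrightarrow> 1"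
proof -
  define p where "p s = cmod (rep_linf x (cayley s))" for s
  have p: "p \<in> borel_measurable borel" unfolding p_def by measurable
  have pos: "\<not> (AE s in lborel. p s \<le> 1 - e)" if "0 < e" for e
  proof
    assume "AE s in lborel. p s \<le> 1 - e"
    then have "AE z in circle. cmod (rep_linf x z) \<le> 1 - e"
      unfolding p_def by (subst AE_circle_iff_cayley) measurable
    then have "norm x \<le> 1 - e" by (rule norm_linf_le)
    with x that show False by simp
  qed
  obtain t k :: "nat \<Rightarrow> real" where tk: "\<And>n. 0 < k n"
    "AE s in lborel. \<forall>\<^sub>F n in sequentially. 1 - 1 / real (n + 1) < p (t n + k n * s)"
    using affine_concentration_seq[OF p pos] by blast
  have "\<exists>\<phi>. \<phi> \<in> disk_moebius \<and> (\<forall>s. \<phi> (cayley s) = cayley (t n + k n * s))" for n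
    by (rule disk_moebius_affine[OF tk(1)[of n], of "t n"]) blast
  then obtain \<phi> where \<phi>: "\<And>n. \<phi> n \<in> disk_moebius" "\<And>n s. \<phi> n (cayley s) = cayley (t n + k n * s)"
    by metis
  have [measurable]: "\<phi> n \<in> circle \<rightarrow>\<^sub>M circle" for n by (rule disk_moebius_measurable[OF \<phi>(1)])
  have lower: "AE z in circle. \<forall>\<^sub>F n in sequentially. 1 - 1 / real (n + 1) < cmod (rep_linf x (\<phi> n z))"
  proof (subst AE_circle_iff_cayley)
    show "{z \<in> space circle. \<forall>\<^sub>F n in sequentially. 1 - 1 / real (n + 1) < cmod (rep_linf x (\<phi> n z))} \<in> sets circle"
      by measurable
  qed (use tk(2) in \<open>simp add: \<phi> p_def\<close>)
  have "AE z in circle. \<forall>n. cmod (rep_linf x (\<phi> n z)) \<le> 1"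
    using AE_circle_disk_moebius[OF \<phi>(1) AE_le_norm_linf[of x]] x by (simp add: AE_all_countable)
  with lower have "AE z in circle. (\<lambda>n. cmod (rep_linf x (\<phi> n z))) \<longlonglongrightarrow> 1"
  proof eventually_elim
    case (elim z)
    have "(\<lambda>n. 1 - 1 / real (n + 1)) \<longlonglongrightarrow> 1 - 0"
      using LIMSEQ_ignore_initial_segment[OF lim_1_over_n, of 1] by (intro tendsto_diff tendsto_const) simp
    then have lim: "(\<lambda>n. 1 - 1 / real (n + 1)) \<longlonglongrightarrow> 1" by (simp only: diff_zero)
    show ?case
    proof (rule tendsto_sandwich[OF _ _ lim tendsto_const])
      show "\<forall>\<^sub>F n in sequentially. 1 - 1 / real (n + 1) \<le> cmod (rep_linf x (\<phi> n z))"
        using elim(1) by (rule eventually_mono) (rule less_imp_le)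
      show "\<forall>\<^sub>F n in sequentially. cmod (rep_linf x (\<phi> n z)) \<le> 1"
        using elim(2) by simp
    qed
  qed
  with \<phi>(1) that show thesis by blast
qed

section \<open>Weak-star closures\<close>

lemma topspace_weak_star [simp]: "topspace weak_star = UNIV"
proof -
  have "UNIV \<in> {{f. (LINT z|circle. rep_linf f z * g z) \<in> U} | g U.
        integrable circle (g :: complex \<Rightarrow> complex) \<and> open (U :: complex set)}"
    by (auto intro!: exI[of _ "\<lambda>_. 0"] exI[of _ UNIV])
  then show ?thesis unfolding weak_star_def topology_generated_by_topspace by blast
qed

lemma finite_measure_circle: "finite_measure circle"
  by (rule finite_measureI) (subst emeasure_circle, simp)

text \<open>Eventual membership is stable under finite intersections and arbitrary unions, so
  induction over the generated topology reduces it to the subbasic sets, where it is convergence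
  against a single \<open>g\<close>.\<close>

lemma weak_star_eventually:
  assumes lim: "\<And>g :: complex \<Rightarrow> complex. integrable circle g \<Longrightarrow>
      (\<lambda>n. LINT z|circle. rep_linf (y n) z * g z) \<longlonglongrightarrow> (LINT z|circle. rep_linf x z * g z)"
    and U: "openin weak_star U" "x \<in> U"
  shows "\<forall>\<^sub>F n in sequentially. y n \<in> U"
proof -
  have "generate_topology_on {{f. (LINT z|circle. rep_linf f z * g z) \<in> U} | g U.
        integrable circle (g :: complex \<Rightarrow> complex) \<and> open (U :: complex set)} U"
    using U(1) by (simp add: weak_star_def openin_topology_generated_by_iff)
  from this U(2) show ?thesis
  proof (induction U)
    case (Int a b)
    then show ?case by (simp add: eventually_conj)
  next
    case (UN K)
    then obtain k where k: "k \<in> K" "x \<in> k" by blast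
    with UN have "\<forall>\<^sub>F n in sequentially. y n \<in> k" by blast
    then show ?case by (rule eventually_mono) (use k in blast)
  next
    case (Basis s)
    then obtain g U where s: "s = {f. (LINT z|circle. rep_linf f z * g z) \<in> U}"
      and g: "integrable circle (g :: complex \<Rightarrow> complex)" and V: "open U" by blast
    have "(LINT z|circle. rep_linf x z * g z) \<in> U" using Basis s by simp
    with lim[OF g] V have "\<forall>\<^sub>F n in sequentially. (LINT z|circle. rep_linf (y n) z * g z) \<in> U"
      by (rule topological_tendstoD)
    then show ?case by (simp add: s)
  qed simp
qed

text \<open>As the \<open>y n\<close> lie in the unit ball, \<open>\<bar>g\<bar>\<close> dominates
  and pointwise convergence becomes weak-star convergence; one convergent sequence already witnesses
  membership in the closure.\<close>

lemma weak_star_closure_sequentially: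
  assumes x: "x \<in> A" and y: "\<And>n. y n \<in> C" and C: "C \<subseteq> A"
    and bound: "\<And>n. norm (y n) \<le> 1"
    and conv: "AE z in circle. (\<lambda>n. rep_linf (y n) z) \<longlonglongrightarrow> rep_linf x z"
  shows "x \<in> (subtopology weak_star A) closure_of C"
  unfolding in_closure_of
proof (intro conjI allI impI)
  show "x \<in> topspace (subtopology weak_star A)" using x by simp
  fix T assume "x \<in> T \<and> openin (subtopology weak_star A) T"
  then obtain U where U: "openin weak_star U" "T = U \<inter> A" "x \<in> U" by (auto simp: openin_subtopology)
  have "(\<lambda>n. LINT z|circle. rep_linf (y n) z * g z) \<longlonglongrightarrow> (LINT z|circle. rep_linf x z * g z)"
    if g: "integrable circle g" for g :: "complex \<Rightarrow> complex"
  proof (rule integral_dominated_convergence[where w = "\<lambda>z. cmod (g z)"])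
    have gm[measurable]: "g \<in> borel_measurable circle" using g by auto
    show "(\<lambda>z. rep_linf x z * g z) \<in> borel_measurable circle" by measurable
    show "(\<lambda>z. rep_linf (y n) z * g z) \<in> borel_measurable circle" for n by measurable
    show "integrable circle (\<lambda>z. cmod (g z))" using g by (rule integrable_norm)
    show "AE z in circle. (\<lambda>n. rep_linf (y n) z * g z) \<longlonglongrightarrow> rep_linf x z * g z"
      using conv by eventually_elim (intro tendsto_intros)
    show "AE z in circle. cmod (rep_linf (y n) z * g z) \<le> cmod (g z)" for n
      using AE_le_norm_linf[of "y n"]
    proof eventually_elim
      case (elim z)
      then have "cmod (rep_linf (y n) z) \<le> 1" using bound[of n] by simp
      then show ?case by (simp add: norm_mult mult_left_le_one_le)
    qed
  qed
  then have "\<forall>\<^sub>F n in sequentially. y n \<in> U" using U(1,3) by (rule weak_star_eventually)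
  then obtain n where "y n \<in> U" by (auto simp: eventually_sequentially)
  then show "\<exists>z. z \<in> C \<and> z \<in> T" using y[of n] C U(2) by blast
qed

text \<open>A function of norm greater than one is separated from the unit ball by integration against its
  conjugate phase on the set where its modulus exceeds one.\<close>

lemma weak_star_closure_norm_le:
  assumes C: "\<And>f. f \<in> C \<Longrightarrow> norm f \<le> 1"
    and x: "x \<in> (subtopology weak_star A) closure_of C"
  shows "norm x \<le> 1"
proof (rule ccontr)
  assume not: "\<not> norm x \<le> 1"
  interpret finite_measure circle by (rule finite_measure_circle)
  define E where "E = {z \<in> space circle. 1 < cmod (rep_linf x z)}"
  have E[measurable]: "E \<in> sets circle" unfolding E_def by measurable
  define g where "g z = complex_of_real (indicator E z) * cnj (sgn (rep_linf x z))" for z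
  have cnj_m: "cnj \<in> borel_measurable borel" by (intro borel_measurable_continuous_onI continuous_intros)
  have sgn_m: "(\<lambda>z. sgn (rep_linf x z)) \<in> borel_measurable circle" unfolding sgn_div_norm by measurable
  note [measurable] = measurable_compose[OF sgn_m cnj_m]
  have gm[measurable]: "g \<in> borel_measurable circle" unfolding g_def by measurable
  have g_le: "cmod (g z) \<le> indicator E z" for z
    by (auto simp: g_def norm_mult norm_sgn split: split_indicator)
  have [simp]: "E \<inter> sphere 0 1 = E" by (auto simp: E_def)
  have int_E: "integrable circle (\<lambda>z. indicator E z :: real)"
    by (rule integrable_real_indicator) (simp_all add: less_top[symmetric])
  have g: "integrable circle g"
    by (rule Bochner_Integration.integrable_bound[OF int_E]) (use g_le in simp_all)
  have xg: "rep_linf x z * g z = of_real (indicator E z * cmod (rep_linf x z))" for z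
  proof -
    have "w * cnj (sgn w) = of_real (cmod w)" for w :: complex
      using complex_norm_square[of w]
      by (cases "w = 0") (simp_all add: sgn_div_norm scaleR_conv_of_real power2_eq_square field_simps)
    then show ?thesis by (simp add: g_def mult_ac)
  qed
  have int_xg: "integrable circle (\<lambda>z. rep_linf f z * g z)" for f
  proof (rule Bochner_Integration.integrable_bound)
    show "integrable circle (\<lambda>z. norm f * cmod (g z))" using g by auto
    show "AE z in circle. norm (rep_linf f z * g z) \<le> norm (norm f * cmod (g z))"
      using AE_le_norm_linf[of f] by eventually_elim (simp add: norm_mult mult_right_mono)
  qed measurable
  have int_Ex: "integrable circle (\<lambda>z. indicator E z * cmod (rep_linf x z))"
    using integrable_norm[OF int_xg[of x]] unfolding xg norm_of_real by simp
  \<comment> \<open>For \<open>x\<close> the pairing with \<open>g\<close> is the integral of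
    \<open>\<bar>x\<bar>\<close> over \<open>E\<close>; for an element of the unit ball its modulus
    is at most \<open>measure circle E\<close>. This open half plane separates the two.\<close>
  define U where "U = {w. measure circle E < Re w}"
  have "open U" unfolding U_def by (rule open_halfspace_Re_gt)
  then have opn: "openin weak_star {f. (LINT z|circle. rep_linf f z * g z) \<in> U}"
    unfolding weak_star_def using g by (intro topology_generated_by_Basis) blast
  have "measure circle E < (LINT z|circle. indicator E z * cmod (rep_linf x z))"
  proof -
    have nonneg: "0 \<le> indicator E z * cmod (rep_linf x z) - indicator E z" for z
      by (auto simp: E_def split: split_indicator)
    have int: "integrable circle (\<lambda>z. indicator E z * cmod (rep_linf x z) - indicator E z)"
      using int_Ex int_E by (rule Bochner_Integration.integrable_diff)
    \<comment> \<open>A vanishing integral would give \<open>\<bar>x\<bar> = 1\<close> almost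
      everywhere on \<open>E\<close>, where \<open>\<bar>x\<bar>\<close> exceeds 1; then
      \<open>E\<close> would be null and \<open>norm x \<le> 1\<close>.\<close>
    have "(LINT z|circle. indicator E z * cmod (rep_linf x z) - indicator E z) \<noteq> 0"
    proof
      assume "(LINT z|circle. indicator E z * cmod (rep_linf x z) - indicator E z) = 0"
      then have "AE z in circle. indicator E z * cmod (rep_linf x z) - indicator E z = 0"
        using integral_nonneg_eq_0_iff_AE[OF int] nonneg by simp
      then have "AE z in circle. cmod (rep_linf x z) \<le> 1"
        using AE_space by eventually_elim (auto simp: E_def split: split_indicator_asm)
      then have "norm x \<le> 1" by (rule norm_linf_le)
      with not show False ..
    qed
    moreover have "0 \<le> (LINT z|circle. indicator E z * cmod (rep_linf x z) - indicator E z)"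
      by (rule Bochner_Integration.integral_nonneg) (use nonneg in auto)
    ultimately have "0 < (LINT z|circle. indicator E z * cmod (rep_linf x z) - indicator E z)" by simp
    also have "\<dots> = (LINT z|circle. indicator E z * cmod (rep_linf x z)) - measure circle E"
      using int_Ex int_E by (subst Bochner_Integration.integral_diff) auto
    finally show ?thesis by simp
  qed
  moreover have "(LINT z|circle. rep_linf x z * g z) = of_real (LINT z|circle. indicator E z * cmod (rep_linf x z))"
    unfolding xg by (rule integral_complex_of_real)
  ultimately have "x \<in> {f. (LINT z|circle. rep_linf f z * g z) \<in> U}" by (simp add: U_def)
  moreover have "x \<in> A" using x by (simp add: in_closure_of)
  ultimately have "x \<in> {f. (LINT z|circle. rep_linf f z * g z) \<in> U} \<inter> A" by simp
  moreover have "openin (subtopology weak_star A) ({f. (LINT z|circle. rep_linf f z * g z) \<in> U} \<inter> A)"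
    using opn by (rule openin_subtopology_Int)
  ultimately have "\<exists>f. f \<in> C \<and> f \<in> {f. (LINT z|circle. rep_linf f z * g z) \<in> U} \<inter> A"
    using x unfolding in_closure_of by (elim conjE allE impE) (rule conjI)
  then obtain f where f: "f \<in> C" "(LINT z|circle. rep_linf f z * g z) \<in> U" by blast
  have "Re (LINT z|circle. rep_linf f z * g z) \<le> cmod (LINT z|circle. rep_linf f z * g z)"
    by (rule complex_Re_le_cmod)
  also have "\<dots> \<le> (LINT z|circle. cmod (rep_linf f z * g z))" by (rule integral_norm_bound)
  also have "\<dots> \<le> (LINT z|circle. indicator E z)"
  proof (rule integral_mono_AE[OF integrable_norm[OF int_xg] int_E])
    show "AE z in circle. cmod (rep_linf f z * g z) \<le> indicator E z"
      using AE_le_norm_linf[of f]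
    proof eventually_elim
      case (elim z)
      then have "cmod (rep_linf f z) \<le> 1" using C[OF f(1)] by simp
      then have "cmod (rep_linf f z) * cmod (g z) \<le> 1 * indicator E z"
        using g_le[of z] by (intro mult_mono) auto
      then show ?case by (simp add: norm_mult)
    qed
  qed
  also have "\<dots> = measure circle E" by simp
  finally show False using f(2) by (simp add: U_def)
qed

lemma convex_hull_subset_sub_cstar:
  assumes "sub_cstar_algebra A" "S \<subseteq> A"
  shows "convex hull S \<subseteq> A"
proof (rule hull_minimal[OF assms(2)])
  show "convex A"
    unfolding convex_def using assms(1) by (auto intro!: sub_cstarD(2) sub_cstar_scaleR)
qed

lemma convex_hull_norm_le:
  fixes S :: "'a::real_normed_vector set"
  assumes "\<And>f. f \<in> S \<Longrightarrow> norm f \<le> r" "f \<in> convex hull S"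
  shows "norm f \<le> r"
proof -
  have "convex hull S \<subseteq> cball 0 r" by (rule hull_minimal) (use assms(1) in auto)
  then show ?thesis using assms(2) by auto
qed

lemma ball_subset_weak_star_closure:
  assumes A: "sub_cstar_algebra A"
    and comp: "\<And>f \<phi>. f \<in> A \<Longrightarrow> \<phi> \<in> disk_moebius \<Longrightarrow> compose_linf f \<phi> \<in> A"
    and x: "x \<in> A" "norm x = 1" and y: "y \<in> A" "norm y \<le> 1"
  shows "y \<in> (subtopology weak_star A) closure_of
    (convex hull {u * compose_linf x \<phi> | u \<phi>. u \<in> A \<and> unimodular u \<and> \<phi> \<in> disk_moebius})"
    (is "y \<in> _ closure_of (convex hull ?S)")
proof -
  obtain \<phi> :: "nat \<Rightarrow> complex \<Rightarrow> complex" where \<phi>: "\<And>n. \<phi> n \<in> disk_moebius"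
    and lim: "AE z in circle. (\<lambda>n. cmod (rep_linf x (\<phi> n z))) \<longlonglongrightarrow> 1"
    using moebius_concentration[OF x(2)] by blast
  define h where "h n = compose_linf x (\<phi> n)" for n
  have hA: "h n \<in> A" and h1: "norm (h n) = 1" for n
    unfolding h_def using comp x \<phi> by (auto simp: norm_compose_linf)
  \<comment> \<open>Values in \<open>[1/2, 1)\<close> tending to 1: staying strictly below 1 puts
    \<open>a n\<close> into the open unit ball, as the Russo--Dye approximation demands.\<close>
  define c where "c n = 1 - 1 / real (n + 2)" for n
  have c: "0 \<le> c n" "c n < 1" for n by (auto simp: c_def)
  define a where "a n = c n *\<^sub>R (cnj_linf (h n) * y)" for n
  have aA: "a n \<in> A" for n
    unfolding a_def by (intro sub_cstar_scaleR[OF A] sub_cstarD[OF A] hA y)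
  have a1: "norm (a n) < 1" for n
  proof -
    have "norm (cnj_linf (h n) * y) \<le> 1 * 1"
      using y(2) h1[of n] by (intro order_trans[OF norm_mult_ineq] mult_mono) (auto simp: norm_cnj_linf)
    then have "norm (a n) \<le> c n" using c[of n] by (simp add: a_def mult_left_le)
    then show ?thesis using c(2)[of n] by simp
  qed
  have "\<exists>v. v \<in> convex hull {u \<in> A. unimodular u} \<and> norm (v - a n) \<le> 1 / real (n + 1)" for n
    by (rule russo_dye[OF A aA[of n] a1[of n], of "1 / real (n + 1)"]) auto
  then obtain v where v: "\<And>n. v n \<in> convex hull {u \<in> A. unimodular u}"
    "\<And>n. norm (v n - a n) \<le> 1 / real (n + 1)" by metis
  have S: "?S \<subseteq> A" using comp x(1) by (auto intro: sub_cstarD(4)[OF A])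
  have S1: "norm f \<le> 1" if "f \<in> ?S" for f
    using that by (auto simp: norm_unimodular_mult norm_compose_linf x(2))
  have vh: "v n * h n \<in> convex hull ?S" for n
  proof -
    \<comment> \<open>Multiplication by the fixed \<open>h n\<close> is linear, so it commutes with
      convex hulls, and it sends each unimodular \<open>u\<close> to a point of the orbit.\<close>
    have "linear (\<lambda>v. v * h n)" by (intro linearI) (simp_all add: distrib_right)
    then have "(\<lambda>v. v * h n) ` (convex hull {u \<in> A. unimodular u})
        = convex hull ((\<lambda>v. v * h n) ` {u \<in> A. unimodular u})" by (rule convex_hull_linear_image)
    moreover have "convex hull ((\<lambda>v. v * h n) ` {u \<in> A. unimodular u}) \<subseteq> convex hull ?S"
      using \<phi> by (intro hull_mono) (auto simp: h_def)
    ultimately show ?thesis using v(1)[of n] by blast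
  qed
  show ?thesis
  proof (rule weak_star_closure_sequentially[OF y(1)])
    show "v n * h n \<in> convex hull ?S" for n by (rule vh)
    show "convex hull ?S \<subseteq> A" by (rule convex_hull_subset_sub_cstar[OF A S])
    \<comment> \<open>The domination bound comes from membership in the hull; closeness of
      \<open>v n\<close> to \<open>a n\<close> alone would allow norms slightly above 1.\<close>
    show "norm (v n * h n) \<le> 1" for n by (rule convex_hull_norm_le[OF S1 vh])
    have "AE z in circle. \<forall>n. rep_linf (v n * h n) z = rep_linf (v n) z * rep_linf (h n) z"
      by (simp add: AE_all_countable rep_linf_mult)
    moreover have "AE z in circle. \<forall>n. rep_linf (h n) z = rep_linf x (\<phi> n z)"
      unfolding h_def using \<phi> by (simp add: AE_all_countable rep_compose_linf)
    moreover have "AE z in circle. \<forall>n. rep_linf (a n) z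
        = of_real (c n) * (cnj (rep_linf (h n) z) * rep_linf y z)"
      unfolding AE_all_countable
    proof
      fix n
      show "AE z in circle. rep_linf (a n) z = of_real (c n) * (cnj (rep_linf (h n) z) * rep_linf y z)"
        unfolding a_def using rep_linf_scaleR[of "c n" "cnj_linf (h n) * y"]
          rep_linf_mult[of "cnj_linf (h n)" y] rep_linf_cnj[of "h n"]
        by eventually_elim simp
    qed
    moreover have "AE z in circle. \<forall>n. cmod (rep_linf (v n) z - rep_linf (a n) z) \<le> 1 / real (n + 1)"
      unfolding AE_all_countable
    proof
      fix n
      show "AE z in circle. cmod (rep_linf (v n) z - rep_linf (a n) z) \<le> 1 / real (n + 1)"
        using AE_le_norm_linf[of "v n - a n"] rep_linf_diff[of "v n" "a n"]
        by eventually_elim (use v(2)[of n] in simp)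
    qed
    moreover have "AE z in circle. \<forall>n. cmod (rep_linf (h n) z) \<le> 1"
      unfolding AE_all_countable using AE_le_norm_linf[of "h n" for n] unfolding h1 by blast
    ultimately show "AE z in circle. (\<lambda>n. rep_linf (v n * h n) z) \<longlonglongrightarrow> rep_linf y z"
      using lim
    proof eventually_elim
      case (elim z)
      have c1: "c \<longlonglongrightarrow> 1 - 0"
        unfolding c_def using LIMSEQ_ignore_initial_segment[OF lim_1_over_n, of 2]
        by (intro tendsto_diff tendsto_const) simp
      have r0: "(\<lambda>n. 1 / real (n + 1)) \<longlonglongrightarrow> 0"
        using LIMSEQ_ignore_initial_segment[OF lim_1_over_n, of 1] by simp
      have h1: "(\<lambda>n. cmod (rep_linf (h n) z)) \<longlonglongrightarrow> 1" using elim(2,6) by simp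
      have "(\<lambda>n. (rep_linf (v n) z - rep_linf (a n) z) * rep_linf (h n) z) \<longlonglongrightarrow> 0"
      proof (rule Lim_null_comparison[OF _ r0])
        show "\<forall>\<^sub>F n in sequentially. cmod ((rep_linf (v n) z - rep_linf (a n) z) * rep_linf (h n) z) \<le> 1 / real (n + 1)"
        proof (intro always_eventually allI)
          fix n
          have "cmod ((rep_linf (v n) z - rep_linf (a n) z) * rep_linf (h n) z) \<le> 1 / real (n + 1) * 1"
            unfolding norm_mult using elim(4,5) by (intro mult_mono) auto
          then show "cmod ((rep_linf (v n) z - rep_linf (a n) z) * rep_linf (h n) z) \<le> 1 / real (n + 1)" by simp
        qed
      qed
      moreover have "(\<lambda>n. of_real (c n * (cmod (rep_linf (h n) z))\<^sup>2) * rep_linf y z) \<longlonglongrightarrow> of_real ((1 - 0) * 1\<^sup>2) * rep_linf y z"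
        by (intro tendsto_intros c1 h1)
      ultimately have "(\<lambda>n. (rep_linf (v n) z - rep_linf (a n) z) * rep_linf (h n) z
          + of_real (c n * (cmod (rep_linf (h n) z))\<^sup>2) * rep_linf y z) \<longlonglongrightarrow> 0 + of_real ((1 - 0) * 1\<^sup>2) * rep_linf y z"
        by (rule tendsto_add)
      \<comment> \<open>The first summand is the approximation error times \<open>h n\<close>; the
        second is \<open>a n * h n\<close>, with \<open>cnj h * h\<close> written as a squared
        modulus.\<close>
      moreover have "(rep_linf (v n) z - rep_linf (a n) z) * rep_linf (h n) z
          + of_real (c n * (cmod (rep_linf (h n) z))\<^sup>2) * rep_linf y z = rep_linf (v n * h n) z" for n
        using elim(1,3) unfolding of_real_mult complex_norm_square by (simp add: algebra_simps)
      ultimately show ?case by simp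
    qed
  qed
qed

section \<open>The group of weighted composition operators\<close>

definition weighted_composition :: "linf set \<Rightarrow> linf \<Rightarrow> (complex \<Rightarrow> complex) \<Rightarrow> linf \<Rightarrow> linf" where
  "weighted_composition A u \<phi> = (\<lambda>f\<in>A. u * compose_linf f \<phi>)"

text \<open>Solving \<open>g = u * (f \<circ> \<phi>)\<close> for \<open>f\<close> gives
  \<open>f = (cnj u \<circ> \<psi>) * (g \<circ> \<psi>)\<close> with \<open>\<psi>\<close> inverse
  to \<open>\<phi>\<close>. The new weight stays in \<open>A\<close> because \<open>A\<close> is
  closed under conjugation and composition.\<close>

lemma weighted_composition_in_Bij:
  assumes A: "sub_cstar_algebra A"
    and comp: "\<And>f \<phi>. f \<in> A \<Longrightarrow> \<phi> \<in> disk_moebius \<Longrightarrow> compose_linf f \<phi> \<in> A"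
    and u: "u \<in> A" "unimodular u" and \<phi>: "\<phi> \<in> disk_moebius"
  obtains w \<psi> where "w \<in> A" "unimodular w" "\<psi> \<in> disk_moebius"
    "weighted_composition A u \<phi> \<in> Bij A"
    "m_inv (BijGroup A) (weighted_composition A u \<phi>) = weighted_composition A w \<psi>"
proof -
  obtain \<psi> where \<psi>: "\<psi> \<in> disk_moebius" "\<And>z. cmod z \<le> 1 \<Longrightarrow> \<psi> (\<phi> z) = z"
    "\<And>z. cmod z \<le> 1 \<Longrightarrow> \<phi> (\<psi> z) = z" using disk_moebius_inverse[OF \<phi>] by metis
  define w where "w = compose_linf (cnj_linf u) \<psi>"
  have w: "w \<in> A" "unimodular w"
    unfolding w_def using comp sub_cstarD(5)[OF A] u \<psi>(1) by (auto intro: unimodular_compose unimodular_cnj)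
  let ?T = "weighted_composition A u \<phi>" and ?R = "weighted_composition A w \<psi>"
  have TA: "?T f \<in> A" "?R f \<in> A" if "f \<in> A" for f
    using that comp u w \<phi> \<psi> by (auto simp: weighted_composition_def intro: sub_cstarD(4)[OF A])
  have RT: "?R (?T f) = f" if f: "f \<in> A" for f
  proof -
    have "?R (?T f) = compose_linf (cnj_linf u) \<psi> * compose_linf (u * compose_linf f \<phi>) \<psi>"
      using f TA[OF f] by (simp add: weighted_composition_def w_def)
    also have "\<dots> = compose_linf (cnj_linf u * u) \<psi> * compose_linf (compose_linf f \<phi>) \<psi>"
      by (simp add: compose_linf_mult[OF \<psi>(1)] mult.assoc)
    also have "\<dots> = f"
      by (simp add: cnj_mult_unimodular[OF u(2)] compose_linf_one[OF \<psi>(1)] compose_linf_inverse[OF \<phi> \<psi>(1,3)])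
    finally show ?thesis .
  qed
  have TR: "?T (?R f) = f" if f: "f \<in> A" for f
  proof -
    have "?T (?R f) = u * compose_linf (compose_linf (cnj_linf u) \<psi> * compose_linf f \<psi>) \<phi>"
      using f TA[OF f] by (simp add: weighted_composition_def w_def)
    also have "\<dots> = (cnj_linf u * u) * f"
      by (simp add: compose_linf_mult[OF \<phi>] compose_linf_inverse[OF \<psi>(1) \<phi> \<psi>(2)] mult_ac)
    finally show ?thesis by (simp add: cnj_mult_unimodular[OF u(2)])
  qed
  have bij: "bij_betw ?T A A" by (rule bij_betwI[of _ _ _ ?R]) (use TA RT TR in auto)
  then have T: "?T \<in> Bij A" by (simp add: Bij_def weighted_composition_def)
  have "inv_into A ?T f = ?R f" if "f \<in> A" for f
    using that bij TA TR by (metis bij_betw_inv_into_left)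
  then have "m_inv (BijGroup A) ?T = (\<lambda>f\<in>A. ?R f)"
    unfolding inv_BijGroup[OF T] by (intro restrict_ext) simp
  also have "\<dots> = ?R" by (simp add: weighted_composition_def fun_eq_iff)
  finally show thesis using that[OF w \<psi>(1) T] by simp
qed

lemma isometry_group_weighted_composition:
  assumes A: "sub_cstar_algebra A"
    and comp: "\<And>f \<phi>. f \<in> A \<Longrightarrow> \<phi> \<in> disk_moebius \<Longrightarrow> compose_linf f \<phi> \<in> A"
  shows "isometry_group A (weighted_composition_operators A)"
proof -
  have G: "weighted_composition_operators A
      = {weighted_composition A u \<phi> | u \<phi>. u \<in> A \<and> unimodular u \<and> \<phi> \<in> disk_moebius}"
    by (simp add: weighted_composition_operators_def weighted_composition_def)
  note bij = weighted_composition_in_Bij[OF A comp]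
  have Bij: "weighted_composition A u \<phi> \<in> Bij A" if "u \<in> A" "unimodular u" "\<phi> \<in> disk_moebius" for u \<phi>
    by (rule bij[OF _ _ that]) auto
  interpret group "BijGroup A" by (rule group_BijGroup)
  have "subgroup (weighted_composition_operators A) (BijGroup A)"
  proof (rule subgroupI)
    show "weighted_composition_operators A \<subseteq> carrier (BijGroup A)"
      unfolding G using Bij by (auto simp: BijGroup_def)
    show "weighted_composition_operators A \<noteq> {}"
    proof -
      obtain \<kappa> where "\<kappa> \<in> disk_moebius" by (rule disk_moebius_id)
      then show ?thesis unfolding G using sub_cstarD(1)[OF A] unimodular_one by blast
    qed
  next
    fix T assume "T \<in> weighted_composition_operators A"
    then obtain u \<phi> where T: "T = weighted_composition A u \<phi>" and u: "u \<in> A" "unimodular u" "\<phi> \<in> disk_moebius"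
      unfolding G by blast
    show "inv\<^bsub>BijGroup A\<^esub> T \<in> weighted_composition_operators A"
      unfolding T by (rule bij[OF _ _ u]) (auto simp: G)
  next
    fix T R assume "T \<in> weighted_composition_operators A" "R \<in> weighted_composition_operators A"
    then obtain u \<phi> v \<psi> where T: "T = weighted_composition A u \<phi>" and u: "u \<in> A" "unimodular u" "\<phi> \<in> disk_moebius"
      and R: "R = weighted_composition A v \<psi>" and v: "v \<in> A" "unimodular v" "\<psi> \<in> disk_moebius"
      unfolding G by blast
    \<comment> \<open>Applying \<open>R\<close> and then \<open>T\<close> turns \<open>f\<close>
      into \<open>u * (v \<circ> \<phi>) * (f \<circ> \<psi> \<circ> \<phi>)\<close>: the symbols
      compose in the order opposite to the operators.\<close>
    obtain \<rho> where \<rho>: "\<rho> \<in> disk_moebius" "\<And>z. cmod z \<le> 1 \<Longrightarrow> \<rho> z = \<psi> (\<phi> z)"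
      using disk_moebius_compose[OF v(3) u(3)] by blast
    let ?w = "u * compose_linf v \<phi>"
    have w: "?w \<in> A" "unimodular ?w"
      using u v comp by (auto intro: sub_cstarD(4)[OF A] unimodular_mult unimodular_compose)
    \<comment> \<open>Elements of \<open>BijGroup A\<close> are extensional, so equality is also
      checked off \<open>A\<close>, where both sides are \<open>undefined\<close>.\<close>
    have "compose A T R = weighted_composition A ?w \<rho>"
    proof
      fix f
      show "compose A T R f = weighted_composition A ?w \<rho> f"
      proof (cases "f \<in> A")
        case True
        then have "v * compose_linf f \<psi> \<in> A" using comp v by (auto intro: sub_cstarD(4)[OF A])
        then have "compose A T R f = u * compose_linf (v * compose_linf f \<psi>) \<phi>"
          using True by (simp add: T R compose_def weighted_composition_def)
        also have "\<dots> = ?w * compose_linf (compose_linf f \<psi>) \<phi>"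
          by (simp add: compose_linf_mult[OF u(3)] mult.assoc)
        also have "compose_linf (compose_linf f \<psi>) \<phi> = compose_linf f \<rho>"
          using \<rho> by (intro compose_linf_compose u v) auto
        finally show ?thesis using True by (simp add: weighted_composition_def)
      qed (simp add: compose_def weighted_composition_def)
    qed
    moreover have "T \<in> Bij A" "R \<in> Bij A" using Bij u v by (simp_all add: T R)
    ultimately have "T \<otimes>\<^bsub>BijGroup A\<^esub> R = weighted_composition A ?w \<rho>" by (simp add: BijGroup_def)
    then show "T \<otimes>\<^bsub>BijGroup A\<^esub> R \<in> weighted_composition_operators A"
      using w \<rho>(1) unfolding G by auto
  qed
  moreover have "(\<forall>f\<in>A. \<forall>g\<in>A. T (f + g) = T f + T g) \<and>
             (\<forall>c. \<forall>f\<in>A. T (scaleC_linf c f) = scaleC_linf c (T f)) \<and>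
             (\<forall>f\<in>A. norm (T f) = norm f)" if TG: "T \<in> weighted_composition_operators A" for T
  proof -
    obtain u \<phi> where T: "T = weighted_composition A u \<phi>" and u: "u \<in> A" "unimodular u" "\<phi> \<in> disk_moebius"
      using TG unfolding G by blast
    have "u * scaleC_linf c f = scaleC_linf c (u * f)" for c f
      using scaleC_mult_left_linf[of c f u] by (simp add: mult.commute)
    then show ?thesis
      using sub_cstarD(2,3)[OF A] u unfolding T
      by (auto simp: weighted_composition_def compose_linf_add compose_linf_scaleC distrib_left
          norm_unimodular_mult norm_compose_linf)
  qed
  ultimately show ?thesis by (simp add: isometry_group_def)
qed

theorem theorem4p4:
  fixes Y :: "(complex \<Rightarrow> complex) set" and A :: "linf set"
  assumes "linear_subspace_Hinf Y"
    and "\<And>f \<phi>. f \<in> Y \<Longrightarrow> \<phi> \<in> disk_moebius \<Longrightarrow> disk_compose f \<phi> \<in> Y"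
    and "A = cstar_generated (boundary_function ` Y)"
  shows "weak_star_convex_transitive A (weighted_composition_operators A)"
proof -
  have A: "sub_cstar_algebra A" unfolding assms(3) by (rule sub_cstar_algebra_generated)
  \<comment> \<open>This serves both conclusions: the operators map \<open>A\<close> into itself,
    and the targets \<open>c_n * cnj h_n * y\<close> of the approximation lie in
    \<open>A\<close>.\<close>
  have comp: "compose_linf f \<phi> \<in> A" if "f \<in> A" "\<phi> \<in> disk_moebius" for f \<phi>
    using that assms(1,2) unfolding assms(3)
    by (intro compose_linf_generated) (auto simp: linear_subspace_Hinf_def)
  have "(subtopology weak_star A) closure_of (convex hull {T x |T. T \<in> weighted_composition_operators A})
      = {y \<in> A. norm y \<le> 1}" if x: "x \<in> A" "norm x = 1" for x
  proof -
    let ?S = "{u * compose_linf x \<phi> | u \<phi>. u \<in> A \<and> unimodular u \<and> \<phi> \<in> disk_moebius}"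
    have S: "{T x |T. T \<in> weighted_composition_operators A} = ?S"
    proof -
      have "{T x |T. T \<in> weighted_composition_operators A}
          = {(\<lambda>f\<in>A. u * compose_linf f \<phi>) x | u \<phi>. u \<in> A \<and> unimodular u \<and> \<phi> \<in> disk_moebius}"
        unfolding weighted_composition_operators_def by blast
      then show ?thesis using x(1) by simp
    qed
    have S1: "norm f \<le> 1" if "f \<in> ?S" for f
      using that by (auto simp: norm_unimodular_mult norm_compose_linf x(2))
    show ?thesis
      unfolding S
    proof (intro equalityI subsetI CollectI conjI)
      fix y assume y: "y \<in> (subtopology weak_star A) closure_of (convex hull ?S)"
      then show "y \<in> A" by (simp add: in_closure_of)
      show "norm y \<le> 1" by (rule weak_star_closure_norm_le[OF convex_hull_norm_le[OF S1] y])
    next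
      fix y assume "y \<in> {y \<in> A. norm y \<le> 1}"
      then show "y \<in> (subtopology weak_star A) closure_of (convex hull ?S)"
        by (intro ball_subset_weak_star_closure[OF A comp x]) auto
    qed
  qed
  with isometry_group_weighted_composition[OF A comp] show ?thesis
    by (simp add: weak_star_convex_transitive_def)
qed

end
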